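(* Let $\mathbf C$ be a $2$-category, and let $F\colon \mathbf C^{\mathrm{op}}\to \mathbf{Cat}$ be a normal pseudo-functor. The following statements are equivalent. (i) The normal pseudo-functor $F$ has a bi-representation $(I,\rho)$. (ii) There is an object $I\in \mathbf C$ together with an object $i\in FI$ such that $(I,i)$ is bi-initial in $\mathbf{el}(F)$ and $(I,\mathrm{id}_i)$ is bi-initial in $\mathbf{mor}(F)$. (iii) There is an object $I\in \mathbf C$ together with an object $i\in FI$ such that $(I,\mathrm{id}_i)$ is bi-initial in $\mathbf{mor}(F)$.
   Context: **$2$-categories.** $\mathbf{Cat}$ is the $2$-category of categories, functors and natural transformations; $\mathbf C^{\mathrm{op}}$ reverses morphisms but not $2$-morphisms. A normal pseudo-functor $F\colon\mathbf A\to\mathbf B$ between (strict) $2$-categories consists of an assignment on objects, functors $\mathbf A(A,A')\to\mathbf B(FA,FA')$, and invertible compositors $\phi_{a,a'}\colon (Fa')(Fa)\Rightarrow F(a'a)$ satisfying the usual naturality, associativity and unit axioms, with all unitors identities (so $F\mathrm{id}_A=\mathrm{id}_{FA}$). $\mathbf{Ps}(\mathbf A,\mathbf B)$ is the $2$-category of normal pseudo-functors, pseudo-natural transformations (with invertible $2$-morphism components) and modifications. **Bi-representation.** A bi-representation of $F\colon \mathbf C^{\mathrm{op}}\to\mathbf{Cat}$ is a pair $(I,\rho)$ of an object $I\in\mathbf C$ and a pseudo-natural adjoint equivalence $\rho\colon \mathbf C(-,I)\Rightarrow F$, i.e. an adjoint equivalence in $\mathbf{Ps}(\mathbf C^{\mathrm{op}},\mathbf{Cat})$.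 **The $2$-category of elements** $\mathbf{el}(F)$ has objects $(C,x)$ with $C\in\mathbf C$, $x\in FC$; morphisms $(C',x')\to (C,x)$ pairs $(c,\psi)$ of a morphism $c\colon C\to C'$ of $\mathbf C$ and an isomorphism $\psi\colon x\cong (Fc)x'$ in $FC$ (composed using the compositors of $F$: $(c',\psi')\colon (C'',x'')\to(C',x')$ followed by $(c,\psi)$ is $c'c$ with $x\xrightarrow{\psi}(Fc)x'\xrightarrow{(Fc)\psi'}(Fc)(Fc')x''\cong F(c'c)x''$); $2$-morphisms $(c,\psi)\Rightarrow(d,\varphi)\colon (C',x')\to(C,x)$ the $2$-morphisms $\gamma\colon c\Rightarrow d$ of $\mathbf C$ with $\varphi=(F\gamma)_{x'}\circ\psi$. **The $2$-category of morphisms** $\mathbf{mor}(F)$ has objects $(C,\alpha)$ with $C\in\mathbf C$ and $\alpha\colon x\to y$ a morphism in $FC$. A morphism from $(C',\alpha'\colon x'\to y')$ to $(C,\alpha\colon x\to y)$ consists of morphisms $(c,\psi)\colon (C',x')\to(C,x)$ and $(d,\varphi)\colon(C',y')\to(C,y)$ of $\mathbf{el}(F)$ together with a $2$-morphism $\gamma\colon c\Rightarrow d$ of $\mathbf C$ such that $\varphi\circ\alpha=(F\gamma)_{y'}\circ(Fc)(\alpha')\circ\psi$ in $FC$; the $\gamma$'s compose by horizontal composition. A $2$-morphism from $((c,\psi),(d,\varphi),\gamma)$ to $((\bar c,\bar\psi),(\bar d,\bar\varphi),\bar\gamma)$ is a pair of $2$-morphisms $\sigma_0\colon (c,\psi)\Rightarrow(\bar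 c,\bar\psi)$ and $\sigma_1\colon (d,\varphi)\Rightarrow(\bar d,\bar\varphi)$ of $\mathbf{el}(F)$ with $\bar\gamma\circ\sigma_0=\sigma_1\circ\gamma$. **Bi-initial object.** For an object $I$ of a $2$-category $\mathbf A$, the pseudo-slice $2$-category $I\downarrow\mathbf A$ has objects $(A,f\colon I\to A)$; morphisms $(A,f)\to(A',f')$ pairs $(a,\psi)$ of $a\colon A\to A'$ and an invertible $\psi\colon f'\Rightarrow af$; $2$-morphisms $(a,\psi)\Rightarrow(b,\varphi)$ the $2$-morphisms $\beta\colon a\Rightarrow b$ with $(\beta f)\circ\psi=\varphi$. A $2$-functor is a trivial fibration if it is surjective on objects, full on morphisms (every morphism $FA\to FA'$ is the image of some morphism $A\to A'$) and fully faithful on $2$-morphisms. $I$ is bi-initial if the projection $I\downarrow\mathbf A\to\mathbf A$ is a trivial fibration. *)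

theory Defs
  imports Main
begin

section \<open>Categories, functors, natural transformations\<close>

text \<open>
  A category consists of a set of objects and a set of arrows inside two HOL types; every arrow has
  a unique domain and codomain. Functions are only constrained on these carriers, and equality of
  functors, transformations and modifications always means equality on the carriers.
\<close>

record ('x, 'y) cat =
  Obj :: "'x set"
  Arr :: "'y set"
  Dom :: "'y \<Rightarrow> 'x"
  Cod :: "'y \<Rightarrow> 'x"
  Idn :: "'x \<Rightarrow> 'y"
  Cmp :: "'y \<Rightarrow> 'y \<Rightarrow> 'y"  (infixr "\<cdot>\<index>" 70)

definition in_hom :: "('x, 'y, 'e) cat_scheme \<Rightarrow> 'y \<Rightarrow> 'x \<Rightarrow> 'x \<Rightarrow> bool" where
  "in_hom K f x y \<longleftrightarrow> f \<in> Arr K \<and> Dom K f = x \<and> Cod K f = y"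

locale category =
  fixes K :: "('x, 'y) cat" (structure)
  assumes Dom_Obj: "f \<in> Arr K \<Longrightarrow> Dom K f \<in> Obj K"
    and Cod_Obj: "f \<in> Arr K \<Longrightarrow> Cod K f \<in> Obj K"
    and Idn_hom: "x \<in> Obj K \<Longrightarrow> in_hom K (Idn K x) x x"
    and Cmp_hom: "in_hom K f x y \<Longrightarrow> in_hom K g y z \<Longrightarrow> in_hom K (g \<cdot> f) x z"
    and Idn_left: "in_hom K f x y \<Longrightarrow> Idn K y \<cdot> f = f"
    and Idn_right: "in_hom K f x y \<Longrightarrow> f \<cdot> Idn K x = f"
    and Cmp_assoc: "in_hom K f w x \<Longrightarrow> in_hom K g x y \<Longrightarrow> in_hom K h y z
      \<Longrightarrow> (h \<cdot> g) \<cdot> f = h \<cdot> (g \<cdot> f)"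

definition iso_hom :: "('x, 'y) cat \<Rightarrow> 'y \<Rightarrow> 'x \<Rightarrow> 'x \<Rightarrow> bool" where
  "iso_hom K f x y \<longleftrightarrow> in_hom K f x y \<and>
     (\<exists>g. in_hom K g y x \<and> g \<cdot>\<^bsub>K\<^esub> f = Idn K x \<and> f \<cdot>\<^bsub>K\<^esub> g = Idn K y)"

record ('x, 'y, 'u, 'v) fctr =
  fob :: "'x \<Rightarrow> 'u"
  far :: "'y \<Rightarrow> 'v"

definition id_fctr :: "('x, 'y, 'x, 'y) fctr" where
  "id_fctr = \<lparr>fob = (\<lambda>x. x), far = (\<lambda>f. f)\<rparr>"

definition comp_fctr ::
  "('u, 'v, 'p, 'q) fctr \<Rightarrow> ('x, 'y, 'u, 'v) fctr \<Rightarrow> ('x, 'y, 'p, 'q) fctr" where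
  "comp_fctr S T = \<lparr>fob = (\<lambda>x. fob S (fob T x)), far = (\<lambda>f. far S (far T f))\<rparr>"

locale is_functor = src: category K + trg: category L
  for K :: "('x, 'y) cat" and L :: "('u, 'v) cat" +
  fixes T :: "('x, 'y, 'u, 'v) fctr"
  assumes fob_Obj: "x \<in> Obj K \<Longrightarrow> fob T x \<in> Obj L"
    and far_hom: "in_hom K f x y \<Longrightarrow> in_hom L (far T f) (fob T x) (fob T y)"
    and far_Idn: "x \<in> Obj K \<Longrightarrow> far T (Idn K x) = Idn L (fob T x)"
    and far_Cmp: "in_hom K f x y \<Longrightarrow> in_hom K g y z
      \<Longrightarrow> far T (g \<cdot>\<^bsub>K\<^esub> f) = far T g \<cdot>\<^bsub>L\<^esub> far T f"

locale nat_trans = S: is_functor K L S + T: is_functor K L T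
  for K :: "('x, 'y) cat" and L :: "('u, 'v) cat" and S T +
  fixes t :: "'x \<Rightarrow> 'v"
  assumes component: "x \<in> Obj K \<Longrightarrow> in_hom L (t x) (fob S x) (fob T x)"
    and natural: "in_hom K f x y \<Longrightarrow> t y \<cdot>\<^bsub>L\<^esub> far S f = far T f \<cdot>\<^bsub>L\<^esub> t x"

locale nat_iso = nat_trans +
  assumes component_iso: "x \<in> Obj K \<Longrightarrow> iso_hom L (t x) (fob S x) (fob T x)"

section \<open>Strict 2-categories\<close>

record ('o, 'm, 't) twocat =
  Ob :: "'o set"
  Mor :: "'m set"
  Cell :: "'t set"
  Src :: "'m \<Rightarrow> 'o"
  Trg :: "'m \<Rightarrow> 'o"
  VDom :: "'t \<Rightarrow> 'm"
  VCod :: "'t \<Rightarrow> 'm"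
  Id1 :: "'o \<Rightarrow> 'm"
  Id2 :: "'m \<Rightarrow> 't"
  Comp :: "'m \<Rightarrow> 'm \<Rightarrow> 'm"  (infixr "\<odot>\<index>" 75)
  VComp :: "'t \<Rightarrow> 't \<Rightarrow> 't"  (infixr "\<bullet>\<index>" 70)
  HComp :: "'t \<Rightarrow> 't \<Rightarrow> 't"  (infixr "\<star>\<index>" 75)

definition underlying_cat :: "('o, 'm, 't) twocat \<Rightarrow> ('o, 'm) cat" where
  "underlying_cat A = \<lparr>Obj = Ob A, Arr = Mor A, Dom = Src A, Cod = Trg A,
     Idn = Id1 A, Cmp = Comp A\<rparr>"

definition vertical_cat :: "('o, 'm, 't) twocat \<Rightarrow> ('m, 't) cat" where
  "vertical_cat A = \<lparr>Obj = Mor A, Arr = Cell A, Dom = VDom A, Cod = VCod A,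
     Idn = Id2 A, Cmp = VComp A\<rparr>"

abbreviation mor_hom :: "('o, 'm, 't) twocat \<Rightarrow> 'm \<Rightarrow> 'o \<Rightarrow> 'o \<Rightarrow> bool" where
  "mor_hom A \<equiv> in_hom (underlying_cat A)"

abbreviation cell_hom :: "('o, 'm, 't) twocat \<Rightarrow> 't \<Rightarrow> 'm \<Rightarrow> 'm \<Rightarrow> bool" where
  "cell_hom A \<equiv> in_hom (vertical_cat A)"

abbreviation invertible_cell :: "('o, 'm, 't) twocat \<Rightarrow> 't \<Rightarrow> 'm \<Rightarrow> 'm \<Rightarrow> bool" where
  "invertible_cell A \<equiv> iso_hom (vertical_cat A)"

locale two_category =
  fixes A :: "('o, 'm, 't) twocat" (structure)
  assumes underlying: "category (underlying_cat A)"
    and vertical: "category (vertical_cat A)"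
    and globular: "cell_hom A s f g \<Longrightarrow> Src A f = Src A g \<and> Trg A f = Trg A g"
    and HComp_hom: "cell_hom A s f g \<Longrightarrow> cell_hom A t h k \<Longrightarrow> Trg A f = Src A h
      \<Longrightarrow> cell_hom A (t \<star> s) (h \<odot> f) (k \<odot> g)"
    and HComp_Id2: "mor_hom A f x y \<Longrightarrow> mor_hom A g y z \<Longrightarrow> Id2 A g \<star> Id2 A f = Id2 A (g \<odot> f)"
    and interchange: "cell_hom A s f f' \<Longrightarrow> cell_hom A s' f' f''
      \<Longrightarrow> cell_hom A t g g' \<Longrightarrow> cell_hom A t' g' g'' \<Longrightarrow> Trg A f = Src A g
      \<Longrightarrow> (t' \<bullet> t) \<star> (s' \<bullet> s) = (t' \<star> s') \<bullet> (t \<star> s)"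
    and HComp_unit_left: "cell_hom A s f g \<Longrightarrow> Id2 A (Id1 A (Trg A f)) \<star> s = s"
    and HComp_unit_right: "cell_hom A s f g \<Longrightarrow> s \<star> Id2 A (Id1 A (Src A f)) = s"
    and HComp_assoc: "cell_hom A r f f' \<Longrightarrow> cell_hom A s g g' \<Longrightarrow> cell_hom A t h h'
      \<Longrightarrow> Trg A f = Src A g \<Longrightarrow> Trg A g = Src A h \<Longrightarrow> (t \<star> s) \<star> r = t \<star> (s \<star> r)"

definition op2 :: "('o, 'm, 't) twocat \<Rightarrow> ('o, 'm, 't) twocat" where
  "op2 A = A\<lparr>Src := Trg A, Trg := Src A,
     Comp := (\<lambda>g f. Comp A f g), HComp := (\<lambda>t s. HComp A s t)\<rparr>"

definition hom_cat :: "('o, 'm, 't) twocat \<Rightarrow> 'o \<Rightarrow> 'o \<Rightarrow> ('m, 't) cat" where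
  "hom_cat A X Y = \<lparr>Obj = {f. mor_hom A f X Y},
     Arr = {s \<in> Cell A. mor_hom A (VDom A s) X Y \<and> mor_hom A (VCod A s) X Y},
     Dom = VDom A, Cod = VCod A, Idn = Id2 A, Cmp = VComp A\<rparr>"

record ('o, 'm, 't, 'p, 'n, 's) twofun =
  map0 :: "'o \<Rightarrow> 'p"
  map1 :: "'m \<Rightarrow> 'n"
  map2 :: "'t \<Rightarrow> 's"

locale two_functor = src: two_category A + trg: two_category B
  for A :: "('o, 'm, 't) twocat" and B :: "('p, 'n, 's) twocat" +
  fixes P :: "('o, 'm, 't, 'p, 'n, 's) twofun"
  assumes map0_Ob: "X \<in> Ob A \<Longrightarrow> map0 P X \<in> Ob B"
    and map1_hom: "mor_hom A f X Y \<Longrightarrow> mor_hom B (map1 P f) (map0 P X) (map0 P Y)"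
    and map2_hom: "cell_hom A s f g \<Longrightarrow> cell_hom B (map2 P s) (map1 P f) (map1 P g)"
    and map1_Id1: "X \<in> Ob A \<Longrightarrow> map1 P (Id1 A X) = Id1 B (map0 P X)"
    and map2_Id2: "f \<in> Mor A \<Longrightarrow> map2 P (Id2 A f) = Id2 B (map1 P f)"
    and map1_Comp: "mor_hom A f X Y \<Longrightarrow> mor_hom A g Y Z
      \<Longrightarrow> map1 P (g \<odot>\<^bsub>A\<^esub> f) = map1 P g \<odot>\<^bsub>B\<^esub> map1 P f"
    and map2_VComp: "cell_hom A s f g \<Longrightarrow> cell_hom A t g h
      \<Longrightarrow> map2 P (t \<bullet>\<^bsub>A\<^esub> s) = map2 P t \<bullet>\<^bsub>B\<^esub> map2 P s"
    and map2_HComp: "cell_hom A s f g \<Longrightarrow> cell_hom A t h k \<Longrightarrow> Trg A f = Src A h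
      \<Longrightarrow> map2 P (t \<star>\<^bsub>A\<^esub> s) = map2 P t \<star>\<^bsub>B\<^esub> map2 P s"

definition trivial_fibration ::
  "('o, 'm, 't) twocat \<Rightarrow> ('p, 'n, 's) twocat \<Rightarrow> ('o, 'm, 't, 'p, 'n, 's) twofun \<Rightarrow> bool" where
  "trivial_fibration A B P \<longleftrightarrow> two_functor A B P \<and>
     (\<forall>Y \<in> Ob B. \<exists>X \<in> Ob A. map0 P X = Y) \<and>
     (\<forall>X \<in> Ob A. \<forall>X' \<in> Ob A. \<forall>g. mor_hom B g (map0 P X) (map0 P X') \<longrightarrow>
        (\<exists>f. mor_hom A f X X' \<and> map1 P f = g)) \<and>
     (\<forall>X X' f f'. mor_hom A f X X' \<and> mor_hom A f' X X' \<longrightarrow>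
        (\<forall>t. cell_hom B t (map1 P f) (map1 P f') \<longrightarrow> (\<exists>!s. cell_hom A s f f' \<and> map2 P s = t)))"

section \<open>Pseudo-slices and bi-initial objects\<close>

text \<open>
  In the derived 2-categories below, morphisms and 2-morphisms carry their source and target
  explicitly, so that the same underlying data between different objects stay distinct.
\<close>

datatype ('f, 'c) dcell = DCell (dsrc: 'f) (dtrg: 'f) (dval: 'c)

datatype ('o, 'm, 't) slice_mor =
  SliceMor (ssrc: "'o \<times> 'm") (strg: "'o \<times> 'm") (smor: 'm) (scell: 't)

definition slice_comp :: "('o, 'm, 't) twocat \<Rightarrow>
    ('o, 'm, 't) slice_mor \<Rightarrow> ('o, 'm, 't) slice_mor \<Rightarrow> ('o, 'm, 't) slice_mor" where
  "slice_comp A v u = SliceMor (ssrc u) (strg v) (smor v \<odot>\<^bsub>A\<^esub> smor u)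
     ((Id2 A (smor v) \<star>\<^bsub>A\<^esub> scell u) \<bullet>\<^bsub>A\<^esub> scell v)"

definition slice_mors :: "'o \<Rightarrow> ('o, 'm, 't) twocat \<Rightarrow> ('o, 'm, 't) slice_mor set" where
  "slice_mors I A = {SliceMor (X, f) (X', f') a p | X f X' f' a p.
     mor_hom A f I X \<and> mor_hom A f' I X' \<and> mor_hom A a X X' \<and>
     invertible_cell A p f' (a \<odot>\<^bsub>A\<^esub> f)}"

definition pseudo_slice :: "'o \<Rightarrow> ('o, 'm, 't) twocat \<Rightarrow>
    ('o \<times> 'm, ('o, 'm, 't) slice_mor, (('o, 'm, 't) slice_mor, 't) dcell) twocat" where
  "pseudo_slice I A = \<lparr>
     Ob = {(X, f). mor_hom A f I X},
     Mor = slice_mors I A,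
     Cell = {DCell u v b | u v b. u \<in> slice_mors I A \<and> v \<in> slice_mors I A \<and>
       ssrc u = ssrc v \<and> strg u = strg v \<and> cell_hom A b (smor u) (smor v) \<and>
       (b \<star>\<^bsub>A\<^esub> Id2 A (snd (ssrc u))) \<bullet>\<^bsub>A\<^esub> scell u = scell v},
     Src = ssrc, Trg = strg, VDom = dsrc, VCod = dtrg,
     Id1 = (\<lambda>(X, f). SliceMor (X, f) (X, f) (Id1 A X) (Id2 A f)),
     Id2 = (\<lambda>u. DCell u u (Id2 A (smor u))),
     Comp = slice_comp A,
     VComp = (\<lambda>t s. DCell (dsrc s) (dtrg t) (dval t \<bullet>\<^bsub>A\<^esub> dval s)),
     HComp = (\<lambda>t s. DCell (slice_comp A (dsrc t) (dsrc s)) (slice_comp A (dtrg t) (dtrg s))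
       (dval t \<star>\<^bsub>A\<^esub> dval s))\<rparr>"

definition slice_proj ::
  "('o \<times> 'm, ('o, 'm, 't) slice_mor, (('o, 'm, 't) slice_mor, 't) dcell, 'o, 'm, 't) twofun" where
  "slice_proj = \<lparr>map0 = fst, map1 = smor, map2 = dval\<rparr>"

definition bi_initial :: "('o, 'm, 't) twocat \<Rightarrow> 'o \<Rightarrow> bool" where
  "bi_initial A I \<longleftrightarrow> I \<in> Ob A \<and> trivial_fibration (pseudo_slice I A) A slice_proj"

section \<open>Normal pseudo-functors with values in Cat\<close>

text \<open>
  Categories over different pairs of HOL types do not form a single HOL type, so the 2-category Cat
  is not a value of type \<open>twocat\<close>; its operations are the polymorphic ones above. What
  follows spells out the 2-category Ps(A, Cat) of normal pseudo-functors, pseudo-natural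
  transformations and modifications for Cat in this sense. In particular a transformation may relate
  pseudo-functors whose values live over different types, such as a representable one and an
  arbitrary one.

  The compositor \<open>pf_cpr F a b\<close>, for \<open>a\<close> followed by \<open>b\<close>, goes from
  \<open>F b \<circ> F a\<close> to \<open>F (b \<odot> a)\<close>.
\<close>

record ('o, 'm, 't, 'x, 'y) pfun =
  pf_ob :: "'o \<Rightarrow> ('x, 'y) cat"
  pf_mor :: "'m \<Rightarrow> ('x, 'y, 'x, 'y) fctr"
  pf_cell :: "'t \<Rightarrow> 'x \<Rightarrow> 'y"
  pf_cpr :: "'m \<Rightarrow> 'm \<Rightarrow> 'x \<Rightarrow> 'y"

locale normal_pseudofunctor =
  fixes A :: "('o, 'm, 't) twocat" and F :: "('o, 'm, 't, 'x, 'y) pfun"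
  assumes ob_category: "X \<in> Ob A \<Longrightarrow> category (pf_ob F X)"
    and mor_functor: "mor_hom A a X Y \<Longrightarrow> is_functor (pf_ob F X) (pf_ob F Y) (pf_mor F a)"
    and cell_nat: "cell_hom A s a b \<Longrightarrow> mor_hom A a X Y
      \<Longrightarrow> nat_trans (pf_ob F X) (pf_ob F Y) (pf_mor F a) (pf_mor F b) (pf_cell F s)"
    and cell_Id2: "mor_hom A a X Y \<Longrightarrow> x \<in> Obj (pf_ob F X)
      \<Longrightarrow> pf_cell F (Id2 A a) x = Idn (pf_ob F Y) (fob (pf_mor F a) x)"
    and cell_VComp: "cell_hom A s a b \<Longrightarrow> cell_hom A t b c \<Longrightarrow> mor_hom A a X Y
      \<Longrightarrow> x \<in> Obj (pf_ob F X)
      \<Longrightarrow> pf_cell F (t \<bullet>\<^bsub>A\<^esub> s) x = pf_cell F t x \<cdot>\<^bsub>pf_ob F Y\<^esub> pf_cell F s x"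
    and normal_ob: "X \<in> Ob A \<Longrightarrow> x \<in> Obj (pf_ob F X) \<Longrightarrow> fob (pf_mor F (Id1 A X)) x = x"
    and normal_arr: "X \<in> Ob A \<Longrightarrow> f \<in> Arr (pf_ob F X) \<Longrightarrow> far (pf_mor F (Id1 A X)) f = f"
    and cpr_iso: "mor_hom A a X Y \<Longrightarrow> mor_hom A b Y Z
      \<Longrightarrow> nat_iso (pf_ob F X) (pf_ob F Z)
            (comp_fctr (pf_mor F b) (pf_mor F a)) (pf_mor F (b \<odot>\<^bsub>A\<^esub> a)) (pf_cpr F a b)"
    and cpr_natural: "cell_hom A s a a' \<Longrightarrow> cell_hom A t b b'
      \<Longrightarrow> mor_hom A a X Y \<Longrightarrow> mor_hom A b Y Z \<Longrightarrow> x \<in> Obj (pf_ob F X)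
      \<Longrightarrow> pf_cell F (t \<star>\<^bsub>A\<^esub> s) x \<cdot>\<^bsub>pf_ob F Z\<^esub> pf_cpr F a b x =
          pf_cpr F a' b' x \<cdot>\<^bsub>pf_ob F Z\<^esub>
            (pf_cell F t (fob (pf_mor F a') x) \<cdot>\<^bsub>pf_ob F Z\<^esub> far (pf_mor F b) (pf_cell F s x))"
    and cpr_assoc: "mor_hom A a W X \<Longrightarrow> mor_hom A b X Y \<Longrightarrow> mor_hom A c Y Z
      \<Longrightarrow> x \<in> Obj (pf_ob F W)
      \<Longrightarrow> pf_cpr F (b \<odot>\<^bsub>A\<^esub> a) c x \<cdot>\<^bsub>pf_ob F Z\<^esub> far (pf_mor F c) (pf_cpr F a b x) =
          pf_cpr F a (c \<odot>\<^bsub>A\<^esub> b) x \<cdot>\<^bsub>pf_ob F Z\<^esub> pf_cpr F b c (fob (pf_mor F a) x)"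
    and cpr_unit_left: "mor_hom A a X Y \<Longrightarrow> x \<in> Obj (pf_ob F X)
      \<Longrightarrow> pf_cpr F a (Id1 A Y) x = Idn (pf_ob F Y) (fob (pf_mor F a) x)"
    and cpr_unit_right: "mor_hom A a X Y \<Longrightarrow> x \<in> Obj (pf_ob F X)
      \<Longrightarrow> pf_cpr F (Id1 A X) a x = Idn (pf_ob F Y) (fob (pf_mor F a) x)"

text \<open>
  A pseudo-natural transformation \<open>\<theta>\<close> from \<open>F\<close> to \<open>G\<close> has components
  \<open>pn_ob \<theta> X\<close> from \<open>F X\<close> to \<open>G X\<close> and, for \<open>a\<close> from
  \<open>X\<close> to \<open>Y\<close>, a natural isomorphism \<open>pn_mor \<theta> a\<close> from
  \<open>G a \<circ> \<theta> X\<close> to \<open>\<theta> Y \<circ> F a\<close>.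
\<close>

record ('o, 'm, 'x, 'y, 'u, 'v) pnat =
  pn_ob :: "'o \<Rightarrow> ('x, 'y, 'u, 'v) fctr"
  pn_mor :: "'m \<Rightarrow> 'x \<Rightarrow> 'v"

locale pseudonat = F: normal_pseudofunctor A F + G: normal_pseudofunctor A G
  for A :: "('o, 'm, 't) twocat" and F :: "('o, 'm, 't, 'x, 'y) pfun"
    and G :: "('o, 'm, 't, 'u, 'v) pfun" +
  fixes \<theta> :: "('o, 'm, 'x, 'y, 'u, 'v) pnat"
  assumes ob_functor: "X \<in> Ob A \<Longrightarrow> is_functor (pf_ob F X) (pf_ob G X) (pn_ob \<theta> X)"
    and mor_iso: "mor_hom A a X Y
      \<Longrightarrow> nat_iso (pf_ob F X) (pf_ob G Y) (comp_fctr (pf_mor G a) (pn_ob \<theta> X))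
            (comp_fctr (pn_ob \<theta> Y) (pf_mor F a)) (pn_mor \<theta> a)"
    and mor_natural: "cell_hom A s a b \<Longrightarrow> mor_hom A a X Y \<Longrightarrow> x \<in> Obj (pf_ob F X)
      \<Longrightarrow> pn_mor \<theta> b x \<cdot>\<^bsub>pf_ob G Y\<^esub> pf_cell G s (fob (pn_ob \<theta> X) x) =
          far (pn_ob \<theta> Y) (pf_cell F s x) \<cdot>\<^bsub>pf_ob G Y\<^esub> pn_mor \<theta> a x"
    and mor_Id1: "X \<in> Ob A \<Longrightarrow> x \<in> Obj (pf_ob F X)
      \<Longrightarrow> pn_mor \<theta> (Id1 A X) x = Idn (pf_ob G X) (fob (pn_ob \<theta> X) x)"
    and mor_Comp: "mor_hom A a X Y \<Longrightarrow> mor_hom A b Y Z \<Longrightarrow> x \<in> Obj (pf_ob F X)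
      \<Longrightarrow> pn_mor \<theta> (b \<odot>\<^bsub>A\<^esub> a) x \<cdot>\<^bsub>pf_ob G Z\<^esub> pf_cpr G a b (fob (pn_ob \<theta> X) x) =
          far (pn_ob \<theta> Z) (pf_cpr F a b x) \<cdot>\<^bsub>pf_ob G Z\<^esub>
            (pn_mor \<theta> b (fob (pf_mor F a) x) \<cdot>\<^bsub>pf_ob G Z\<^esub>
              far (pf_mor G b) (pn_mor \<theta> a x))"

definition id_pnat ::
  "('o, 'm, 't) twocat \<Rightarrow> ('o, 'm, 't, 'x, 'y) pfun \<Rightarrow> ('o, 'm, 'x, 'y, 'x, 'y) pnat" where
  "id_pnat A F = \<lparr>pn_ob = (\<lambda>X. id_fctr),
     pn_mor = (\<lambda>a x. Idn (pf_ob F (Trg A a)) (fob (pf_mor F a) x))\<rparr>"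

text \<open>The second argument of \<open>comp_pnat\<close> is the target pseudo-functor of the composite.\<close>

definition comp_pnat :: "('o, 'm, 't) twocat \<Rightarrow> ('o, 'm, 't, 'p, 'q) pfun \<Rightarrow>
    ('o, 'm, 'u, 'v, 'p, 'q) pnat \<Rightarrow> ('o, 'm, 'x, 'y, 'u, 'v) pnat \<Rightarrow>
    ('o, 'm, 'x, 'y, 'p, 'q) pnat" where
  "comp_pnat A H \<kappa> \<theta> = \<lparr>pn_ob = (\<lambda>X. comp_fctr (pn_ob \<kappa> X) (pn_ob \<theta> X)),
     pn_mor = (\<lambda>a x. far (pn_ob \<kappa> (Trg A a)) (pn_mor \<theta> a x) \<cdot>\<^bsub>pf_ob H (Trg A a)\<^esub>
       pn_mor \<kappa> a (fob (pn_ob \<theta> (Src A a)) x))\<rparr>"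

locale modification = src: pseudonat A F G \<theta> + trg: pseudonat A F G \<kappa>
  for A :: "('o, 'm, 't) twocat" and F :: "('o, 'm, 't, 'x, 'y) pfun"
    and G :: "('o, 'm, 't, 'u, 'v) pfun" and \<theta> \<kappa> +
  fixes m :: "'o \<Rightarrow> 'x \<Rightarrow> 'v"
  assumes component_nat: "X \<in> Ob A
      \<Longrightarrow> nat_trans (pf_ob F X) (pf_ob G X) (pn_ob \<theta> X) (pn_ob \<kappa> X) (m X)"
    and component_mor: "mor_hom A a X Y \<Longrightarrow> x \<in> Obj (pf_ob F X)
      \<Longrightarrow> pn_mor \<kappa> a x \<cdot>\<^bsub>pf_ob G Y\<^esub> far (pf_mor G a) (m X x) =
          m Y (fob (pf_mor F a) x) \<cdot>\<^bsub>pf_ob G Y\<^esub> pn_mor \<theta> a x"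

definition id_modif :: "('o, 'm, 't, 'u, 'v) pfun \<Rightarrow> ('o, 'm, 'x, 'y, 'u, 'v) pnat \<Rightarrow>
    'o \<Rightarrow> 'x \<Rightarrow> 'v" where
  "id_modif G \<theta> = (\<lambda>X x. Idn (pf_ob G X) (fob (pn_ob \<theta> X) x))"

definition comp_modif :: "('o, 'm, 't, 'u, 'v) pfun \<Rightarrow>
    ('o \<Rightarrow> 'x \<Rightarrow> 'v) \<Rightarrow> ('o \<Rightarrow> 'x \<Rightarrow> 'v) \<Rightarrow> 'o \<Rightarrow> 'x \<Rightarrow> 'v" where
  "comp_modif G n m = (\<lambda>X x. n X x \<cdot>\<^bsub>pf_ob G X\<^esub> m X x)"

definition whisker_pre :: "('o \<Rightarrow> 'u \<Rightarrow> 'q) \<Rightarrow> ('o, 'm, 'x, 'y, 'u, 'v) pnat \<Rightarrow>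
    'o \<Rightarrow> 'x \<Rightarrow> 'q" where
  "whisker_pre m \<theta> = (\<lambda>X x. m X (fob (pn_ob \<theta> X) x))"

definition whisker_post :: "('o, 'm, 'u, 'v, 'p, 'q) pnat \<Rightarrow> ('o \<Rightarrow> 'x \<Rightarrow> 'v) \<Rightarrow>
    'o \<Rightarrow> 'x \<Rightarrow> 'q" where
  "whisker_post \<kappa> m = (\<lambda>X x. far (pn_ob \<kappa> X) (m X x))"

definition modif_eq :: "('o, 'm, 't) twocat \<Rightarrow> ('o, 'm, 't, 'x, 'y) pfun \<Rightarrow>
    ('o \<Rightarrow> 'x \<Rightarrow> 'v) \<Rightarrow> ('o \<Rightarrow> 'x \<Rightarrow> 'v) \<Rightarrow> bool" where
  "modif_eq A F m n \<longleftrightarrow> (\<forall>X \<in> Ob A. \<forall>x \<in> Obj (pf_ob F X). m X x = n X x)"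

definition invertible_modification where
  "invertible_modification A F G \<theta> \<kappa> m \<longleftrightarrow> modification A F G \<theta> \<kappa> m \<and>
     (\<exists>n. modification A F G \<kappa> \<theta> n \<and>
       modif_eq A F (comp_modif G n m) (id_modif G \<theta>) \<and>
       modif_eq A F (comp_modif G m n) (id_modif G \<kappa>))"

definition pseudonat_adjoint_equivalence :: "('o, 'm, 't) twocat \<Rightarrow>
    ('o, 'm, 't, 'x, 'y) pfun \<Rightarrow> ('o, 'm, 't, 'u, 'v) pfun \<Rightarrow>
    ('o, 'm, 'x, 'y, 'u, 'v) pnat \<Rightarrow> bool" where
  "pseudonat_adjoint_equivalence A F G \<rho> \<longleftrightarrow> pseudonat A F G \<rho> \<and>
     (\<exists>\<sigma> \<eta> \<epsilon>. pseudonat A G F \<sigma> \<and>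
       invertible_modification A F F (id_pnat A F) (comp_pnat A F \<sigma> \<rho>) \<eta> \<and>
       invertible_modification A G G (comp_pnat A G \<rho> \<sigma>) (id_pnat A G) \<epsilon> \<and>
       modif_eq A F (comp_modif G (whisker_pre \<epsilon> \<rho>) (whisker_post \<rho> \<eta>)) (id_modif G \<rho>) \<and>
       modif_eq A G (comp_modif F (whisker_post \<sigma> \<epsilon>) (whisker_pre \<eta> \<sigma>)) (id_modif F \<sigma>))"

section \<open>Bi-representations\<close>

definition representable ::
  "('o, 'm, 't) twocat \<Rightarrow> 'o \<Rightarrow> ('o, 'm, 't, 'm, 't) pfun" where
  "representable C I = \<lparr>
     pf_ob = (\<lambda>X. hom_cat C X I),
     pf_mor = (\<lambda>c. \<lparr>fob = (\<lambda>f. f \<odot>\<^bsub>C\<^esub> c), far = (\<lambda>s. s \<star>\<^bsub>C\<^esub> Id2 C c)\<rparr>),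
     pf_cell = (\<lambda>t f. Id2 C f \<star>\<^bsub>C\<^esub> t),
     pf_cpr = (\<lambda>a b f. Id2 C ((f \<odot>\<^bsub>C\<^esub> a) \<odot>\<^bsub>C\<^esub> b))\<rparr>"

definition bi_representation :: "('o, 'm, 't) twocat \<Rightarrow> ('o, 'm, 't, 'x, 'y) pfun \<Rightarrow>
    'o \<Rightarrow> ('o, 'm, 'm, 't, 'x, 'y) pnat \<Rightarrow> bool" where
  "bi_representation C F I \<rho> \<longleftrightarrow>
     I \<in> Ob C \<and> pseudonat_adjoint_equivalence (op2 C) (representable C I) F \<rho>"

section \<open>The 2-category of elements\<close>

text \<open>
  In the remaining definitions \<open>F\<close> is a pseudo-functor on \<open>op2 C\<close>; an arrow
  \<open>c\<close> of \<open>C\<close> from \<open>X\<close> to \<open>X'\<close> is sent to a functor from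
  \<open>F X'\<close> to \<open>F X\<close>, and \<open>pf_cpr F c' c\<close> goes from
  \<open>F c \<circ> F c'\<close> to \<open>F (c' \<odot> c)\<close>.
  A morphism of elements from \<open>(X', x')\<close> to \<open>(X, x)\<close> lies over an arrow
  from \<open>X\<close> to \<open>X'\<close>.
\<close>

datatype ('o, 'm, 'x, 'y) el_mor =
  ElMor (esrc: "'o \<times> 'x") (etrg: "'o \<times> 'x") (emor: 'm) (eiso: 'y)

definition el_mors ::
  "('o, 'm, 't) twocat \<Rightarrow> ('o, 'm, 't, 'x, 'y) pfun \<Rightarrow> ('o, 'm, 'x, 'y) el_mor set" where
  "el_mors C F = {ElMor (X', x') (X, x) c p | X' x' X x c p.
     x' \<in> Obj (pf_ob F X') \<and> x \<in> Obj (pf_ob F X) \<and> mor_hom C c X X' \<and>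
     iso_hom (pf_ob F X) p x (fob (pf_mor F c) x')}"

definition el_id :: "('o, 'm, 't) twocat \<Rightarrow> ('o, 'm, 't, 'x, 'y) pfun \<Rightarrow>
    'o \<times> 'x \<Rightarrow> ('o, 'm, 'x, 'y) el_mor" where
  "el_id C F = (\<lambda>(X, x). ElMor (X, x) (X, x) (Id1 C X) (Idn (pf_ob F X) x))"

text \<open>\<open>el_comp C F v u\<close> is \<open>u\<close> followed by \<open>v\<close>.\<close>

definition el_comp :: "('o, 'm, 't) twocat \<Rightarrow> ('o, 'm, 't, 'x, 'y) pfun \<Rightarrow>
    ('o, 'm, 'x, 'y) el_mor \<Rightarrow> ('o, 'm, 'x, 'y) el_mor \<Rightarrow> ('o, 'm, 'x, 'y) el_mor" where
  "el_comp C F v u = (let K = pf_ob F (fst (etrg v)) in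
     ElMor (esrc u) (etrg v) (emor u \<odot>\<^bsub>C\<^esub> emor v)
       (pf_cpr F (emor u) (emor v) (snd (esrc u)) \<cdot>\<^bsub>K\<^esub>
         (far (pf_mor F (emor v)) (eiso u) \<cdot>\<^bsub>K\<^esub> eiso v)))"

definition el_cells :: "('o, 'm, 't) twocat \<Rightarrow> ('o, 'm, 't, 'x, 'y) pfun \<Rightarrow>
    (('o, 'm, 'x, 'y) el_mor, 't) dcell set" where
  "el_cells C F = {DCell u v s | u v s. u \<in> el_mors C F \<and> v \<in> el_mors C F \<and>
     esrc u = esrc v \<and> etrg u = etrg v \<and> cell_hom C s (emor u) (emor v) \<and>
     eiso v = pf_cell F s (snd (esrc u)) \<cdot>\<^bsub>pf_ob F (fst (etrg u))\<^esub> eiso u}"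

definition el :: "('o, 'm, 't) twocat \<Rightarrow> ('o, 'm, 't, 'x, 'y) pfun \<Rightarrow>
    ('o \<times> 'x, ('o, 'm, 'x, 'y) el_mor, (('o, 'm, 'x, 'y) el_mor, 't) dcell) twocat" where
  "el C F = \<lparr>
     Ob = {(X, x). X \<in> Ob C \<and> x \<in> Obj (pf_ob F X)},
     Mor = el_mors C F,
     Cell = el_cells C F,
     Src = esrc, Trg = etrg, VDom = dsrc, VCod = dtrg,
     Id1 = el_id C F,
     Id2 = (\<lambda>u. DCell u u (Id2 C (emor u))),
     Comp = el_comp C F,
     VComp = (\<lambda>t s. DCell (dsrc s) (dtrg t) (dval t \<bullet>\<^bsub>C\<^esub> dval s)),
     HComp = (\<lambda>t s. DCell (el_comp C F (dsrc t) (dsrc s)) (el_comp C F (dtrg t) (dtrg s))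
       (dval s \<star>\<^bsub>C\<^esub> dval t))\<rparr>"

section \<open>The 2-category of morphisms\<close>

text \<open>
  An object \<open>(X, \<alpha>)\<close> leaves the domain and codomain of \<open>\<alpha>\<close> implicit;
  \<open>mel0\<close> acts on domains and \<open>mel1\<close> on codomains.
\<close>

datatype ('o, 'm, 't, 'x, 'y) mo_mor =
  MoMor (msrc: "'o \<times> 'y") (mtrg: "'o \<times> 'y")
    (mel0: "('o, 'm, 'x, 'y) el_mor") (mel1: "('o, 'm, 'x, 'y) el_mor") (mcell: 't)

definition mo_mors :: "('o, 'm, 't) twocat \<Rightarrow> ('o, 'm, 't, 'x, 'y) pfun \<Rightarrow>
    ('o, 'm, 't, 'x, 'y) mo_mor set" where
  "mo_mors C F = {MoMor (X', \<alpha>') (X, \<alpha>) (ElMor (X', x') (X, x) c p) (ElMor (X', y') (X, y) d q) s |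
     X' \<alpha>' X \<alpha> x' y' x y c d p q s.
     in_hom (pf_ob F X') \<alpha>' x' y' \<and> in_hom (pf_ob F X) \<alpha> x y \<and>
     ElMor (X', x') (X, x) c p \<in> el_mors C F \<and> ElMor (X', y') (X, y) d q \<in> el_mors C F \<and>
     cell_hom C s c d \<and>
     q \<cdot>\<^bsub>pf_ob F X\<^esub> \<alpha> =
       pf_cell F s y' \<cdot>\<^bsub>pf_ob F X\<^esub> (far (pf_mor F c) \<alpha>' \<cdot>\<^bsub>pf_ob F X\<^esub> p)}"

definition mo_comp :: "('o, 'm, 't) twocat \<Rightarrow> ('o, 'm, 't, 'x, 'y) pfun \<Rightarrow>
    ('o, 'm, 't, 'x, 'y) mo_mor \<Rightarrow> ('o, 'm, 't, 'x, 'y) mo_mor \<Rightarrow>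
    ('o, 'm, 't, 'x, 'y) mo_mor" where
  "mo_comp C F v u = MoMor (msrc u) (mtrg v) (el_comp C F (mel0 v) (mel0 u))
     (el_comp C F (mel1 v) (mel1 u)) (mcell u \<star>\<^bsub>C\<^esub> mcell v)"

definition mo_cells :: "('o, 'm, 't) twocat \<Rightarrow> ('o, 'm, 't, 'x, 'y) pfun \<Rightarrow>
    (('o, 'm, 't, 'x, 'y) mo_mor,
     (('o, 'm, 'x, 'y) el_mor, 't) dcell \<times> (('o, 'm, 'x, 'y) el_mor, 't) dcell) dcell set" where
  "mo_cells C F = {DCell u v (s0, s1) | u v s0 s1. u \<in> mo_mors C F \<and> v \<in> mo_mors C F \<and>
     msrc u = msrc v \<and> mtrg u = mtrg v \<and>
     cell_hom (el C F) s0 (mel0 u) (mel0 v) \<and> cell_hom (el C F) s1 (mel1 u) (mel1 v) \<and>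
     mcell v \<bullet>\<^bsub>C\<^esub> dval s0 = dval s1 \<bullet>\<^bsub>C\<^esub> mcell u}"

definition mor :: "('o, 'm, 't) twocat \<Rightarrow> ('o, 'm, 't, 'x, 'y) pfun \<Rightarrow>
    ('o \<times> 'y, ('o, 'm, 't, 'x, 'y) mo_mor,
     (('o, 'm, 't, 'x, 'y) mo_mor,
      (('o, 'm, 'x, 'y) el_mor, 't) dcell \<times> (('o, 'm, 'x, 'y) el_mor, 't) dcell) dcell) twocat" where
  "mor C F = \<lparr>
     Ob = {(X, \<alpha>). X \<in> Ob C \<and> \<alpha> \<in> Arr (pf_ob F X)},
     Mor = mo_mors C F,
     Cell = mo_cells C F,
     Src = msrc, Trg = mtrg, VDom = dsrc, VCod = dtrg,
     Id1 = (\<lambda>(X, \<alpha>). MoMor (X, \<alpha>) (X, \<alpha>) (el_id C F (X, Dom (pf_ob F X) \<alpha>))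
       (el_id C F (X, Cod (pf_ob F X) \<alpha>)) (Id2 C (Id1 C X))),
     Id2 = (\<lambda>u. DCell u u (Id2 (el C F) (mel0 u), Id2 (el C F) (mel1 u))),
     Comp = mo_comp C F,
     VComp = (\<lambda>t s. DCell (dsrc s) (dtrg t)
       (VComp (el C F) (fst (dval t)) (fst (dval s)), VComp (el C F) (snd (dval t)) (snd (dval s)))),
     HComp = (\<lambda>t s. DCell (mo_comp C F (dsrc t) (dsrc s)) (mo_comp C F (dtrg t) (dtrg s))
       (HComp (el C F) (fst (dval t)) (fst (dval s)), HComp (el C F) (snd (dval t)) (snd (dval s))))\<rparr>"

end

theory Submission
  imports Defs
begin

text \<open>
  All three conditions say that \<open>F\<close> has a universal element \<open>i \<in> F I\<close>: for every
  object \<open>X\<close> the functor \<open>c \<mapsto> (F c) i\<close> from \<open>C(X, I)\<close> to \<open>F X\<close> is full, faithful and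
  essentially surjective (\<open>universal_element\<close>).

  An object \<open>I\<close> of a 2-category is bi-initial iff every hom-category out of \<open>I\<close> is equivalent
  to the terminal one: there is a morphism to every object, and there is exactly one 2-morphism
  between any two parallel morphisms out of \<open>I\<close> (\<open>bi_initial_iff\<close>). For \<open>(I, i)\<close> in
  \<open>el(F)\<close> this says that every \<open>x \<in> F X\<close> is isomorphic to some \<open>(F c) i\<close>, and that
  every isomorphism between \<open>(F c) i\<close> and \<open>(F d) i\<close> comes from a unique 2-morphism
  \<open>c \<Rightarrow> d\<close>. Only isomorphisms are seen by \<open>el(F)\<close>. Arbitrary morphisms are seen by
  \<open>mor(F)\<close>: existence of a morphism from \<open>(I, id)\<close> to \<open>\<alpha> : (F c) i \<rightarrow> (F d) i\<close> exhibits
  \<open>\<alpha>\<close>, up to isomorphisms which lift by \<open>el(F)\<close>, as the image of a 2-morphism, and two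
  preimages of \<open>\<alpha>\<close> give two parallel morphisms of \<open>mor(F)\<close>, whose connecting 2-morphism
  forces the preimages to agree
  (\<open>universal_element_if_bi_initial\<close>, with converse \<open>bi_initial_if_universal_element\<close>).
  Bi-initiality in \<open>mor(F)\<close> implies the one in \<open>el(F)\<close> by looking only at identity morphisms
  (\<open>bi_initial_mor_imp_el\<close>).

  That a universal element amounts to a bi-representation is the bicategorical Yoneda lemma in
  the form needed here. An element \<open>i\<close> gives a pseudo-natural transformation from \<open>C(-, I)\<close>
  to \<open>F\<close> with components \<open>c \<mapsto> (F c) i\<close>, and a transformation \<open>\<rho>\<close> is isomorphic, in each
  component, to the one given by \<open>\<rho> id\<close>. A pseudo-natural transformation is part of an
  adjoint equivalence iff each of its components is an equivalence of categories
  (\<open>pointwise_equivalence.adjoint_equivalence\<close> and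
  \<open>pointwise_equivalence_if_adjoint_equivalence\<close>).

  The definition of bi-initiality contains the statement that the projection from the pseudo-slice
  is a 2-functor, so pseudo-slices, \<open>el(F)\<close> and \<open>mor(F)\<close> have to be shown to be 2-categories.
  In all three a 2-morphism is a 2-morphism of another 2-category subject to an equation, and
  \<open>cells_over\<close> treats them at once.
\<close>

section \<open>Calculating in categories\<close>

text \<open>
  The axioms speak of \<open>in_hom\<close> with explicit end points. They are restated as conditional
  equations about membership, domain and codomain, so that rewriting discharges the typing
  conditions of a calculation by itself.
\<close>

lemma in_hom_iff: "in_hom K f x y \<longleftrightarrow> f \<in> Arr K \<and> Dom K f = x \<and> Cod K f = y"
  by (simp add: in_hom_def)

context category
begin

lemma Idn_simps:
  "x \<in> Obj K \<Longrightarrow> Idn K x \<in> Arr K"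
  "x \<in> Obj K \<Longrightarrow> Dom K (Idn K x) = x"
  "x \<in> Obj K \<Longrightarrow> Cod K (Idn K x) = x"
  using Idn_hom by (auto simp: in_hom_iff)

lemma Cmp_simps:
  "f \<in> Arr K \<Longrightarrow> g \<in> Arr K \<Longrightarrow> Cod K f = Dom K g \<Longrightarrow> g \<cdot> f \<in> Arr K"
  "f \<in> Arr K \<Longrightarrow> g \<in> Arr K \<Longrightarrow> Cod K f = Dom K g \<Longrightarrow> Dom K (g \<cdot> f) = Dom K f"
  "f \<in> Arr K \<Longrightarrow> g \<in> Arr K \<Longrightarrow> Cod K f = Dom K g \<Longrightarrow> Cod K (g \<cdot> f) = Cod K g"
  using Cmp_hom by (auto simp: in_hom_iff)

lemma Idn_Cmp:
  "f \<in> Arr K \<Longrightarrow> Cod K f = y \<Longrightarrow> Idn K y \<cdot> f = f"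
  "f \<in> Arr K \<Longrightarrow> Dom K f = x \<Longrightarrow> f \<cdot> Idn K x = f"
  using Idn_left Idn_right by (auto simp: in_hom_iff)

lemma Cmp_assoc_arr:
  "f \<in> Arr K \<Longrightarrow> g \<in> Arr K \<Longrightarrow> h \<in> Arr K \<Longrightarrow> Cod K f = Dom K g \<Longrightarrow> Cod K g = Dom K h
   \<Longrightarrow> (h \<cdot> g) \<cdot> f = h \<cdot> (g \<cdot> f)"
  using Cmp_assoc by (auto simp: in_hom_iff)

end

lemmas cat_simps = category.Dom_Obj category.Cod_Obj category.Idn_simps category.Cmp_simps
  category.Idn_Cmp category.Cmp_assoc_arr

text \<open>
  Composites are kept nested to the right; a square \<open>g \<cdot> f = k \<cdot> h\<close> then meets
  composites of the form \<open>g \<cdot> (f \<cdot> e)\<close>, and has to be rewritten there.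
\<close>

lemma Cmp_square:
  assumes "category K" and "g \<cdot>\<^bsub>K\<^esub> f = k \<cdot>\<^bsub>K\<^esub> h"
    and "f \<in> Arr K" "g \<in> Arr K" "h \<in> Arr K" "k \<in> Arr K" "e \<in> Arr K"
    and "Cod K f = Dom K g" "Cod K h = Dom K k" "Cod K e = Dom K f" "Dom K f = Dom K h"
  shows "g \<cdot>\<^bsub>K\<^esub> (f \<cdot>\<^bsub>K\<^esub> e) = k \<cdot>\<^bsub>K\<^esub> (h \<cdot>\<^bsub>K\<^esub> e)"
  using assms by (metis category.Cmp_assoc_arr)

definition inv_arr :: "('x, 'y) cat \<Rightarrow> 'y \<Rightarrow> 'y" where
  "inv_arr K f = (SOME g. in_hom K g (Cod K f) (Dom K f) \<and>
     g \<cdot>\<^bsub>K\<^esub> f = Idn K (Dom K f) \<and> f \<cdot>\<^bsub>K\<^esub> g = Idn K (Cod K f))"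

lemma iso_homD:
  assumes "iso_hom K f x y"
  shows "f \<in> Arr K" "Dom K f = x" "Cod K f = y"
    and "inv_arr K f \<in> Arr K" "Dom K (inv_arr K f) = y" "Cod K (inv_arr K f) = x"
    and "inv_arr K f \<cdot>\<^bsub>K\<^esub> f = Idn K x" "f \<cdot>\<^bsub>K\<^esub> inv_arr K f = Idn K y"
proof -
  show f: "f \<in> Arr K" "Dom K f = x" "Cod K f = y"
    using assms by (auto simp: iso_hom_def in_hom_iff)
  have "\<exists>g. in_hom K g (Cod K f) (Dom K f) \<and>
     g \<cdot>\<^bsub>K\<^esub> f = Idn K (Dom K f) \<and> f \<cdot>\<^bsub>K\<^esub> g = Idn K (Cod K f)"
    using assms f by (auto simp: iso_hom_def)
  from someI_ex[OF this, folded inv_arr_def]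
  show "inv_arr K f \<in> Arr K" "Dom K (inv_arr K f) = y" "Cod K (inv_arr K f) = x"
    "inv_arr K f \<cdot>\<^bsub>K\<^esub> f = Idn K x" "f \<cdot>\<^bsub>K\<^esub> inv_arr K f = Idn K y"
    using f by (auto simp: in_hom_iff)
qed

lemma iso_homI:
  assumes "f \<in> Arr K" "Dom K f = x" "Cod K f = y" "g \<in> Arr K" "Dom K g = y" "Cod K g = x"
    and "g \<cdot>\<^bsub>K\<^esub> f = Idn K x" "f \<cdot>\<^bsub>K\<^esub> g = Idn K y"
  shows "iso_hom K f x y"
  using assms by (auto simp: iso_hom_def in_hom_iff)

lemma iso_hom_inv: "iso_hom K f x y \<Longrightarrow> iso_hom K (inv_arr K f) y x"
  by (rule iso_homI[where g = f]) (auto simp: iso_homD)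

context category
begin

lemma iso_Idn: "x \<in> Obj K \<Longrightarrow> iso_hom K (Idn K x) x x"
  by (rule iso_homI[where g = "Idn K x"]) (auto simp: Idn_simps Idn_Cmp)

lemma inv_Cmp_cancel:
  "iso_hom K f x y \<Longrightarrow> g \<in> Arr K \<Longrightarrow> Cod K g = x \<Longrightarrow> inv_arr K f \<cdot> (f \<cdot> g) = g"
  "iso_hom K f x y \<Longrightarrow> g \<in> Arr K \<Longrightarrow> Cod K g = y \<Longrightarrow> f \<cdot> (inv_arr K f \<cdot> g) = g"
  by (simp_all add: iso_homD[where f = f and x = x and y = y] Cmp_assoc_arr[symmetric] Idn_Cmp)

lemma iso_Cmp:
  assumes f: "iso_hom K f x y" and g: "iso_hom K g y z"
  shows "iso_hom K (g \<cdot> f) x z"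
proof (rule iso_homI[where g = "inv_arr K f \<cdot> inv_arr K g"])
  note [simp] = iso_homD[OF f] iso_homD[OF g] Cmp_simps Cmp_assoc_arr Idn_Cmp
    inv_Cmp_cancel[OF f] inv_Cmp_cancel[OF g]
  show "(inv_arr K f \<cdot> inv_arr K g) \<cdot> (g \<cdot> f) = Idn K x"
    "(g \<cdot> f) \<cdot> (inv_arr K f \<cdot> inv_arr K g) = Idn K z" by simp_all
qed (simp_all add: iso_homD[OF f] iso_homD[OF g] Cmp_simps)

lemma iso_cancel_left:
  assumes "iso_hom K f x y" "f \<cdot> g = f \<cdot> h" "g \<in> Arr K" "Cod K g = x" "h \<in> Arr K" "Cod K h = x"
  shows "g = h"
  using assms inv_Cmp_cancel(1) by metis

lemma iso_cancel_right:
  assumes f: "iso_hom K f x y" and eq: "g \<cdot> f = h \<cdot> f"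
    and "g \<in> Arr K" "Dom K g = y" "h \<in> Arr K" "Dom K h = y"
  shows "g = h"
proof -
  have "k = (k \<cdot> f) \<cdot> inv_arr K f" if "k \<in> Arr K" "Dom K k = y" for k
    using that iso_homD[OF f] by (simp add: Cmp_assoc_arr Idn_Cmp)
  with assms show ?thesis by metis
qed

end

context is_functor
begin

lemma far_simps:
  "f \<in> Arr K \<Longrightarrow> far T f \<in> Arr L"
  "f \<in> Arr K \<Longrightarrow> Dom L (far T f) = fob T (Dom K f)"
  "f \<in> Arr K \<Longrightarrow> Cod L (far T f) = fob T (Cod K f)"
  using far_hom by (auto simp: in_hom_iff)

lemma far_Cmp_arr:
  "f \<in> Arr K \<Longrightarrow> g \<in> Arr K \<Longrightarrow> Cod K f = Dom K g
   \<Longrightarrow> far T (g \<cdot>\<^bsub>K\<^esub> f) = far T g \<cdot>\<^bsub>L\<^esub> far T f"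
  using far_Cmp by (auto simp: in_hom_iff)

lemma far_iso:
  assumes f: "iso_hom K f x y"
  shows "iso_hom L (far T f) (fob T x) (fob T y)"
proof (rule iso_homI[where g = "far T (inv_arr K f)"])
  note f' = iso_homD[OF f]
  have "x \<in> Obj K" "y \<in> Obj K" using f' src.Dom_Obj src.Cod_Obj by auto
  then show "far T (inv_arr K f) \<cdot>\<^bsub>L\<^esub> far T f = Idn L (fob T x)"
    "far T f \<cdot>\<^bsub>L\<^esub> far T (inv_arr K f) = Idn L (fob T y)"
    using f' by (simp_all add: far_Cmp_arr[symmetric] far_Idn)
qed (simp_all add: far_simps iso_homD[OF f])

end

text \<open>
  Stated without choosing an inverse: bi-initiality speaks about liftings of single
  objects and arrows, and an inverse is only chosen when an adjoint equivalence is built.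
\<close>

definition cat_equivalence ::
  "('x, 'y) cat \<Rightarrow> ('u, 'v) cat \<Rightarrow> ('x, 'y, 'u, 'v) fctr \<Rightarrow> bool" where
  "cat_equivalence K L T \<longleftrightarrow> is_functor K L T \<and>
     (\<forall>y \<in> Obj L. \<exists>x \<in> Obj K. \<exists>e. iso_hom L e (fob T x) y) \<and>
     (\<forall>x \<in> Obj K. \<forall>y \<in> Obj K. \<forall>b. in_hom L b (fob T x) (fob T y) \<longrightarrow>
        (\<exists>!f. in_hom K f x y \<and> far T f = b))"

section \<open>Calculating in 2-categories\<close>

lemma mor_hom_iff: "mor_hom A f x y \<longleftrightarrow> f \<in> Mor A \<and> Src A f = x \<and> Trg A f = y"
  by (simp add: in_hom_iff underlying_cat_def)

lemma cell_hom_iff: "cell_hom A s f g \<longleftrightarrow> s \<in> Cell A \<and> VDom A s = f \<and> VCod A s = g"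
  by (simp add: in_hom_iff vertical_cat_def)

context two_category
begin

lemmas underlying' = underlying[unfolded underlying_cat_def]
lemmas vertical' = vertical[unfolded vertical_cat_def]

lemma mor_simps:
  "f \<in> Mor A \<Longrightarrow> Src A f \<in> Ob A"
  "f \<in> Mor A \<Longrightarrow> Trg A f \<in> Ob A"
  "X \<in> Ob A \<Longrightarrow> Id1 A X \<in> Mor A"
  "X \<in> Ob A \<Longrightarrow> Src A (Id1 A X) = X"
  "X \<in> Ob A \<Longrightarrow> Trg A (Id1 A X) = X"
  "f \<in> Mor A \<Longrightarrow> g \<in> Mor A \<Longrightarrow> Trg A f = Src A g \<Longrightarrow> g \<odot> f \<in> Mor A"
  "f \<in> Mor A \<Longrightarrow> g \<in> Mor A \<Longrightarrow> Trg A f = Src A g \<Longrightarrow> Src A (g \<odot> f) = Src A f"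
  "f \<in> Mor A \<Longrightarrow> g \<in> Mor A \<Longrightarrow> Trg A f = Src A g \<Longrightarrow> Trg A (g \<odot> f) = Trg A g"
  "f \<in> Mor A \<Longrightarrow> Trg A f = Y \<Longrightarrow> Id1 A Y \<odot> f = f"
  "f \<in> Mor A \<Longrightarrow> Src A f = X \<Longrightarrow> f \<odot> Id1 A X = f"
  "f \<in> Mor A \<Longrightarrow> g \<in> Mor A \<Longrightarrow> h \<in> Mor A \<Longrightarrow> Trg A f = Src A g \<Longrightarrow> Trg A g = Src A h
    \<Longrightarrow> (h \<odot> g) \<odot> f = h \<odot> (g \<odot> f)"
  using category.Dom_Obj[OF underlying'] category.Cod_Obj[OF underlying']
    category.Idn_simps[OF underlying'] category.Cmp_simps[OF underlying']
    category.Idn_Cmp[OF underlying'] category.Cmp_assoc_arr[OF underlying']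
  by auto

lemma cell_simps:
  "s \<in> Cell A \<Longrightarrow> VDom A s \<in> Mor A"
  "s \<in> Cell A \<Longrightarrow> VCod A s \<in> Mor A"
  "f \<in> Mor A \<Longrightarrow> Id2 A f \<in> Cell A"
  "f \<in> Mor A \<Longrightarrow> VDom A (Id2 A f) = f"
  "f \<in> Mor A \<Longrightarrow> VCod A (Id2 A f) = f"
  "s \<in> Cell A \<Longrightarrow> t \<in> Cell A \<Longrightarrow> VCod A s = VDom A t \<Longrightarrow> t \<bullet> s \<in> Cell A"
  "s \<in> Cell A \<Longrightarrow> t \<in> Cell A \<Longrightarrow> VCod A s = VDom A t \<Longrightarrow> VDom A (t \<bullet> s) = VDom A s"
  "s \<in> Cell A \<Longrightarrow> t \<in> Cell A \<Longrightarrow> VCod A s = VDom A t \<Longrightarrow> VCod A (t \<bullet> s) = VCod A t"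
  "s \<in> Cell A \<Longrightarrow> VCod A s = g \<Longrightarrow> Id2 A g \<bullet> s = s"
  "s \<in> Cell A \<Longrightarrow> VDom A s = f \<Longrightarrow> s \<bullet> Id2 A f = s"
  "r \<in> Cell A \<Longrightarrow> s \<in> Cell A \<Longrightarrow> t \<in> Cell A \<Longrightarrow> VCod A r = VDom A s \<Longrightarrow> VCod A s = VDom A t
    \<Longrightarrow> (t \<bullet> s) \<bullet> r = t \<bullet> (s \<bullet> r)"
  using category.Dom_Obj[OF vertical'] category.Cod_Obj[OF vertical']
    category.Idn_simps[OF vertical'] category.Cmp_simps[OF vertical']
    category.Idn_Cmp[OF vertical'] category.Cmp_assoc_arr[OF vertical']
  by auto

lemma globular_simps:
  "s \<in> Cell A \<Longrightarrow> Src A (VCod A s) = Src A (VDom A s)"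
  "s \<in> Cell A \<Longrightarrow> Trg A (VCod A s) = Trg A (VDom A s)"
  using globular by (auto simp: cell_hom_iff)

lemma HComp_simps:
  "s \<in> Cell A \<Longrightarrow> t \<in> Cell A \<Longrightarrow> Trg A (VDom A s) = Src A (VDom A t) \<Longrightarrow> t \<star> s \<in> Cell A"
  "s \<in> Cell A \<Longrightarrow> t \<in> Cell A \<Longrightarrow> Trg A (VDom A s) = Src A (VDom A t)
    \<Longrightarrow> VDom A (t \<star> s) = VDom A t \<odot> VDom A s"
  "s \<in> Cell A \<Longrightarrow> t \<in> Cell A \<Longrightarrow> Trg A (VDom A s) = Src A (VDom A t)
    \<Longrightarrow> VCod A (t \<star> s) = VCod A t \<odot> VCod A s"
  "f \<in> Mor A \<Longrightarrow> g \<in> Mor A \<Longrightarrow> Trg A f = Src A g \<Longrightarrow> Id2 A g \<star> Id2 A f = Id2 A (g \<odot> f)"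
  "s \<in> Cell A \<Longrightarrow> Trg A (VDom A s) = Y \<Longrightarrow> Id2 A (Id1 A Y) \<star> s = s"
  "s \<in> Cell A \<Longrightarrow> Src A (VDom A s) = X \<Longrightarrow> s \<star> Id2 A (Id1 A X) = s"
  "r \<in> Cell A \<Longrightarrow> s \<in> Cell A \<Longrightarrow> t \<in> Cell A \<Longrightarrow> Trg A (VDom A r) = Src A (VDom A s)
    \<Longrightarrow> Trg A (VDom A s) = Src A (VDom A t) \<Longrightarrow> (t \<star> s) \<star> r = t \<star> (s \<star> r)"
  using HComp_hom HComp_Id2 HComp_unit_left HComp_unit_right HComp_assoc
  by (auto simp: cell_hom_iff mor_hom_iff)

lemma interchange_cell:
  "s \<in> Cell A \<Longrightarrow> s' \<in> Cell A \<Longrightarrow> t \<in> Cell A \<Longrightarrow> t' \<in> Cell A \<Longrightarrow> VCod A s = VDom A s'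
    \<Longrightarrow> VCod A t = VDom A t' \<Longrightarrow> Trg A (VDom A s) = Src A (VDom A t)
    \<Longrightarrow> (t' \<bullet> t) \<star> (s' \<bullet> s) = (t' \<star> s') \<bullet> (t \<star> s)"
  using interchange by (auto simp: cell_hom_iff mor_hom_iff)

lemma whisker_VComp:
  "s \<in> Cell A \<Longrightarrow> s' \<in> Cell A \<Longrightarrow> g \<in> Mor A \<Longrightarrow> VCod A s = VDom A s' \<Longrightarrow> Trg A (VDom A s) = Src A g
    \<Longrightarrow> Id2 A g \<star> (s' \<bullet> s) = (Id2 A g \<star> s') \<bullet> (Id2 A g \<star> s)"
  "t \<in> Cell A \<Longrightarrow> t' \<in> Cell A \<Longrightarrow> f \<in> Mor A \<Longrightarrow> VCod A t = VDom A t' \<Longrightarrow> Trg A f = Src A (VDom A t)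
    \<Longrightarrow> (t' \<bullet> t) \<star> Id2 A f = (t' \<star> Id2 A f) \<bullet> (t \<star> Id2 A f)"
  using interchange_cell[of s s' "Id2 A g" "Id2 A g"] interchange_cell[of "Id2 A f" "Id2 A f" t t']
  by (auto simp: cell_simps)

text \<open>The two ways of splitting a horizontal composite into whiskered cells.\<close>

lemma HComp_split:
  assumes "s \<in> Cell A" "t \<in> Cell A" "Trg A (VDom A s) = Src A (VDom A t)"
  shows "t \<star> s = (t \<star> Id2 A (VCod A s)) \<bullet> (Id2 A (VDom A t) \<star> s)"
    and "t \<star> s = (Id2 A (VCod A t) \<star> s) \<bullet> (t \<star> Id2 A (VDom A s))"
  using assms interchange_cell[of s "Id2 A (VCod A s)" "Id2 A (VDom A t)" t]
    interchange_cell[of "Id2 A (VDom A s)" s t "Id2 A (VCod A t)"]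
  by (auto simp: cell_simps)

lemmas simps = mor_simps cell_simps globular_simps HComp_simps

lemma invertible_whisker:
  assumes p: "invertible_cell A p f g" and h: "h \<in> Mor A" "Trg A f = Src A h"
  shows "invertible_cell A (Id2 A h \<star> p) (h \<odot> f) (h \<odot> g)"
proof (rule iso_homI[where g = "Id2 A h \<star> inv_arr (vertical_cat A) p"])
  note p' = iso_homD[OF p, unfolded vertical_cat_def, simplified]
  have g: "Src A g = Src A f" "Trg A g = Trg A f" using globular_simps[of p] p' by auto
  show "(Id2 A h \<star> inv_arr (vertical_cat A) p) \<cdot>\<^bsub>vertical_cat A\<^esub> (Id2 A h \<star> p) =
      Idn (vertical_cat A) (h \<odot> f)"
    "(Id2 A h \<star> p) \<cdot>\<^bsub>vertical_cat A\<^esub> (Id2 A h \<star> inv_arr (vertical_cat A) p) =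
      Idn (vertical_cat A) (h \<odot> g)"
    using p' h g cell_simps(1,2)[of p]
    by (simp_all add: vertical_cat_def whisker_VComp[symmetric] simps)
qed (use iso_homD[OF p] h globular_simps[of p] in
      \<open>auto simp: vertical_cat_def simps\<close>)

lemma invertible_VComp:
  "invertible_cell A s f g \<Longrightarrow> invertible_cell A t g h \<Longrightarrow> invertible_cell A (t \<bullet> s) f h"
  using category.iso_Cmp[OF vertical, of s f g t h] by (simp add: vertical_cat_def)

lemma invertible_Id2: "f \<in> Mor A \<Longrightarrow> invertible_cell A (Id2 A f) f f"
  using category.iso_Idn[OF vertical, of f] by (simp add: vertical_cat_def)

end

lemma op2_simps:
  "Ob (op2 A) = Ob A" "Mor (op2 A) = Mor A" "Cell (op2 A) = Cell A"
  "Src (op2 A) = Trg A" "Trg (op2 A) = Src A" "VDom (op2 A) = VDom A" "VCod (op2 A) = VCod A"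
  "Id1 (op2 A) = Id1 A" "Id2 (op2 A) = Id2 A" "g \<odot>\<^bsub>op2 A\<^esub> f = f \<odot>\<^bsub>A\<^esub> g"
  "VComp (op2 A) = VComp A" "t \<star>\<^bsub>op2 A\<^esub> s = s \<star>\<^bsub>A\<^esub> t"
  "vertical_cat (op2 A) = vertical_cat A"
  by (simp_all add: op2_def vertical_cat_def)

lemma two_category_op2:
  assumes "two_category A"
  shows "two_category (op2 A)"
proof -
  interpret two_category A by fact
  show ?thesis
  proof (rule two_category.intro)
    show "category (underlying_cat (op2 A))"
      by (rule category.intro) (auto simp: underlying_cat_def op2_simps in_hom_iff simps)
    show "category (vertical_cat (op2 A))" using vertical by (simp add: op2_simps)
  qed (auto simp: cell_hom_iff mor_hom_iff op2_simps simps interchange_cell)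
qed

lemma hom_cat_simps:
  "f \<in> Obj (hom_cat A X Y) \<longleftrightarrow> f \<in> Mor A \<and> Src A f = X \<and> Trg A f = Y"
  "Dom (hom_cat A X Y) = VDom A" "Cod (hom_cat A X Y) = VCod A"
  "Idn (hom_cat A X Y) = Id2 A" "Cmp (hom_cat A X Y) = VComp A"
  by (simp_all add: hom_cat_def mor_hom_iff)

context two_category
begin

lemma Arr_hom_cat: "s \<in> Arr (hom_cat A X Y) \<longleftrightarrow>
    s \<in> Cell A \<and> Src A (VDom A s) = X \<and> Trg A (VDom A s) = Y"
  by (auto simp: hom_cat_def mor_hom_iff simps)

lemma category_hom_cat: "category (hom_cat A X Y)"
  by (rule category.intro) (auto simp: in_hom_iff hom_cat_simps Arr_hom_cat simps)

end

section \<open>2-categories whose 2-morphisms lie over a given 2-category\<close>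

text \<open>
  Here \<open>B\<close> is the base, \<open>U\<close> a category of objects and 1-morphisms, \<open>\<phi>\<close> sends these
  1-morphisms to \<open>B\<close>, and \<open>Q\<close> selects the admissible 2-morphisms. Since a 2-morphism is
  determined by its end points and its underlying 2-morphism in \<open>B\<close>, the equations between
  2-morphisms are inherited from \<open>B\<close>; what remains to be checked for an instance is that
  \<open>U\<close> is a category, that \<open>\<phi>\<close> is functorial and that \<open>Q\<close> is closed under the operations.
\<close>

definition cells_over :: "('p, 'n, 's) twocat \<Rightarrow> ('o, 'm) cat \<Rightarrow> ('m \<Rightarrow> 'n) \<Rightarrow>
    ('m \<Rightarrow> 'm \<Rightarrow> 's \<Rightarrow> bool) \<Rightarrow> ('o, 'm, ('m, 's) dcell) twocat" where
  "cells_over B U \<phi> Q = \<lparr>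
     Ob = Obj U, Mor = Arr U,
     Cell = {DCell u v b | u v b. u \<in> Arr U \<and> v \<in> Arr U \<and> Dom U u = Dom U v \<and>
       Cod U u = Cod U v \<and> cell_hom B b (\<phi> u) (\<phi> v) \<and> Q u v b},
     Src = Dom U, Trg = Cod U, VDom = dsrc, VCod = dtrg, Id1 = Idn U,
     Id2 = (\<lambda>u. DCell u u (Id2 B (\<phi> u))),
     Comp = Cmp U,
     VComp = (\<lambda>t s. DCell (dsrc s) (dtrg t) (dval t \<bullet>\<^bsub>B\<^esub> dval s)),
     HComp = (\<lambda>t s. DCell (Cmp U (dsrc t) (dsrc s)) (Cmp U (dtrg t) (dtrg s))
       (dval t \<star>\<^bsub>B\<^esub> dval s))\<rparr>"

lemma cells_over_simps:
  "Ob (cells_over B U \<phi> Q) = Obj U" "Mor (cells_over B U \<phi> Q) = Arr U"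
  "Src (cells_over B U \<phi> Q) = Dom U" "Trg (cells_over B U \<phi> Q) = Cod U"
  "VDom (cells_over B U \<phi> Q) = dsrc" "VCod (cells_over B U \<phi> Q) = dtrg"
  "Id1 (cells_over B U \<phi> Q) = Idn U" "Comp (cells_over B U \<phi> Q) = Cmp U"
  "Id2 (cells_over B U \<phi> Q) u = DCell u u (Id2 B (\<phi> u))"
  "VComp (cells_over B U \<phi> Q) t s = DCell (dsrc s) (dtrg t) (dval t \<bullet>\<^bsub>B\<^esub> dval s)"
  "HComp (cells_over B U \<phi> Q) t s = DCell (Cmp U (dsrc t) (dsrc s)) (Cmp U (dtrg t) (dtrg s))
       (dval t \<star>\<^bsub>B\<^esub> dval s)"
  by (simp_all add: cells_over_def)

lemma Cell_cells_over: "s \<in> Cell (cells_over B U \<phi> Q) \<longleftrightarrow>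
    dsrc s \<in> Arr U \<and> dtrg s \<in> Arr U \<and> Dom U (dtrg s) = Dom U (dsrc s) \<and>
    Cod U (dtrg s) = Cod U (dsrc s) \<and> dval s \<in> Cell B \<and> VDom B (dval s) = \<phi> (dsrc s) \<and>
    VCod B (dval s) = \<phi> (dtrg s) \<and> Q (dsrc s) (dtrg s) (dval s)"
  by (cases s) (auto simp: cells_over_def cell_hom_iff)

locale cells_over_data = two_category B + U: category U
  for B :: "('p, 'n, 's) twocat" and U :: "('o, 'm) cat" +
  fixes \<phi>0 :: "'o \<Rightarrow> 'p" and \<phi> :: "'m \<Rightarrow> 'n" and Q :: "'m \<Rightarrow> 'm \<Rightarrow> 's \<Rightarrow> bool"
  assumes base: "is_functor U (underlying_cat B) \<lparr>fob = \<phi>0, far = \<phi>\<rparr>"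
    and Q_Id2: "u \<in> Arr U \<Longrightarrow> Q u u (Id2 B (\<phi> u))"
    and Q_VComp: "s \<in> Cell (cells_over B U \<phi> Q) \<Longrightarrow> t \<in> Cell (cells_over B U \<phi> Q)
      \<Longrightarrow> dtrg s = dsrc t \<Longrightarrow> Q (dsrc s) (dtrg t) (dval t \<bullet>\<^bsub>B\<^esub> dval s)"
    and Q_HComp: "s \<in> Cell (cells_over B U \<phi> Q) \<Longrightarrow> t \<in> Cell (cells_over B U \<phi> Q)
      \<Longrightarrow> Cod U (dsrc s) = Dom U (dsrc t)
      \<Longrightarrow> Q (dsrc t \<cdot>\<^bsub>U\<^esub> dsrc s) (dtrg t \<cdot>\<^bsub>U\<^esub> dtrg s) (dval t \<star>\<^bsub>B\<^esub> dval s)"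
begin

lemma base_simps:
  "x \<in> Obj U \<Longrightarrow> \<phi>0 x \<in> Ob B"
  "u \<in> Arr U \<Longrightarrow> \<phi> u \<in> Mor B"
  "u \<in> Arr U \<Longrightarrow> Src B (\<phi> u) = \<phi>0 (Dom U u)"
  "u \<in> Arr U \<Longrightarrow> Trg B (\<phi> u) = \<phi>0 (Cod U u)"
  "x \<in> Obj U \<Longrightarrow> \<phi> (Idn U x) = Id1 B (\<phi>0 x)"
  "u \<in> Arr U \<Longrightarrow> v \<in> Arr U \<Longrightarrow> Cod U u = Dom U v \<Longrightarrow> \<phi> (v \<cdot>\<^bsub>U\<^esub> u) = \<phi> v \<odot>\<^bsub>B\<^esub> \<phi> u"
  using is_functor.fob_Obj[OF base] is_functor.far_simps[OF base] is_functor.far_Idn[OF base]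
    is_functor.far_Cmp_arr[OF base]
  by (auto simp: underlying_cat_def)

lemmas over_simps = cells_over_simps Cell_cells_over base_simps simps
  cat_simps[OF U.category_axioms]

lemma two_category_cells_over: "two_category (cells_over B U \<phi> Q)"
proof (rule two_category.intro)
  show "category (underlying_cat (cells_over B U \<phi> Q))"
    using U.category_axioms
    by (simp add: underlying_cat_def cells_over_simps category_def in_hom_iff)
  show "category (vertical_cat (cells_over B U \<phi> Q))"
    by (rule category.intro)
      (auto simp: vertical_cat_def in_hom_iff over_simps Q_Id2 Q_VComp dcell.expand)
qed (auto simp: cell_hom_iff mor_hom_iff over_simps Q_HComp interchange_cell dcell.expand)

lemma two_functor_cells_over:
  "two_functor (cells_over B U \<phi> Q) B \<lparr>map0 = \<phi>0, map1 = \<phi>, map2 = dval\<rparr>"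
  by (intro two_functor.intro two_functor_axioms.intro two_category_cells_over two_category_axioms)
    (auto simp: cell_hom_iff mor_hom_iff over_simps)

end

text \<open>
  The base of \<open>mor(F)\<close> is \<open>el(F) \<times> el(F)\<close>.
\<close>

definition prod2 :: "('o, 'm, 't) twocat \<Rightarrow> ('p, 'n, 's) twocat \<Rightarrow>
    ('o \<times> 'p, 'm \<times> 'n, 't \<times> 's) twocat" where
  "prod2 A B = \<lparr>
     Ob = Ob A \<times> Ob B, Mor = Mor A \<times> Mor B, Cell = Cell A \<times> Cell B,
     Src = (\<lambda>f. (Src A (fst f), Src B (snd f))), Trg = (\<lambda>f. (Trg A (fst f), Trg B (snd f))),
     VDom = (\<lambda>s. (VDom A (fst s), VDom B (snd s))), VCod = (\<lambda>s. (VCod A (fst s), VCod B (snd s))),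
     Id1 = (\<lambda>x. (Id1 A (fst x), Id1 B (snd x))), Id2 = (\<lambda>f. (Id2 A (fst f), Id2 B (snd f))),
     Comp = (\<lambda>g f. (fst g \<odot>\<^bsub>A\<^esub> fst f, snd g \<odot>\<^bsub>B\<^esub> snd f)),
     VComp = (\<lambda>t s. (fst t \<bullet>\<^bsub>A\<^esub> fst s, snd t \<bullet>\<^bsub>B\<^esub> snd s)),
     HComp = (\<lambda>t s. (fst t \<star>\<^bsub>A\<^esub> fst s, snd t \<star>\<^bsub>B\<^esub> snd s))\<rparr>"

lemma prod2_simps:
  "Ob (prod2 A B) = Ob A \<times> Ob B" "Mor (prod2 A B) = Mor A \<times> Mor B"
  "Cell (prod2 A B) = Cell A \<times> Cell B"
  "Src (prod2 A B) f = (Src A (fst f), Src B (snd f))"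
  "Trg (prod2 A B) f = (Trg A (fst f), Trg B (snd f))"
  "VDom (prod2 A B) s = (VDom A (fst s), VDom B (snd s))"
  "VCod (prod2 A B) s = (VCod A (fst s), VCod B (snd s))"
  "Id1 (prod2 A B) x = (Id1 A (fst x), Id1 B (snd x))"
  "Id2 (prod2 A B) f = (Id2 A (fst f), Id2 B (snd f))"
  "g \<odot>\<^bsub>prod2 A B\<^esub> f = (fst g \<odot>\<^bsub>A\<^esub> fst f, snd g \<odot>\<^bsub>B\<^esub> snd f)"
  "t \<bullet>\<^bsub>prod2 A B\<^esub> s = (fst t \<bullet>\<^bsub>A\<^esub> fst s, snd t \<bullet>\<^bsub>B\<^esub> snd s)"
  "t \<star>\<^bsub>prod2 A B\<^esub> s = (fst t \<star>\<^bsub>A\<^esub> fst s, snd t \<star>\<^bsub>B\<^esub> snd s)"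
  by (simp_all add: prod2_def)

lemma two_category_prod2:
  assumes "two_category A" "two_category B"
  shows "two_category (prod2 A B)"
proof -
  interpret A: two_category A by fact
  interpret B: two_category B by fact
  show ?thesis
  proof (rule two_category.intro)
    show "category (underlying_cat (prod2 A B))"
      by (rule category.intro)
        (auto simp: underlying_cat_def in_hom_iff prod2_simps A.simps B.simps)
    show "category (vertical_cat (prod2 A B))"
      by (rule category.intro)
        (auto simp: vertical_cat_def in_hom_iff prod2_simps A.simps B.simps)
  qed (auto simp: cell_hom_iff mor_hom_iff prod2_simps A.simps B.simps
      A.interchange_cell B.interchange_cell)
qed

section \<open>Bi-initial objects\<close>

lemma slice_mors_iff: "u \<in> slice_mors I A \<longleftrightarrow>
    mor_hom A (snd (ssrc u)) I (fst (ssrc u)) \<and> mor_hom A (snd (strg u)) I (fst (strg u)) \<and>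
    mor_hom A (smor u) (fst (ssrc u)) (fst (strg u)) \<and>
    invertible_cell A (scell u) (snd (strg u)) (smor u \<odot>\<^bsub>A\<^esub> snd (ssrc u))"
  by (cases u) (auto simp: slice_mors_def)

lemma pseudo_slice_eq: "pseudo_slice I A =
    cells_over A (underlying_cat (pseudo_slice I A)) smor
      (\<lambda>u v b. (b \<star>\<^bsub>A\<^esub> Id2 A (snd (ssrc u))) \<bullet>\<^bsub>A\<^esub> scell u = scell v)"
  by (simp add: pseudo_slice_def cells_over_def underlying_cat_def)

context two_category
begin

lemma invertible_cellD:
  "invertible_cell A s f g \<Longrightarrow> s \<in> Cell A \<and> VDom A s = f \<and> VCod A s = g"
  by (auto simp: iso_hom_def cell_hom_iff)

lemma slice_comp_closed:
  assumes u: "u \<in> slice_mors I A" and v: "v \<in> slice_mors I A" and uv: "strg u = ssrc v"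
  shows "slice_comp A v u \<in> slice_mors I A"
proof -
  let ?f = "snd (ssrc u)"
  have "invertible_cell A ((Id2 A (smor v) \<star> scell u) \<bullet> scell v) (snd (strg v))
      (smor v \<odot> (smor u \<odot> ?f))"
  proof (rule invertible_VComp)
    show "invertible_cell A (scell v) (snd (strg v)) (smor v \<odot> snd (strg u))"
      using v uv by (simp add: slice_mors_iff)
    show "invertible_cell A (Id2 A (smor v) \<star> scell u) (smor v \<odot> snd (strg u))
        (smor v \<odot> smor u \<odot> ?f)"
      using u v uv by (intro invertible_whisker) (auto simp: slice_mors_iff mor_hom_iff)
  qed
  then show ?thesis
    using u v uv by (auto simp: slice_mors_iff mor_hom_iff slice_comp_def simps)
qed

lemma category_slice: "category (underlying_cat (pseudo_slice I A))"
proof -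
  note [simp] = simps
  have id: "SliceMor (X, f) (X, f) (Id1 A X) (Id2 A f) \<in> slice_mors I A"
    if "mor_hom A f I X" for X f
    using that invertible_Id2[of f] by (auto simp: slice_mors_iff mor_hom_iff)
  show ?thesis
    by (rule category.intro)
      (auto simp: in_hom_iff underlying_cat_def pseudo_slice_def slice_comp_closed id,
       auto simp: slice_mors_iff slice_comp_def mor_hom_iff whisker_VComp HComp_simps(7)[symmetric]
         slice_mor.expand split_beta invertible_Id2 dest!: invertible_cellD)
qed

lemma pseudo_slice_data:
  "cells_over_data A (underlying_cat (pseudo_slice I A)) fst smor
     (\<lambda>u v b. (b \<star> Id2 A (snd (ssrc u))) \<bullet> scell u = scell v)"
proof -
  let ?U = "underlying_cat (pseudo_slice I A)"
  have U: "Obj ?U = {(X, f). mor_hom A f I X}" "Arr ?U = slice_mors I A" "Dom ?U = ssrc"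
    "Cod ?U = strg" "Cmp ?U = slice_comp A"
    "Idn ?U = (\<lambda>(X, f). SliceMor (X, f) (X, f) (Id1 A X) (Id2 A f))"
    by (simp_all add: underlying_cat_def pseudo_slice_def)
  note [simp] = simps mor_hom_iff Cell_cells_over U slice_mors_iff
  show ?thesis
  proof (intro cells_over_data.intro cells_over_data_axioms.intro two_category_axioms category_slice)
    show "is_functor ?U (underlying_cat A) \<lparr>fob = fst, far = smor\<rparr>"
      by (intro is_functor.intro is_functor_axioms.intro category_slice underlying)
        (auto simp: in_hom_iff slice_comp_def underlying_cat_def pseudo_slice_def)
  next
    fix u assume "u \<in> Arr ?U"
    then show "(Id2 A (smor u) \<star> Id2 A (snd (ssrc u))) \<bullet> scell u = scell u"
      by (auto dest!: invertible_cellD)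
  next
    let ?Q = "\<lambda>u v b. (b \<star> Id2 A (snd (ssrc u))) \<bullet> scell u = scell v"
    fix s t assume s: "s \<in> Cell (cells_over A ?U smor ?Q)" and t: "t \<in> Cell (cells_over A ?U smor ?Q)"
    show "?Q (dsrc s) (dtrg t) (dval t \<bullet> dval s)" if "dtrg s = dsrc t"
      using s t that by (auto simp: whisker_VComp dest!: invertible_cellD)
    assume st: "Cod ?U (dsrc s) = Dom ?U (dsrc t)"
    obtain u u' b where s': "s = DCell u u' b" by (cases s)
    obtain v v' d where t': "t = DCell v v' d" by (cases t)
    define f where "f = snd (ssrc u)"
    define p p' q q' where "p = scell u" and "p' = scell u'" and "q = scell v" and "q' = scell v'"
    have b: "b \<in> Cell A" "VDom A b = smor u" "VCod A b = smor u'"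
      and d: "d \<in> Cell A" "VDom A d = smor v" "VCod A d = smor v'"
      and f: "f \<in> Mor A" "Src A f = I" "Trg A f = Src A (smor u)"
      and p: "p \<in> Cell A" "VDom A p = snd (ssrc v)" "VCod A p = smor u \<odot> f"
      and p': "p' \<in> Cell A" "VDom A p' = snd (ssrc v)" "VCod A p' = smor u' \<odot> f"
      and q: "q \<in> Cell A" "VDom A q = snd (strg v)" "VCod A q = smor v \<odot> snd (ssrc v)"
      and q': "q' \<in> Cell A" "VCod A q' = smor v' \<odot> snd (ssrc v)"
      and u: "smor u \<in> Mor A" "smor u' \<in> Mor A" "Src A (smor u') = Src A (smor u)" "Trg A (smor u') = Trg A (smor u)"
      and v: "smor v \<in> Mor A" "smor v' \<in> Mor A" "Src A (smor v') = Src A (smor v)" "Trg A (smor v') = Trg A (smor v)"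
        "Trg A (smor u) = Src A (smor v)"
      and g: "snd (ssrc v) \<in> Mor A" "Src A (snd (ssrc v)) = I" "Trg A (snd (ssrc v)) = Src A (smor v)"
      and eq: "(b \<star> Id2 A f) \<bullet> p = p'" "(d \<star> Id2 A (snd (ssrc v))) \<bullet> q = q'"
      using s t st unfolding s' t' p_def p'_def q_def q'_def f_def
      by (auto dest!: invertible_cellD)
    \<comment> \<open>Both sides equal \<open>(d \<star> p') \<bullet> q\<close>, by interchange.\<close>
    have "((d \<star> b) \<star> Id2 A f) \<bullet> (Id2 A (smor v) \<star> p) \<bullet> q = (d \<star> p') \<bullet> q"
      using b d f p q u v g by (simp add: cell_simps(11)[symmetric] interchange_cell[symmetric] flip: eq(1) del: cell_simps(11))
    also have "\<dots> = (Id2 A (smor v') \<star> p') \<bullet> q'"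
      using b d f p' q u v g by (simp add: HComp_split(2)[of p' d] flip: eq(2))
    finally show "?Q (dsrc t \<cdot>\<^bsub>?U\<^esub> dsrc s) (dtrg t \<cdot>\<^bsub>?U\<^esub> dtrg s) (dval t \<star> dval s)"
      unfolding s' t' U slice_comp_def by (simp add: p_def p'_def q_def q'_def f_def)
  qed
qed

text \<open>
  Lifting the identity of \<open>X\<close> to a morphism between two objects \<open>(X, g)\<close> and \<open>(X, f)\<close> of the
  pseudo-slice gives an invertible 2-morphism from \<open>f\<close> to \<open>g\<close>. Any other 2-morphism
  \<open>s : f \<Rightarrow> g\<close> connects two morphisms with source \<open>(I, id)\<close>, and fullness on 2-morphisms
  says that \<open>s\<close> satisfies the slice condition, which identifies it with the one just found.
  Conversely, unique 2-morphisms are invertible and satisfy every equation, so all liftings exist.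
\<close>

lemma bi_initial_iff:
  "bi_initial A I \<longleftrightarrow> I \<in> Ob A \<and> (\<forall>X \<in> Ob A. \<exists>f. mor_hom A f I X) \<and>
     (\<forall>X f g. mor_hom A f I X \<and> mor_hom A g I X \<longrightarrow> (\<exists>!s. cell_hom A s f g))"
  (is "_ \<longleftrightarrow> ?R")
proof
  let ?S = "pseudo_slice I A"
  note [simp] = simps
  have cell_S: "cell_hom ?S s u v \<longleftrightarrow> s = DCell u v (dval s) \<and> u \<in> slice_mors I A \<and>
      v \<in> slice_mors I A \<and> ssrc u = ssrc v \<and> strg u = strg v \<and>
      cell_hom A (dval s) (smor u) (smor v) \<and>
      (dval s \<star> Id2 A (snd (ssrc u))) \<bullet> scell u = scell v" for s u v
    by (cases s) (auto simp: cell_hom_iff pseudo_slice_def)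
  have mor_S: "mor_hom ?S u x y \<longleftrightarrow> u \<in> slice_mors I A \<and> ssrc u = x \<and> strg u = y" for u x y
    by (simp add: mor_hom_iff pseudo_slice_def)
  have Ob_S: "x \<in> Ob ?S \<longleftrightarrow> mor_hom A (snd x) I (fst x)" for x
    by (cases x) (simp add: pseudo_slice_def)
  note S = cell_S mor_S Ob_S slice_proj_def
  {
    assume bi: "bi_initial A I"
    then have I: "I \<in> Ob A" and fib: "trivial_fibration ?S A slice_proj"
      by (auto simp: bi_initial_def)
    have surj: "\<forall>X \<in> Ob A. \<exists>f. mor_hom A f I X"
    proof
      fix X assume "X \<in> Ob A"
      then have "\<exists>x \<in> Ob ?S. fst x = X"
        using fib by (simp add: trivial_fibration_def slice_proj_def)
      then show "\<exists>f. mor_hom A f I X" by (auto simp: S)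
    qed
    have full: "\<exists>u \<in> slice_mors I A. ssrc u = x \<and> strg u = y \<and> smor u = a"
      if "mor_hom A (snd x) I (fst x)" "mor_hom A (snd y) I (fst y)" "mor_hom A a (fst x) (fst y)"
      for x y a
    proof -
      have "\<exists>u. mor_hom ?S u x y \<and> smor u = a"
        using fib that unfolding trivial_fibration_def by (auto simp: Ob_S slice_proj_def)
      then show ?thesis by (auto simp: S)
    qed
    have ff: "(t \<star> Id2 A (snd (ssrc u))) \<bullet> scell u = scell v"
      if "u \<in> slice_mors I A" "v \<in> slice_mors I A" "ssrc u = ssrc v" "strg u = strg v"
        "cell_hom A t (smor u) (smor v)" for u v t
    proof -
      have "\<forall>x y u v. mor_hom ?S u x y \<and> mor_hom ?S v x y \<longrightarrow>
          (\<forall>t. cell_hom A t (smor u) (smor v) \<longrightarrow> (\<exists>!s. cell_hom ?S s u v \<and> dval s = t))"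
        using fib unfolding trivial_fibration_def slice_proj_def twofun.simps by (elim conjE) assumption
      moreover have "mor_hom ?S u (ssrc u) (strg u)" "mor_hom ?S v (ssrc u) (strg u)"
        using that by (auto simp: mor_S)
      ultimately have "\<exists>!s. cell_hom ?S s u v \<and> dval s = t"
        using that(5) by blast
      then show ?thesis by (auto simp: S)
    qed
    have "\<exists>!s. cell_hom A s f g" if "mor_hom A f I X" "mor_hom A g I X" for X f g
    proof -
      have f: "f \<in> Mor A" "Src A f = I" "Trg A f = X" and g: "g \<in> Mor A" "Src A g = I" "Trg A g = X"
        using that by (auto simp: mor_hom_iff)
      \<comment> \<open>A lift of the identity of \<open>X\<close> carries an invertible 2-morphism \<open>f \<Rightarrow> id \<odot> g\<close>.\<close>
      have "\<exists>u \<in> slice_mors I A. ssrc u = (X, g) \<and> strg u = (X, f) \<and> smor u = Id1 A X"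
        using f g mor_simps(2)[OF f(1)] by (intro full) (auto simp: mor_hom_iff)
      then obtain u where "u \<in> slice_mors I A" "ssrc u = (X, g)" "strg u = (X, f)" "smor u = Id1 A X"
        by blast
      then have p: "invertible_cell A (scell u) f g" using g by (auto simp: slice_mors_iff)
      have "s = scell u" if s: "cell_hom A s f g" for s
      proof -
        \<comment> \<open>\<open>s\<close> as a 2-morphism between two morphisms \<open>(I, id) \<rightarrow> (X, f)\<close> of the pseudo-slice.\<close>
        have "(s \<star> Id2 A (Id1 A I)) \<bullet> Id2 A f = scell u"
          using ff[of "SliceMor (I, Id1 A I) (X, f) f (Id2 A f)"
              "SliceMor (I, Id1 A I) (X, f) g (scell u)" s] f g I p s invertible_Id2[of f]
          by (auto simp: slice_mors_iff mor_hom_iff)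
        then show ?thesis using s f by (auto simp: cell_hom_iff)
      qed
      then show ?thesis using p by (auto simp: iso_hom_def)
    qed
    with I surj show ?R by blast
  }
  assume R: ?R
  have inv: "invertible_cell A s f g" if "mor_hom A f I X" "mor_hom A g I X" "cell_hom A s f g"
    for X f g s
  proof -
    note fgs = that
    obtain t where t: "cell_hom A t g f" using R fgs by blast
    have f: "f \<in> Mor A" and g: "g \<in> Mor A" using that by (auto simp: mor_hom_iff)
    have "cell_hom A (t \<bullet> s) f f" "cell_hom A (Id2 A f) f f"
      "cell_hom A (s \<bullet> t) g g" "cell_hom A (Id2 A g) g g"
      using that(3) t f g by (auto simp: cell_hom_iff)
    then have "t \<bullet> s = Id2 A f" "s \<bullet> t = Id2 A g" using R that by blast+
    then show ?thesis using that t
      by (auto simp: iso_hom_def vertical_cat_def in_hom_iff)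
  qed
  interpret S: cells_over_data A "underlying_cat ?S" fst smor
    "\<lambda>u v b. (b \<star> Id2 A (snd (ssrc u))) \<bullet> scell u = scell v"
    by (rule pseudo_slice_data)
  show "bi_initial A I"
    unfolding bi_initial_def trivial_fibration_def
  proof (intro conjI ballI allI impI)
    show "I \<in> Ob A" using R by blast
    show "two_functor ?S A slice_proj"
      using S.two_functor_cells_over by (simp add: slice_proj_def flip: pseudo_slice_eq)
    fix X assume "X \<in> Ob A"
    then obtain f where "mor_hom A f I X" using R by blast
    then show "\<exists>x \<in> Ob ?S. map0 slice_proj x = X"
      by (intro bexI[of _ "(X, f)"]) (simp_all add: Ob_S slice_proj_def)
  next
    fix x y a
    assume x: "x \<in> Ob ?S" and y: "y \<in> Ob ?S" and a: "mor_hom A a (map0 slice_proj x) (map0 slice_proj y)"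
    have af: "mor_hom A (a \<odot> snd x) I (fst y)" using x a by (auto simp: S mor_hom_iff)
    moreover have "mor_hom A (snd y) I (fst y)" using y by (simp add: Ob_S)
    ultimately obtain s where "cell_hom A s (snd y) (a \<odot> snd x)" using R by blast
    then have "invertible_cell A s (snd y) (a \<odot> snd x)" using inv af y by (auto simp: Ob_S)
    then show "\<exists>f. mor_hom ?S f x y \<and> map1 slice_proj f = a"
      using x y a by (intro exI[of _ "SliceMor x y a s"]) (auto simp: S slice_mors_iff)
  next
    fix x y u v t
    assume uv: "mor_hom ?S u x y \<and> mor_hom ?S v x y"
      and t: "cell_hom A t (map1 slice_proj u) (map1 slice_proj v)"
    then have u: "u \<in> slice_mors I A" "ssrc u = x" "strg u = y"
      and v: "v \<in> slice_mors I A" "ssrc v = x" "strg v = y" by (auto simp: S)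
    have "cell_hom A ((t \<star> Id2 A (snd x)) \<bullet> scell u) (snd y) (smor v \<odot> snd x)"
      "cell_hom A (scell v) (snd y) (smor v \<odot> snd x)"
      using u v t by (auto simp: S slice_mors_iff mor_hom_iff cell_hom_iff dest!: invertible_cellD)
    moreover have "mor_hom A (snd y) I (fst y)" "mor_hom A (smor v \<odot> snd x) I (fst y)"
      using u v by (auto simp: slice_mors_iff mor_hom_iff)
    ultimately have "(t \<star> Id2 A (snd x)) \<bullet> scell u = scell v" using R by blast
    then have "cell_hom ?S (DCell u v t) u v" using u v t by (auto simp: S)
    then show "\<exists>!s. cell_hom ?S s u v \<and> map2 slice_proj s = t"
      by (intro ex1I[of _ "DCell u v t"]) (auto simp: S)
  qed
qed

end

section \<open>Calculating with pseudo-functors\<close>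

locale cat_valued = two_category A + normal_pseudofunctor A F
  for A :: "('o, 'm, 't) twocat" (structure) and F :: "('o, 'm, 't, 'x, 'y) pfun"
begin

lemma is_functor_mor:
  "a \<in> Mor A \<Longrightarrow> Src A a = X \<Longrightarrow> Trg A a = Y \<Longrightarrow> is_functor (pf_ob F X) (pf_ob F Y) (pf_mor F a)"
  using mor_functor by (auto simp: mor_hom_iff)

lemma mor_typing:
  "a \<in> Mor A \<Longrightarrow> Trg A a = Y \<Longrightarrow> x \<in> Obj (pf_ob F (Src A a)) \<Longrightarrow> fob (pf_mor F a) x \<in> Obj (pf_ob F Y)"
  "a \<in> Mor A \<Longrightarrow> Trg A a = Y \<Longrightarrow> f \<in> Arr (pf_ob F (Src A a)) \<Longrightarrow> far (pf_mor F a) f \<in> Arr (pf_ob F Y)"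
  "a \<in> Mor A \<Longrightarrow> Trg A a = Y \<Longrightarrow> f \<in> Arr (pf_ob F (Src A a))
    \<Longrightarrow> Dom (pf_ob F Y) (far (pf_mor F a) f) = fob (pf_mor F a) (Dom (pf_ob F (Src A a)) f)"
  "a \<in> Mor A \<Longrightarrow> Trg A a = Y \<Longrightarrow> f \<in> Arr (pf_ob F (Src A a))
    \<Longrightarrow> Cod (pf_ob F Y) (far (pf_mor F a) f) = fob (pf_mor F a) (Cod (pf_ob F (Src A a)) f)"
  "a \<in> Mor A \<Longrightarrow> Src A a = X \<Longrightarrow> x \<in> Obj (pf_ob F X)
    \<Longrightarrow> far (pf_mor F a) (Idn (pf_ob F X) x) = Idn (pf_ob F (Trg A a)) (fob (pf_mor F a) x)"
  "a \<in> Mor A \<Longrightarrow> Src A a = X \<Longrightarrow> f \<in> Arr (pf_ob F X) \<Longrightarrow> g \<in> Arr (pf_ob F X)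
    \<Longrightarrow> Cod (pf_ob F X) f = Dom (pf_ob F X) g
    \<Longrightarrow> far (pf_mor F a) (g \<cdot>\<^bsub>pf_ob F X\<^esub> f) =
        far (pf_mor F a) g \<cdot>\<^bsub>pf_ob F (Trg A a)\<^esub> far (pf_mor F a) f"
  using is_functor.fob_Obj is_functor.far_simps is_functor.far_Idn is_functor.far_Cmp_arr
    is_functor_mor by metis+

lemma far_iso: "a \<in> Mor A \<Longrightarrow> Src A a = X \<Longrightarrow> Trg A a = Y \<Longrightarrow> iso_hom (pf_ob F X) f x y
    \<Longrightarrow> iso_hom (pf_ob F Y) (far (pf_mor F a) f) (fob (pf_mor F a) x) (fob (pf_mor F a) y)"
  using is_functor.far_iso is_functor_mor by metis

lemma nat_trans_cell:
  "s \<in> Cell A \<Longrightarrow> nat_trans (pf_ob F (Src A (VDom A s))) (pf_ob F (Trg A (VDom A s)))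
      (pf_mor F (VDom A s)) (pf_mor F (VCod A s)) (pf_cell F s)"
  by (rule cell_nat) (auto simp: cell_hom_iff mor_hom_iff simps)

lemma cell_typing:
  assumes "s \<in> Cell A" "x \<in> Obj (pf_ob F (Src A (VDom A s)))" "Trg A (VDom A s) = Y"
  shows "pf_cell F s x \<in> Arr (pf_ob F Y)"
    and "Dom (pf_ob F Y) (pf_cell F s x) = fob (pf_mor F (VDom A s)) x"
    and "Cod (pf_ob F Y) (pf_cell F s x) = fob (pf_mor F (VCod A s)) x"
  using nat_trans.component[OF nat_trans_cell[OF assms(1)] assms(2)] assms(3)
  by (auto simp: in_hom_iff)

lemma cell_square:
  assumes "s \<in> Cell A" "VDom A s = a" "VCod A s = b" "Src A a = X" "Trg A a = Y"
    "f \<in> Arr (pf_ob F X)" "Dom (pf_ob F X) f = x" "Cod (pf_ob F X) f = y"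
  shows "pf_cell F s y \<cdot>\<^bsub>pf_ob F Y\<^esub> far (pf_mor F a) f = far (pf_mor F b) f \<cdot>\<^bsub>pf_ob F Y\<^esub> pf_cell F s x"
  using nat_trans.natural[OF nat_trans_cell[OF assms(1)], of f x y] assms
  by (auto simp: in_hom_iff)

lemma cell_functorial:
  "a \<in> Mor A \<Longrightarrow> x \<in> Obj (pf_ob F (Src A a))
    \<Longrightarrow> pf_cell F (Id2 A a) x = Idn (pf_ob F (Trg A a)) (fob (pf_mor F a) x)"
  "s \<in> Cell A \<Longrightarrow> t \<in> Cell A \<Longrightarrow> VCod A s = VDom A t \<Longrightarrow> x \<in> Obj (pf_ob F (Src A (VDom A s)))
    \<Longrightarrow> pf_cell F (t \<bullet>\<^bsub>A\<^esub> s) x = pf_cell F t x \<cdot>\<^bsub>pf_ob F (Trg A (VDom A s))\<^esub> pf_cell F s x"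
  using cell_Id2 cell_VComp by (auto simp: cell_hom_iff mor_hom_iff simps)

lemma normal:
  "X \<in> Ob A \<Longrightarrow> x \<in> Obj (pf_ob F X) \<Longrightarrow> fob (pf_mor F (Id1 A X)) x = x"
  "X \<in> Ob A \<Longrightarrow> f \<in> Arr (pf_ob F X) \<Longrightarrow> far (pf_mor F (Id1 A X)) f = f"
  "a \<in> Mor A \<Longrightarrow> Trg A a = Y \<Longrightarrow> x \<in> Obj (pf_ob F (Src A a))
    \<Longrightarrow> pf_cpr F a (Id1 A Y) x = Idn (pf_ob F Y) (fob (pf_mor F a) x)"
  "a \<in> Mor A \<Longrightarrow> Src A a = X \<Longrightarrow> x \<in> Obj (pf_ob F (Src A a))
    \<Longrightarrow> pf_cpr F (Id1 A X) a x = Idn (pf_ob F (Trg A a)) (fob (pf_mor F a) x)"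
  using normal_ob normal_arr cpr_unit_left cpr_unit_right by (auto simp: mor_hom_iff)

lemma nat_iso_cpr: "a \<in> Mor A \<Longrightarrow> b \<in> Mor A \<Longrightarrow> Trg A a = Src A b
    \<Longrightarrow> nat_iso (pf_ob F (Src A a)) (pf_ob F (Trg A b))
            (comp_fctr (pf_mor F b) (pf_mor F a)) (pf_mor F (b \<odot>\<^bsub>A\<^esub> a)) (pf_cpr F a b)"
  using cpr_iso by (auto simp: mor_hom_iff)

lemma iso_cpr:
  assumes "a \<in> Mor A" "b \<in> Mor A" "Trg A a = Src A b" "x \<in> Obj (pf_ob F (Src A a))" "Trg A b = Z"
  shows "iso_hom (pf_ob F Z) (pf_cpr F a b x) (fob (pf_mor F b) (fob (pf_mor F a) x))
    (fob (pf_mor F (b \<odot>\<^bsub>A\<^esub> a)) x)"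
  using nat_iso.component_iso[OF nat_iso_cpr[OF assms(1-3)] assms(4)] assms(5)
  by (simp add: comp_fctr_def)

lemma cpr_typing:
  assumes "a \<in> Mor A" "b \<in> Mor A" "Trg A a = Src A b" "x \<in> Obj (pf_ob F (Src A a))" "Trg A b = Z"
  shows "pf_cpr F a b x \<in> Arr (pf_ob F Z)"
    and "Dom (pf_ob F Z) (pf_cpr F a b x) = fob (pf_mor F b) (fob (pf_mor F a) x)"
    and "Cod (pf_ob F Z) (pf_cpr F a b x) = fob (pf_mor F (b \<odot>\<^bsub>A\<^esub> a)) x"
  using iso_cpr[OF assms] by (auto dest: iso_homD)

lemma cpr_square:
  assumes "a \<in> Mor A" "b \<in> Mor A" "Src A a = X" "Trg A a = Src A b" "Trg A b = Z"
    "f \<in> Arr (pf_ob F X)" "Dom (pf_ob F X) f = x" "Cod (pf_ob F X) f = y"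
  shows "far (pf_mor F (b \<odot>\<^bsub>A\<^esub> a)) f \<cdot>\<^bsub>pf_ob F Z\<^esub> pf_cpr F a b x =
    pf_cpr F a b y \<cdot>\<^bsub>pf_ob F Z\<^esub> far (pf_mor F b) (far (pf_mor F a) f)"
  using nat_trans.natural[OF nat_iso.axioms(1)[OF nat_iso_cpr[OF assms(1,2,4)]], of f x y] assms
  by (simp add: in_hom_iff comp_fctr_def)

lemma cpr_cells:
  assumes "s \<in> Cell A" "VDom A s = a" "VCod A s = a'" "t \<in> Cell A" "VDom A t = b" "VCod A t = b'"
    "Src A a = X" "Trg A a = Src A b" "Trg A b = Z" "x \<in> Obj (pf_ob F X)"
  shows "pf_cell F (t \<star>\<^bsub>A\<^esub> s) x \<cdot>\<^bsub>pf_ob F Z\<^esub> pf_cpr F a b x =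
    pf_cpr F a' b' x \<cdot>\<^bsub>pf_ob F Z\<^esub>
      (pf_cell F t (fob (pf_mor F a') x) \<cdot>\<^bsub>pf_ob F Z\<^esub> far (pf_mor F b) (pf_cell F s x))"
  using cpr_natural[of s a a' t b b' X "Src A b" Z x] assms
  by (auto simp: cell_hom_iff mor_hom_iff simps)

lemma cpr_cocycle:
  assumes "a \<in> Mor A" "b \<in> Mor A" "c \<in> Mor A" "Src A a = W" "Trg A a = Src A b"
    "Trg A b = Src A c" "Trg A c = Z" "x \<in> Obj (pf_ob F W)"
  shows "pf_cpr F (b \<odot>\<^bsub>A\<^esub> a) c x \<cdot>\<^bsub>pf_ob F Z\<^esub> far (pf_mor F c) (pf_cpr F a b x) =
    pf_cpr F a (c \<odot>\<^bsub>A\<^esub> b) x \<cdot>\<^bsub>pf_ob F Z\<^esub> pf_cpr F b c (fob (pf_mor F a) x)"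
  using cpr_assoc[of a W "Src A b" b "Src A c" c Z x] assms by (auto simp: mor_hom_iff)

lemmas pf_simps = ob_category mor_typing cell_typing cell_functorial normal cpr_typing

end

text \<open>
  The contravariant situation of the theorem. The rules for pseudo-functors on \<open>op2 C\<close> are
  rewritten in terms of \<open>C\<close>, so that the opposite 2-category disappears from calculations.
\<close>

locale presheaf = two_category C + F: cat_valued "op2 C" F
  for C :: "('o, 'm, 't) twocat" (structure) and F :: "('o, 'm, 't, 'x, 'y) pfun"
begin

lemmas pf_simps = F.pf_simps[unfolded op2_simps] cat_simps
lemmas far_iso = F.far_iso[unfolded op2_simps]
lemmas cell_square = F.cell_square[unfolded op2_simps]
lemmas iso_cpr = F.iso_cpr[unfolded op2_simps]
lemmas cpr_square = F.cpr_square[unfolded op2_simps]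
lemmas cpr_cells = F.cpr_cells[unfolded op2_simps]
lemmas cpr_cocycle = F.cpr_cocycle[unfolded op2_simps]

end

section \<open>The 2-category of elements\<close>

context presheaf
begin

lemma el_mors_iff: "u \<in> el_mors C F \<longleftrightarrow>
    snd (esrc u) \<in> Obj (pf_ob F (fst (esrc u))) \<and> snd (etrg u) \<in> Obj (pf_ob F (fst (etrg u))) \<and>
    emor u \<in> Mor C \<and> Src C (emor u) = fst (etrg u) \<and> Trg C (emor u) = fst (esrc u) \<and>
    iso_hom (pf_ob F (fst (etrg u))) (eiso u) (snd (etrg u)) (fob (pf_mor F (emor u)) (snd (esrc u)))"
  by (cases u) (auto simp: el_mors_def mor_hom_iff)

lemma el_simps:
  "Ob (el C F) = {(X, x). X \<in> Ob C \<and> x \<in> Obj (pf_ob F X)}" "Mor (el C F) = el_mors C F"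
  "Src (el C F) = esrc" "Trg (el C F) = etrg" "VDom (el C F) = dsrc" "VCod (el C F) = dtrg"
  "Id1 (el C F) = el_id C F" "Id2 (el C F) u = DCell u u (Id2 C (emor u))"
  "v \<odot>\<^bsub>el C F\<^esub> u = el_comp C F v u"
  "t \<bullet>\<^bsub>el C F\<^esub> s = DCell (dsrc s) (dtrg t) (dval t \<bullet>\<^bsub>C\<^esub> dval s)"
  "t \<star>\<^bsub>el C F\<^esub> s = DCell (el_comp C F (dsrc t) (dsrc s)) (el_comp C F (dtrg t) (dtrg s))
       (dval s \<star>\<^bsub>C\<^esub> dval t)"
  by (simp_all add: el_def)

lemma el_mor_ob: "u \<in> el_mors C F \<Longrightarrow> fst (esrc u) \<in> Ob C \<and> fst (etrg u) \<in> Ob C"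
  using mor_simps(1,2)[of "emor u"] by (auto simp: el_mors_iff)

lemma el_eiso: "u \<in> el_mors C F \<Longrightarrow> eiso u \<in> Arr (pf_ob F (fst (etrg u))) \<and>
    Dom (pf_ob F (fst (etrg u))) (eiso u) = snd (etrg u) \<and>
    Cod (pf_ob F (fst (etrg u))) (eiso u) = fob (pf_mor F (emor u)) (snd (esrc u))"
  by (auto simp: el_mors_iff iso_homD)

lemmas el_comp_simp = el_comp_def[unfolded Let_def]

lemma el_comp_closed:
  assumes u: "u \<in> el_mors C F" and v: "v \<in> el_mors C F" and uv: "etrg u = esrc v"
  shows "el_comp C F v u \<in> el_mors C F"
proof -
  let ?K = "pf_ob F (fst (etrg v))" and ?x = "snd (esrc u)"
  have K: "category ?K" using el_mor_ob[OF v] by (simp add: pf_simps)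
  have "iso_hom ?K (far (pf_mor F (emor v)) (eiso u)) (fob (pf_mor F (emor v)) (snd (esrc v)))
      (fob (pf_mor F (emor v)) (fob (pf_mor F (emor u)) ?x))"
    using u v uv by (intro far_iso[where X = "fst (esrc v)"]) (auto simp: el_mors_iff)
  moreover have "iso_hom ?K (pf_cpr F (emor u) (emor v) ?x)
      (fob (pf_mor F (emor v)) (fob (pf_mor F (emor u)) ?x))
      (fob (pf_mor F (emor u \<odot> emor v)) ?x)"
    using u v uv by (intro iso_cpr) (auto simp: el_mors_iff)
  ultimately have "iso_hom ?K (eiso (el_comp C F v u)) (snd (etrg v))
      (fob (pf_mor F (emor u \<odot> emor v)) ?x)"
    using u v uv category.iso_Cmp[OF K] unfolding el_comp_simp el_mors_iff el_mor.sel
    by metis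
  then show ?thesis
    using u v uv by (auto simp: el_mors_iff el_comp_simp simps)
qed

text \<open>
  Associativity of the composition of elements: the cocycle condition moves one compositor past the
  image of the other, and naturality of the compositor moves the isomorphism \<open>p\<close> across.
\<close>

lemma el_comp_assoc_iso:
  assumes a: "a \<in> Mor C" "Trg C a = X1" "Src C a = X2" and b: "b \<in> Mor C" "Trg C b = X2" "Src C b = X3"
    and c: "c \<in> Mor C" "Trg C c = X3" "Src C c = X4"
    and x1: "x1 \<in> Obj (pf_ob F X1)"
    and p: "p \<in> Arr (pf_ob F X2)" "Dom (pf_ob F X2) p = x2" "Cod (pf_ob F X2) p = fob (pf_mor F a) x1"
    and q: "q \<in> Arr (pf_ob F X3)" "Dom (pf_ob F X3) q = x3" "Cod (pf_ob F X3) q = fob (pf_mor F b) x2"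
    and r: "r \<in> Arr (pf_ob F X4)" "Cod (pf_ob F X4) r = fob (pf_mor F c) x3"
  shows "pf_cpr F (a \<odot> b) c x1 \<cdot>\<^bsub>pf_ob F X4\<^esub> (far (pf_mor F c) (pf_cpr F a b x1 \<cdot>\<^bsub>pf_ob F X3\<^esub>
        (far (pf_mor F b) p \<cdot>\<^bsub>pf_ob F X3\<^esub> q)) \<cdot>\<^bsub>pf_ob F X4\<^esub> r) =
    pf_cpr F a (b \<odot> c) x1 \<cdot>\<^bsub>pf_ob F X4\<^esub> (far (pf_mor F (b \<odot> c)) p \<cdot>\<^bsub>pf_ob F X4\<^esub>
        (pf_cpr F b c x2 \<cdot>\<^bsub>pf_ob F X4\<^esub> (far (pf_mor F c) q \<cdot>\<^bsub>pf_ob F X4\<^esub> r)))" (is "?l = ?r")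
proof -
  let ?K = "pf_ob F X4" and ?F = "\<lambda>a. far (pf_mor F a)"
  have X: "X1 \<in> Ob C" "X2 \<in> Ob C" "X3 \<in> Ob C" "X4 \<in> Ob C" using a b c mor_simps(1,2) by auto
  have x2: "x2 \<in> Obj (pf_ob F X2)" and x3: "x3 \<in> Obj (pf_ob F X3)"
    using X p q category.Dom_Obj F.ob_category[unfolded op2_simps] by metis+
  note [simp] = X x1 x2 x3 a b c p q r pf_simps simps
  have "?l = pf_cpr F (a \<odot> b) c x1 \<cdot>\<^bsub>?K\<^esub> (?F c (pf_cpr F a b x1) \<cdot>\<^bsub>?K\<^esub>
      (?F c (?F b p) \<cdot>\<^bsub>?K\<^esub> (?F c q \<cdot>\<^bsub>?K\<^esub> r)))"
    by simp
  also have "\<dots> = pf_cpr F a (b \<odot> c) x1 \<cdot>\<^bsub>?K\<^esub> (pf_cpr F b c (fob (pf_mor F a) x1) \<cdot>\<^bsub>?K\<^esub>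
      (?F c (?F b p) \<cdot>\<^bsub>?K\<^esub> (?F c q \<cdot>\<^bsub>?K\<^esub> r)))"
    by (rule Cmp_square) (use cpr_cocycle[of a b c X1 X4 x1] in simp_all)
  also have "pf_cpr F b c (fob (pf_mor F a) x1) \<cdot>\<^bsub>?K\<^esub> (?F c (?F b p) \<cdot>\<^bsub>?K\<^esub> (?F c q \<cdot>\<^bsub>?K\<^esub> r)) =
      ?F (b \<odot> c) p \<cdot>\<^bsub>?K\<^esub> (pf_cpr F b c x2 \<cdot>\<^bsub>?K\<^esub> (?F c q \<cdot>\<^bsub>?K\<^esub> r))"
    by (rule Cmp_square) (use cpr_square[of b c X2 X4 p] in simp_all)
  finally show ?thesis .
qed

lemma category_el: "category (underlying_cat (el C F))"
proof (rule category.intro)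
  let ?U = "underlying_cat (el C F)"
  have U: "Obj ?U = {(X, x). X \<in> Ob C \<and> x \<in> Obj (pf_ob F X)}" "Arr ?U = el_mors C F"
    "Dom ?U = esrc" "Cod ?U = etrg" "Cmp ?U = el_comp C F" "Idn ?U = el_id C F"
    by (simp_all add: underlying_cat_def el_def)
  note [simp] = U in_hom_iff pf_simps simps
  show "Dom ?U u \<in> Obj ?U" "Cod ?U u \<in> Obj ?U" if "u \<in> Arr ?U" for u
    using that el_mor_ob[of u] by (auto simp: el_mors_iff)
  show "in_hom ?U (Idn ?U z) z z" if "z \<in> Obj ?U" for z
    using that by (auto simp: el_mors_iff el_id_def category.iso_Idn)
  show "in_hom ?U (v \<cdot>\<^bsub>?U\<^esub> u) x z" if "in_hom ?U u x y" "in_hom ?U v y z" for u v x y z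
    using that el_comp_closed by (auto simp: el_comp_simp)
  show "Idn ?U y \<cdot>\<^bsub>?U\<^esub> u = u" "u \<cdot>\<^bsub>?U\<^esub> Idn ?U x = u" if "in_hom ?U u x y" for u x y
    using that el_mor_ob[of u] el_eiso[of u]
    by (auto simp: el_comp_simp el_id_def el_mors_iff split_beta intro!: el_mor.expand)
  show "(w \<cdot>\<^bsub>?U\<^esub> v) \<cdot>\<^bsub>?U\<^esub> u = w \<cdot>\<^bsub>?U\<^esub> (v \<cdot>\<^bsub>?U\<^esub> u)"
    if "in_hom ?U u x1 x2" "in_hom ?U v x2 x3" "in_hom ?U w x3 x4" for u v w x1 x2 x3 x4
  proof -
    have "pf_cpr F (emor u \<odot> emor v) (emor w) (snd x1) \<cdot>\<^bsub>pf_ob F (fst x4)\<^esub>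
        (far (pf_mor F (emor w)) (pf_cpr F (emor u) (emor v) (snd x1) \<cdot>\<^bsub>pf_ob F (fst x3)\<^esub>
          (far (pf_mor F (emor v)) (eiso u) \<cdot>\<^bsub>pf_ob F (fst x3)\<^esub> eiso v)) \<cdot>\<^bsub>pf_ob F (fst x4)\<^esub> eiso w) =
      pf_cpr F (emor u) (emor v \<odot> emor w) (snd x1) \<cdot>\<^bsub>pf_ob F (fst x4)\<^esub>
        (far (pf_mor F (emor v \<odot> emor w)) (eiso u) \<cdot>\<^bsub>pf_ob F (fst x4)\<^esub>
        (pf_cpr F (emor v) (emor w) (snd x2) \<cdot>\<^bsub>pf_ob F (fst x4)\<^esub>
          (far (pf_mor F (emor w)) (eiso v) \<cdot>\<^bsub>pf_ob F (fst x4)\<^esub> eiso w)))"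
      using that el_eiso[of u] el_eiso[of v] el_eiso[of w]
      by (intro el_comp_assoc_iso[where ?X1.0 = "fst x1" and ?X2.0 = "fst x2"])
        (auto simp: el_mors_iff)
    then show ?thesis
      using that by (auto simp: el_comp_simp el_mors_iff)
  qed
qed

text \<open>
  The base is \<open>op2 C\<close>, since a morphism of elements lies over a morphism of \<open>C\<close> in the
  opposite direction.
\<close>

lemma el_eq: "el C F = cells_over (op2 C) (underlying_cat (el C F)) emor
    (\<lambda>u v s. eiso v = pf_cell F s (snd (esrc u)) \<cdot>\<^bsub>pf_ob F (fst (etrg u))\<^esub> eiso u)"
  by (simp add: el_def el_cells_def cells_over_def underlying_cat_def op2_simps)

text \<open>
  Closure of \<open>el(F)\<close> under horizontal composition: compatibility of the compositors with
  2-morphisms splits \<open>F (s \<star> t)\<close> into \<open>F s\<close> and \<open>F t\<close>, and naturality of \<open>F t\<close>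
  brings the latter next to \<open>q\<close>.
\<close>

lemma el_cells_HComp:
  assumes s: "s \<in> Cell C" "VDom C s = a" "VCod C s = a'" "Trg C a = X1" "Src C a = X2"
    and t: "t \<in> Cell C" "VDom C t = b" "VCod C t = b'" "Trg C b = X2" "Src C b = X3"
    and x1: "x1 \<in> Obj (pf_ob F X1)"
    and p: "p \<in> Arr (pf_ob F X2)" "Dom (pf_ob F X2) p = x2" "Cod (pf_ob F X2) p = fob (pf_mor F a) x1"
    and q: "q \<in> Arr (pf_ob F X3)" "Cod (pf_ob F X3) q = fob (pf_mor F b) x2"
  shows "pf_cell F (s \<star> t) x1 \<cdot>\<^bsub>pf_ob F X3\<^esub>
      (pf_cpr F a b x1 \<cdot>\<^bsub>pf_ob F X3\<^esub> (far (pf_mor F b) p \<cdot>\<^bsub>pf_ob F X3\<^esub> q)) =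
    pf_cpr F a' b' x1 \<cdot>\<^bsub>pf_ob F X3\<^esub> (far (pf_mor F b') (pf_cell F s x1 \<cdot>\<^bsub>pf_ob F X2\<^esub> p) \<cdot>\<^bsub>pf_ob F X3\<^esub>
      (pf_cell F t x2 \<cdot>\<^bsub>pf_ob F X3\<^esub> q))" (is "?l = ?r")
proof -
  let ?K = "pf_ob F X3" and ?F = "\<lambda>a. far (pf_mor F a)" and ?y = "fob (pf_mor F a') x1"
  have ab: "a \<in> Mor C" "b \<in> Mor C" "a' \<in> Mor C" "b' \<in> Mor C" using s t cell_simps(1,2) by auto
  have ab': "Trg C a' = X1" "Src C a' = X2" "Trg C b' = X2" "Src C b' = X3"
    using s t globular_simps by auto
  have X: "X1 \<in> Ob C" "X2 \<in> Ob C" "X3 \<in> Ob C" using s t ab mor_simps(1,2) by auto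
  have x2: "x2 \<in> Obj (pf_ob F X2)"
    using X p category.Dom_Obj F.ob_category[unfolded op2_simps] by metis
  note [simp] = X x1 x2 s t ab ab' p q pf_simps simps
  have "?l = pf_cpr F a' b' x1 \<cdot>\<^bsub>?K\<^esub> ((pf_cell F t ?y \<cdot>\<^bsub>?K\<^esub> ?F b (pf_cell F s x1)) \<cdot>\<^bsub>?K\<^esub> (?F b p \<cdot>\<^bsub>?K\<^esub> q))"
    by (rule Cmp_square) (use cpr_cells[of s a a' t b b' X1 X3 x1] in simp_all)
  also have "\<dots> = pf_cpr F a' b' x1 \<cdot>\<^bsub>?K\<^esub> (pf_cell F t ?y \<cdot>\<^bsub>?K\<^esub> (?F b (pf_cell F s x1 \<cdot>\<^bsub>pf_ob F X2\<^esub> p) \<cdot>\<^bsub>?K\<^esub> q))"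
    by simp
  also have "pf_cell F t ?y \<cdot>\<^bsub>?K\<^esub> (?F b (pf_cell F s x1 \<cdot>\<^bsub>pf_ob F X2\<^esub> p) \<cdot>\<^bsub>?K\<^esub> q) =
      ?F b' (pf_cell F s x1 \<cdot>\<^bsub>pf_ob F X2\<^esub> p) \<cdot>\<^bsub>?K\<^esub> (pf_cell F t x2 \<cdot>\<^bsub>?K\<^esub> q)"
    by (rule Cmp_square)
      (use cell_square[of t b b' X2 X3 "pf_cell F s x1 \<cdot>\<^bsub>pf_ob F X2\<^esub> p" x2 ?y] in simp_all)
  finally show ?thesis .
qed

lemma el_data: "cells_over_data (op2 C) (underlying_cat (el C F)) fst emor
    (\<lambda>u v s. eiso v = pf_cell F s (snd (esrc u)) \<cdot>\<^bsub>pf_ob F (fst (etrg u))\<^esub> eiso u)"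
proof (intro cells_over_data.intro cells_over_data_axioms.intro two_category_op2
    two_category_axioms category_el)
  let ?U = "underlying_cat (el C F)"
  let ?Q = "\<lambda>u v s. eiso v = pf_cell F s (snd (esrc u)) \<cdot>\<^bsub>pf_ob F (fst (etrg u))\<^esub> eiso u"
  have U: "Obj ?U = {(X, x). X \<in> Ob C \<and> x \<in> Obj (pf_ob F X)}" "Arr ?U = el_mors C F"
    "Dom ?U = esrc" "Cod ?U = etrg" "Cmp ?U = el_comp C F" "Idn ?U = el_id C F"
    by (simp_all add: underlying_cat_def el_def)
  note [simp] = pf_simps simps
  show "is_functor ?U (underlying_cat (op2 C)) \<lparr>fob = fst, far = emor\<rparr>"
    by (intro is_functor.intro is_functor_axioms.intro category_el two_category.underlying
        two_category_op2 two_category_axioms)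
      (auto simp: U in_hom_iff, auto simp: underlying_cat_def op2_simps el_comp_simp el_id_def el_mors_iff)
  show "?Q u u (Id2 (op2 C) (emor u))" if "u \<in> Arr ?U" for u
    using that el_mor_ob[of u] el_eiso[of u] by (auto simp: U op2_simps el_mors_iff)
  fix s t
  assume s: "s \<in> Cell (cells_over (op2 C) ?U emor ?Q)" and t: "t \<in> Cell (cells_over (op2 C) ?U emor ?Q)"
  show "?Q (dsrc s) (dtrg t) (dval t \<bullet>\<^bsub>op2 C\<^esub> dval s)" if "dtrg s = dsrc t"
    using s t that el_mor_ob[of "dsrc s"] el_eiso[of "dsrc s"]
    by (auto simp: Cell_cells_over U op2_simps el_mors_iff)
  assume st: "Cod ?U (dsrc s) = Dom ?U (dsrc t)"
  show "?Q (dsrc t \<cdot>\<^bsub>?U\<^esub> dsrc s) (dtrg t \<cdot>\<^bsub>?U\<^esub> dtrg s) (dval t \<star>\<^bsub>op2 C\<^esub> dval s)"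
    using s t st el_cells_HComp[of "dval s" "emor (dsrc s)" "emor (dtrg s)" "fst (esrc (dsrc s))"
        "fst (etrg (dsrc s))" "dval t" "emor (dsrc t)" "emor (dtrg t)" "fst (etrg (dsrc t))"
        "snd (esrc (dsrc s))" "eiso (dsrc s)" "snd (etrg (dsrc s))" "eiso (dsrc t)"]
      el_eiso[of "dsrc s"] el_eiso[of "dsrc t"]
    by (simp add: Cell_cells_over U op2_simps el_mors_iff el_comp_simp)
qed

lemma two_category_el: "two_category (el C F)"
  using cells_over_data.two_category_cells_over[OF el_data] by (simp flip: el_eq)

lemma cell_hom_el: "cell_hom (el C F) s u v \<longleftrightarrow> s = DCell u v (dval s) \<and> u \<in> el_mors C F \<and>
    v \<in> el_mors C F \<and> esrc u = esrc v \<and> etrg u = etrg v \<and> cell_hom C (dval s) (emor u) (emor v) \<and>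
    eiso v = pf_cell F (dval s) (snd (esrc u)) \<cdot>\<^bsub>pf_ob F (fst (etrg u))\<^esub> eiso u"
  by (cases s) (auto simp: cell_hom_iff el_def el_cells_def)

end

section \<open>The 2-category of morphisms\<close>

context presheaf
begin

lemma mo_mors_iff: "u \<in> mo_mors C F \<longleftrightarrow>
    (let X' = fst (msrc u); \<alpha>' = snd (msrc u); X = fst (mtrg u); \<alpha> = snd (mtrg u) in
      \<alpha>' \<in> Arr (pf_ob F X') \<and> \<alpha> \<in> Arr (pf_ob F X) \<and>
      mel0 u \<in> el_mors C F \<and> mel1 u \<in> el_mors C F \<and>
      esrc (mel0 u) = (X', Dom (pf_ob F X') \<alpha>') \<and> etrg (mel0 u) = (X, Dom (pf_ob F X) \<alpha>) \<and>
      esrc (mel1 u) = (X', Cod (pf_ob F X') \<alpha>') \<and> etrg (mel1 u) = (X, Cod (pf_ob F X) \<alpha>) \<and>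
      cell_hom C (mcell u) (emor (mel0 u)) (emor (mel1 u)) \<and>
      eiso (mel1 u) \<cdot>\<^bsub>pf_ob F X\<^esub> \<alpha> = pf_cell F (mcell u) (Cod (pf_ob F X') \<alpha>') \<cdot>\<^bsub>pf_ob F X\<^esub>
        (far (pf_mor F (emor (mel0 u))) \<alpha>' \<cdot>\<^bsub>pf_ob F X\<^esub> eiso (mel0 u)))"
proof (cases u)
  case (MoMor s t u0 u1 \<gamma>)
  show ?thesis
    by (cases s; cases t; cases u0; cases u1)
      (auto simp: MoMor mo_mors_def in_hom_iff[of "pf_ob F _"] Let_def)
qed

text \<open>
  The square of a composite in \<open>mor(F)\<close> is obtained by pasting \<open>F c\<close> of the first square to the
  second one; the compositors, their compatibility with 2-morphisms and naturality of \<open>F t\<close> turn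
  the outer boundary into the required form.
\<close>

lemma mo_comp_square:
  assumes s: "s \<in> Cell C" "VDom C s = a" "VCod C s = b" "Trg C a = X1" "Src C a = X2"
    and t: "t \<in> Cell C" "VDom C t = c" "VCod C t = d" "Trg C c = X2" "Src C c = X3"
    and \<alpha>1: "\<alpha>1 \<in> Arr (pf_ob F X1)" "Dom (pf_ob F X1) \<alpha>1 = x1" "Cod (pf_ob F X1) \<alpha>1 = y1"
    and \<alpha>2: "\<alpha>2 \<in> Arr (pf_ob F X2)" "Dom (pf_ob F X2) \<alpha>2 = x2" "Cod (pf_ob F X2) \<alpha>2 = y2"
    and \<alpha>3: "\<alpha>3 \<in> Arr (pf_ob F X3)" "Dom (pf_ob F X3) \<alpha>3 = x3" "Cod (pf_ob F X3) \<alpha>3 = y3"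
    and p: "p \<in> Arr (pf_ob F X2)" "Dom (pf_ob F X2) p = x2" "Cod (pf_ob F X2) p = fob (pf_mor F a) x1"
    and q: "q \<in> Arr (pf_ob F X2)" "Dom (pf_ob F X2) q = y2" "Cod (pf_ob F X2) q = fob (pf_mor F b) y1"
    and p': "p' \<in> Arr (pf_ob F X3)" "Dom (pf_ob F X3) p' = x3" "Cod (pf_ob F X3) p' = fob (pf_mor F c) x2"
    and q': "q' \<in> Arr (pf_ob F X3)" "Dom (pf_ob F X3) q' = y3" "Cod (pf_ob F X3) q' = fob (pf_mor F d) y2"
    and eq: "q \<cdot>\<^bsub>pf_ob F X2\<^esub> \<alpha>2 =
        pf_cell F s y1 \<cdot>\<^bsub>pf_ob F X2\<^esub> (far (pf_mor F a) \<alpha>1 \<cdot>\<^bsub>pf_ob F X2\<^esub> p)"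
      "q' \<cdot>\<^bsub>pf_ob F X3\<^esub> \<alpha>3 =
        pf_cell F t y2 \<cdot>\<^bsub>pf_ob F X3\<^esub> (far (pf_mor F c) \<alpha>2 \<cdot>\<^bsub>pf_ob F X3\<^esub> p')"
  shows "(pf_cpr F b d y1 \<cdot>\<^bsub>pf_ob F X3\<^esub> (far (pf_mor F d) q \<cdot>\<^bsub>pf_ob F X3\<^esub> q')) \<cdot>\<^bsub>pf_ob F X3\<^esub> \<alpha>3 =
    pf_cell F (s \<star> t) y1 \<cdot>\<^bsub>pf_ob F X3\<^esub> (far (pf_mor F (a \<odot> c)) \<alpha>1 \<cdot>\<^bsub>pf_ob F X3\<^esub>
      (pf_cpr F a c x1 \<cdot>\<^bsub>pf_ob F X3\<^esub> (far (pf_mor F c) p \<cdot>\<^bsub>pf_ob F X3\<^esub> p')))" (is "?l = ?r")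
proof -
  let ?K = "pf_ob F X3" and ?F = "\<lambda>a. far (pf_mor F a)" and ?y = "fob (pf_mor F b) y1"
  have ab: "a \<in> Mor C" "b \<in> Mor C" "c \<in> Mor C" "d \<in> Mor C" using s t cell_simps(1,2) by auto
  have ab': "Trg C b = X1" "Src C b = X2" "Trg C d = X2" "Src C d = X3"
    using s t globular_simps by auto
  have X: "X1 \<in> Ob C" "X2 \<in> Ob C" "X3 \<in> Ob C" using s t ab mor_simps(1,2) by auto
  have ob: "x1 \<in> Obj (pf_ob F X1)" "y1 \<in> Obj (pf_ob F X1)" "x2 \<in> Obj (pf_ob F X2)" "y2 \<in> Obj (pf_ob F X2)"
    using X \<alpha>1 \<alpha>2 category.Dom_Obj category.Cod_Obj F.ob_category[unfolded op2_simps] by metis+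
  note [simp] = X ob s t ab ab' \<alpha>1 \<alpha>2 \<alpha>3 p q p' q' pf_simps simps
  have "?r = pf_cell F (s \<star> t) y1 \<cdot>\<^bsub>?K\<^esub> (pf_cpr F a c y1 \<cdot>\<^bsub>?K\<^esub> (?F c (?F a \<alpha>1) \<cdot>\<^bsub>?K\<^esub> (?F c p \<cdot>\<^bsub>?K\<^esub> p')))"
    by (subst Cmp_square[OF _ cpr_square[of a c X1 X3 \<alpha>1]]) simp_all
  also have "\<dots> = pf_cpr F b d y1 \<cdot>\<^bsub>?K\<^esub> ((pf_cell F t ?y \<cdot>\<^bsub>?K\<^esub> ?F c (pf_cell F s y1)) \<cdot>\<^bsub>?K\<^esub>
      (?F c (?F a \<alpha>1) \<cdot>\<^bsub>?K\<^esub> (?F c p \<cdot>\<^bsub>?K\<^esub> p')))"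
    by (rule Cmp_square) (use cpr_cells[of s a b t c d X1 X3 y1] in simp_all)
  also have "\<dots> = pf_cpr F b d y1 \<cdot>\<^bsub>?K\<^esub> (pf_cell F t ?y \<cdot>\<^bsub>?K\<^esub>
      (?F c (pf_cell F s y1 \<cdot>\<^bsub>pf_ob F X2\<^esub> (?F a \<alpha>1 \<cdot>\<^bsub>pf_ob F X2\<^esub> p)) \<cdot>\<^bsub>?K\<^esub> p'))"
    by simp
  also have "\<dots> = pf_cpr F b d y1 \<cdot>\<^bsub>?K\<^esub> (pf_cell F t ?y \<cdot>\<^bsub>?K\<^esub> (?F c q \<cdot>\<^bsub>?K\<^esub> (?F c \<alpha>2 \<cdot>\<^bsub>?K\<^esub> p')))"
    by (subst eq(1)[symmetric]) simp
  also have "pf_cell F t ?y \<cdot>\<^bsub>?K\<^esub> (?F c q \<cdot>\<^bsub>?K\<^esub> (?F c \<alpha>2 \<cdot>\<^bsub>?K\<^esub> p')) =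
      ?F d q \<cdot>\<^bsub>?K\<^esub> (pf_cell F t y2 \<cdot>\<^bsub>?K\<^esub> (?F c \<alpha>2 \<cdot>\<^bsub>?K\<^esub> p'))"
    by (rule Cmp_square) (use cell_square[of t c d X2 X3 q y2 ?y] in simp_all)
  also have "pf_cell F t y2 \<cdot>\<^bsub>?K\<^esub> (?F c \<alpha>2 \<cdot>\<^bsub>?K\<^esub> p') = q' \<cdot>\<^bsub>?K\<^esub> \<alpha>3" by (simp add: eq(2))
  finally show ?thesis by simp
qed

lemma mo_comp_closed:
  assumes u: "u \<in> mo_mors C F" and v: "v \<in> mo_mors C F" and uv: "mtrg u = msrc v"
  shows "mo_comp C F v u \<in> mo_mors C F"
proof -
  obtain X1 \<alpha>1 where 1: "msrc u = (X1, \<alpha>1)" by fastforce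
  obtain X2 \<alpha>2 where 2: "msrc v = (X2, \<alpha>2)" by fastforce
  obtain X3 \<alpha>3 where 3: "mtrg v = (X3, \<alpha>3)" by fastforce
  note u' = u[unfolded mo_mors_iff, simplified 1 uv 2 Let_def fst_conv snd_conv cell_hom_iff]
  note v' = v[unfolded mo_mors_iff, simplified 2 3 Let_def fst_conv snd_conv cell_hom_iff]
  have el: "el_comp C F (mel0 v) (mel0 u) \<in> el_mors C F" "el_comp C F (mel1 v) (mel1 u) \<in> el_mors C F"
    using u' v' by (auto intro!: el_comp_closed)
  have "(pf_cpr F (emor (mel1 u)) (emor (mel1 v)) (Cod (pf_ob F X1) \<alpha>1) \<cdot>\<^bsub>pf_ob F X3\<^esub>
      (far (pf_mor F (emor (mel1 v))) (eiso (mel1 u)) \<cdot>\<^bsub>pf_ob F X3\<^esub> eiso (mel1 v))) \<cdot>\<^bsub>pf_ob F X3\<^esub> \<alpha>3 =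
    pf_cell F (mcell u \<star> mcell v) (Cod (pf_ob F X1) \<alpha>1) \<cdot>\<^bsub>pf_ob F X3\<^esub>
      (far (pf_mor F (emor (mel0 u) \<odot> emor (mel0 v))) \<alpha>1 \<cdot>\<^bsub>pf_ob F X3\<^esub>
      (pf_cpr F (emor (mel0 u)) (emor (mel0 v)) (Dom (pf_ob F X1) \<alpha>1) \<cdot>\<^bsub>pf_ob F X3\<^esub>
        (far (pf_mor F (emor (mel0 v))) (eiso (mel0 u)) \<cdot>\<^bsub>pf_ob F X3\<^esub> eiso (mel0 v))))"
    using u' v' el_eiso[of "mel0 u"] el_eiso[of "mel0 v"] el_eiso[of "mel1 u"] el_eiso[of "mel1 v"]
    by (intro mo_comp_square[where ?X1.0 = X1 and ?X2.0 = X2 and ?X3.0 = X3 and ?\<alpha>2.0 = \<alpha>2])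
      (auto simp: el_mors_iff)
  moreover have "cell_hom C (mcell u \<star> mcell v) (emor (mel0 u) \<odot> emor (mel0 v))
      (emor (mel1 u) \<odot> emor (mel1 v))"
    using u' v' by (auto simp: cell_hom_iff HComp_simps el_mors_iff)
  ultimately show ?thesis
    using el u' v' by (simp add: mo_mors_iff mo_comp_def el_comp_simp Let_def 1 2 3)
qed

lemma el_category_simps:
  "u \<in> el_mors C F \<Longrightarrow> v \<in> el_mors C F \<Longrightarrow> w \<in> el_mors C F \<Longrightarrow> etrg u = esrc v \<Longrightarrow> etrg v = esrc w
    \<Longrightarrow> el_comp C F (el_comp C F w v) u = el_comp C F w (el_comp C F v u)"
  "u \<in> el_mors C F \<Longrightarrow> etrg u = z \<Longrightarrow> el_comp C F (el_id C F z) u = u"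
  "u \<in> el_mors C F \<Longrightarrow> esrc u = z \<Longrightarrow> el_comp C F u (el_id C F z) = u"
  "X \<in> Ob C \<Longrightarrow> x \<in> Obj (pf_ob F X) \<Longrightarrow> el_id C F (X, x) \<in> el_mors C F"
  using category.Cmp_assoc_arr[OF category_el] category.Idn_Cmp[OF category_el]
    category.Idn_simps(1)[OF category_el]
  by (auto simp: underlying_cat_def el_simps)

lemma el_id_sel:
  "esrc (el_id C F z) = z" "etrg (el_id C F z) = z" "emor (el_id C F z) = Id1 C (fst z)"
  "eiso (el_id C F z) = Idn (pf_ob F (fst z)) (snd z)"
  by (simp_all add: el_id_def split_beta)

lemma category_mor: "category (underlying_cat (mor C F))"
proof (rule category.intro)
  let ?U = "underlying_cat (mor C F)"
  have U: "Obj ?U = {(X, \<alpha>). X \<in> Ob C \<and> \<alpha> \<in> Arr (pf_ob F X)}" "Arr ?U = mo_mors C F"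
    "Dom ?U = msrc" "Cod ?U = mtrg" "Cmp ?U = mo_comp C F"
    "Idn ?U = (\<lambda>(X, \<alpha>). MoMor (X, \<alpha>) (X, \<alpha>) (el_id C F (X, Dom (pf_ob F X) \<alpha>))
       (el_id C F (X, Cod (pf_ob F X) \<alpha>)) (Id2 C (Id1 C X)))"
    by (simp_all add: underlying_cat_def mor_def)
  note [simp] = U in_hom_iff pf_simps simps el_category_simps el_id_sel
  show "Dom ?U u \<in> Obj ?U" "Cod ?U u \<in> Obj ?U" if "u \<in> Arr ?U" for u
    using that el_mor_ob[of "mel0 u"] by (auto simp: mo_mors_iff Let_def)
  show "in_hom ?U (Idn ?U z) z z" if "z \<in> Obj ?U" for z
    using that by (auto simp: mo_mors_iff Let_def vertical_cat_def)
  show "in_hom ?U (v \<cdot>\<^bsub>?U\<^esub> u) x z" if "in_hom ?U u x y" "in_hom ?U v y z" for u v x y z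
    using that mo_comp_closed by (auto simp: mo_comp_def)
  show "Idn ?U y \<cdot>\<^bsub>?U\<^esub> u = u" "u \<cdot>\<^bsub>?U\<^esub> Idn ?U x = u" if "in_hom ?U u x y" for u x y
  proof -
    have u: "u \<in> mo_mors C F" "x = msrc u" "y = mtrg u" using that by auto
    then have "mel0 u \<in> el_mors C F" "mel1 u \<in> el_mors C F"
      "mcell u \<in> Cell C" "VDom C (mcell u) = emor (mel0 u)"
      "esrc (mel0 u) = (fst (msrc u), Dom (pf_ob F (fst (msrc u))) (snd (msrc u)))"
      "etrg (mel0 u) = (fst (mtrg u), Dom (pf_ob F (fst (mtrg u))) (snd (mtrg u)))"
      "esrc (mel1 u) = (fst (msrc u), Cod (pf_ob F (fst (msrc u))) (snd (msrc u)))"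
      "etrg (mel1 u) = (fst (mtrg u), Cod (pf_ob F (fst (mtrg u))) (snd (mtrg u)))"
      by (auto simp: mo_mors_iff Let_def vertical_cat_def)
    moreover from this have "Src C (emor (mel0 u)) = fst (mtrg u)" "Trg C (emor (mel0 u)) = fst (msrc u)"
      by (auto simp: el_mors_iff)
    ultimately show "Idn ?U y \<cdot>\<^bsub>?U\<^esub> u = u" "u \<cdot>\<^bsub>?U\<^esub> Idn ?U x = u"
      using u by (simp_all add: mo_comp_def split_beta mo_mor.expand)
  qed
  show "(w \<cdot>\<^bsub>?U\<^esub> v) \<cdot>\<^bsub>?U\<^esub> u = w \<cdot>\<^bsub>?U\<^esub> (v \<cdot>\<^bsub>?U\<^esub> u)"
    if "in_hom ?U u x1 x2" "in_hom ?U v x2 x3" "in_hom ?U w x3 x4" for u v w x1 x2 x3 x4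
    using that by (auto simp: mo_comp_def mo_mors_iff Let_def vertical_cat_def el_mors_iff)
qed

lemma mor_eq: "mor C F = cells_over (prod2 (el C F) (el C F)) (underlying_cat (mor C F))
    (\<lambda>u. (mel0 u, mel1 u)) (\<lambda>u v z. mcell v \<bullet> dval (fst z) = dval (snd z) \<bullet> mcell u)"
  by (auto simp: mor_def mo_cells_def cells_over_def underlying_cat_def prod2_simps cell_hom_iff)

lemma mor_data: "cells_over_data (prod2 (el C F) (el C F)) (underlying_cat (mor C F))
    (\<lambda>z. ((fst z, Dom (pf_ob F (fst z)) (snd z)), (fst z, Cod (pf_ob F (fst z)) (snd z))))
    (\<lambda>u. (mel0 u, mel1 u)) (\<lambda>u v z. mcell v \<bullet> dval (fst z) = dval (snd z) \<bullet> mcell u)"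
proof (intro cells_over_data.intro cells_over_data_axioms.intro two_category_prod2
    two_category_el category_mor)
  let ?U = "underlying_cat (mor C F)" and ?E = "el C F"
  let ?Q = "\<lambda>u v z. mcell v \<bullet> dval (fst z) = dval (snd z) \<bullet> mcell u"
  let ?\<phi> = "\<lambda>u. (mel0 u, mel1 u)"
  have U: "Obj ?U = {(X, \<alpha>). X \<in> Ob C \<and> \<alpha> \<in> Arr (pf_ob F X)}" "Arr ?U = mo_mors C F"
    "Dom ?U = msrc" "Cod ?U = mtrg" "Cmp ?U = mo_comp C F"
    "Idn ?U = (\<lambda>(X, \<alpha>). MoMor (X, \<alpha>) (X, \<alpha>) (el_id C F (X, Dom (pf_ob F X) \<alpha>))
       (el_id C F (X, Cod (pf_ob F X) \<alpha>)) (Id2 C (Id1 C X)))"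
    by (simp_all add: underlying_cat_def mor_def)
  note [simp] = pf_simps simps el_category_simps
  show "is_functor ?U (underlying_cat (prod2 ?E ?E)) \<lparr>fob = (\<lambda>z. ((fst z, Dom (pf_ob F (fst z)) (snd z)),
      (fst z, Cod (pf_ob F (fst z)) (snd z)))), far = ?\<phi>\<rparr>"
    by (intro is_functor.intro is_functor_axioms.intro category_mor two_category.underlying
        two_category_prod2 two_category_el)
      (auto simp: U in_hom_iff,
       auto simp: underlying_cat_def prod2_simps el_simps mo_comp_def mo_mors_iff Let_def)
  have mo: "mcell u \<in> Cell C" "VDom C (mcell u) = emor (mel0 u)" "VCod C (mcell u) = emor (mel1 u)"
    if "u \<in> mo_mors C F" for u
    using that by (auto simp: mo_mors_iff Let_def cell_hom_iff)
  have E: "s \<in> Cell ?E \<Longrightarrow> dval s \<in> Cell C \<and> VDom C (dval s) = emor (dsrc s) \<and>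
      VCod C (dval s) = emor (dtrg s)" for s
    by (auto simp: el_def el_cells_def cell_hom_iff)
  show "?Q u u (Id2 (prod2 ?E ?E) (?\<phi> u))" if "u \<in> Arr ?U" for u
    using that mo[of u] by (simp add: U prod2_simps el_simps)
  fix s t
  assume s: "s \<in> Cell (cells_over (prod2 ?E ?E) ?U ?\<phi> ?Q)"
    and t: "t \<in> Cell (cells_over (prod2 ?E ?E) ?U ?\<phi> ?Q)"
  note st = s t mo[of "dsrc s"] mo[of "dtrg s"] mo[of "dsrc t"] mo[of "dtrg t"]
    E[of "fst (dval s)"] E[of "snd (dval s)"] E[of "fst (dval t)"] E[of "snd (dval t)"]
  show "?Q (dsrc s) (dtrg t) (dval t \<bullet>\<^bsub>prod2 ?E ?E\<^esub> dval s)" if "dtrg s = dsrc t"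
    using st that
    by (auto simp: Cell_cells_over U prod2_simps el_simps) (simp flip: cell_simps(11), simp)
  assume "Cod ?U (dsrc s) = Dom ?U (dsrc t)"
  then have e: "etrg (mel0 (dsrc s)) = esrc (mel0 (dsrc t))" "etrg (mel1 (dsrc s)) = esrc (mel1 (dsrc t))"
    "etrg (mel0 (dtrg s)) = esrc (mel0 (dtrg t))" "etrg (mel1 (dtrg s)) = esrc (mel1 (dtrg t))"
    "mel0 (dsrc s) \<in> el_mors C F" "mel0 (dsrc t) \<in> el_mors C F"
    "mel1 (dsrc s) \<in> el_mors C F" "mel1 (dsrc t) \<in> el_mors C F"
    "mel0 (dtrg s) \<in> el_mors C F" "mel0 (dtrg t) \<in> el_mors C F"
    "mel1 (dtrg s) \<in> el_mors C F" "mel1 (dtrg t) \<in> el_mors C F"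
    using s t by (auto simp: Cell_cells_over U mo_mors_iff Let_def)
  show "?Q (dsrc t \<cdot>\<^bsub>?U\<^esub> dsrc s) (dtrg t \<cdot>\<^bsub>?U\<^esub> dtrg s) (dval t \<star>\<^bsub>prod2 ?E ?E\<^esub> dval s)"
    using st e
    by (simp add: Cell_cells_over U prod2_simps el_simps mo_comp_def el_mors_iff mem_Times_iff
        interchange_cell[symmetric])
qed

lemma two_category_mor: "two_category (mor C F)"
  using cells_over_data.two_category_cells_over[OF mor_data] by (simp flip: mor_eq)

end

section \<open>Universal elements\<close>

text \<open>
  The functor \<open>C(X, I) \<rightarrow> F X\<close> given by \<open>i \<in> F I\<close>; its formula does not depend on \<open>X\<close>
  and \<open>I\<close>.
\<close>

definition evaluation :: "('o, 'm, 't, 'x, 'y) pfun \<Rightarrow> 'x \<Rightarrow> ('m, 't, 'x, 'y) fctr" where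
  "evaluation F i = \<lparr>fob = (\<lambda>c. fob (pf_mor F c) i), far = (\<lambda>s. pf_cell F s i)\<rparr>"

definition universal_element ::
  "('o, 'm, 't) twocat \<Rightarrow> ('o, 'm, 't, 'x, 'y) pfun \<Rightarrow> 'o \<Rightarrow> 'x \<Rightarrow> bool" where
  "universal_element C F I i \<longleftrightarrow> I \<in> Ob C \<and> i \<in> Obj (pf_ob F I) \<and>
     (\<forall>X \<in> Ob C. cat_equivalence (hom_cat C X I) (pf_ob F X) (evaluation F i))"

context presheaf
begin

lemma is_functor_evaluation:
  assumes "X \<in> Ob C" "i \<in> Obj (pf_ob F I)"
  shows "is_functor (hom_cat C X I) (pf_ob F X) (evaluation F i)"
  using assms
  by (intro is_functor.intro category_hom_cat is_functor_axioms.intro)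
    (auto simp: evaluation_def in_hom_iff hom_cat_simps Arr_hom_cat pf_simps simps)

text \<open>
  A morphism of \<open>el(F)\<close> from \<open>(I, i)\<close> to \<open>(X, x)\<close>, and below a morphism of \<open>mor(F)\<close> from
  \<open>(I, id)\<close> to \<open>(X, \<alpha>)\<close>, as bare data. In the square of the latter the factor
  \<open>(F c) id\<close> is an identity and has been removed.
\<close>

definition el_from :: "'o \<Rightarrow> 'x \<Rightarrow> 'o \<Rightarrow> 'x \<Rightarrow> 'm \<Rightarrow> 'y \<Rightarrow> bool" where
  "el_from I i X x c p \<longleftrightarrow> mor_hom C c X I \<and> iso_hom (pf_ob F X) p x (fob (pf_mor F c) i)"

definition mor_from :: "'o \<Rightarrow> 'x \<Rightarrow> 'o \<Rightarrow> 'y \<Rightarrow> 'm \<Rightarrow> 'y \<Rightarrow> 'm \<Rightarrow> 'y \<Rightarrow> 't \<Rightarrow> bool" where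
  "mor_from I i X \<alpha> c p d q s \<longleftrightarrow> \<alpha> \<in> Arr (pf_ob F X) \<and>
     el_from I i X (Dom (pf_ob F X) \<alpha>) c p \<and> el_from I i X (Cod (pf_ob F X) \<alpha>) d q \<and>
     cell_hom C s c d \<and> q \<cdot>\<^bsub>pf_ob F X\<^esub> \<alpha> = pf_cell F s i \<cdot>\<^bsub>pf_ob F X\<^esub> p"

lemma el_fromD:
  assumes "el_from I i X x c p"
  shows "c \<in> Mor C" "Src C c = X" "Trg C c = I" "X \<in> Ob C" "I \<in> Ob C"
    "p \<in> Arr (pf_ob F X)" "Dom (pf_ob F X) p = x" "Cod (pf_ob F X) p = fob (pf_mor F c) i"
    "x \<in> Obj (pf_ob F X)"
proof -
  show *: "c \<in> Mor C" "Src C c = X" "Trg C c = I"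
    and p: "p \<in> Arr (pf_ob F X)" "Dom (pf_ob F X) p = x" "Cod (pf_ob F X) p = fob (pf_mor F c) i"
    using assms by (auto simp: el_from_def mor_hom_iff dest: iso_homD)
  show X: "X \<in> Ob C" "I \<in> Ob C" using mor_simps(1,2)[of c] * by auto
  show "x \<in> Obj (pf_ob F X)" using p X pf_simps by metis
qed

text \<open>
  The criterion for bi-initiality, with the end points that morphisms and 2-morphisms carry
  stripped off. The same is done for \<open>mor(F)\<close> below.
\<close>

lemma bi_initial_el_iff:
  assumes I: "I \<in> Ob C" and i: "i \<in> Obj (pf_ob F I)"
  shows "bi_initial (el C F) (I, i) \<longleftrightarrow>
    (\<forall>X \<in> Ob C. \<forall>x \<in> Obj (pf_ob F X). \<exists>c p. el_from I i X x c p) \<and>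
    (\<forall>X x c p d q. el_from I i X x c p \<and> el_from I i X x d q \<longrightarrow>
      (\<exists>!s. cell_hom C s c d \<and> q = pf_cell F s i \<cdot>\<^bsub>pf_ob F X\<^esub> p))" (is "_ \<longleftrightarrow> ?E \<and> ?U")
proof -
  have mor: "mor_hom (el C F) u (I, i) z \<longleftrightarrow>
      u = ElMor (I, i) z (emor u) (eiso u) \<and> el_from I i (fst z) (snd z) (emor u) (eiso u)" for u z
    using i el_fromD(9)[of I i "fst z" "snd z"]
    by (cases u) (auto simp: mor_hom_iff el_simps el_mors_iff el_from_def)
  have ob: "(I, i) \<in> Ob (el C F)" using assms by (simp add: el_simps)
  have "(\<forall>z \<in> Ob (el C F). \<exists>u. mor_hom (el C F) u (I, i) z) \<longleftrightarrow> ?E"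
  proof
    assume *: "\<forall>z \<in> Ob (el C F). \<exists>u. mor_hom (el C F) u (I, i) z"
    show ?E
    proof (intro ballI)
      fix X x assume "X \<in> Ob C" "x \<in> Obj (pf_ob F X)"
      then have "\<exists>u. mor_hom (el C F) u (I, i) (X, x)" using * by (simp add: el_simps)
      then show "\<exists>c p. el_from I i X x c p" by (auto simp: mor)
    qed
  next
    assume ?E
    show "\<forall>z \<in> Ob (el C F). \<exists>u. mor_hom (el C F) u (I, i) z"
    proof
      fix z assume "z \<in> Ob (el C F)"
      then have "fst z \<in> Ob C" "snd z \<in> Obj (pf_ob F (fst z))" by (auto simp: el_simps)
      then have "\<exists>c p. el_from I i (fst z) (snd z) c p" using \<open>?E\<close> by simp
      then obtain c p where "el_from I i (fst z) (snd z) c p" by auto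
      then show "\<exists>u. mor_hom (el C F) u (I, i) z" by (intro exI[of _ "ElMor (I, i) z c p"]) (simp add: mor)
    qed
  qed
  moreover have "(\<forall>z u v. mor_hom (el C F) u (I, i) z \<and> mor_hom (el C F) v (I, i) z \<longrightarrow>
      (\<exists>!s. cell_hom (el C F) s u v)) \<longleftrightarrow> ?U"
  proof
    assume *: "\<forall>z u v. mor_hom (el C F) u (I, i) z \<and> mor_hom (el C F) v (I, i) z \<longrightarrow>
      (\<exists>!s. cell_hom (el C F) s u v)"
    show ?U
    proof (intro allI impI, elim conjE)
      fix X x c p d q assume cp: "el_from I i X x c p" and dq: "el_from I i X x d q"
      let ?u = "ElMor (I, i) (X, x) c p" and ?v = "ElMor (I, i) (X, x) d q"
      have uv: "?u \<in> el_mors C F" "?v \<in> el_mors C F" using cp dq mor[of ?u "(X, x)"] mor[of ?v "(X, x)"]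
        by (auto simp: mor_hom_iff el_simps)
      have "\<exists>!s. cell_hom (el C F) s ?u ?v" using * cp dq mor[of ?u "(X, x)"] mor[of ?v "(X, x)"] by simp
      then obtain s where s: "cell_hom (el C F) s ?u ?v"
        and un: "\<And>t. cell_hom (el C F) t ?u ?v \<Longrightarrow> t = s" by blast
      show "\<exists>!s. cell_hom C s c d \<and> q = pf_cell F s i \<cdot>\<^bsub>pf_ob F X\<^esub> p"
      proof (rule ex1I[of _ "dval s"])
        show "cell_hom C (dval s) c d \<and> q = pf_cell F (dval s) i \<cdot>\<^bsub>pf_ob F X\<^esub> p"
          using s by (simp add: cell_hom_el)
        fix t assume "cell_hom C t c d \<and> q = pf_cell F t i \<cdot>\<^bsub>pf_ob F X\<^esub> p"
        then have "cell_hom (el C F) (DCell ?u ?v t) ?u ?v" using uv by (simp add: cell_hom_el)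
        then show "t = dval s" using un by force
      qed
    qed
  next
    assume U: ?U
    show "\<forall>z u v. mor_hom (el C F) u (I, i) z \<and> mor_hom (el C F) v (I, i) z \<longrightarrow>
      (\<exists>!s. cell_hom (el C F) s u v)"
    proof (intro allI impI, elim conjE)
      fix z u v assume u: "mor_hom (el C F) u (I, i) z" and v: "mor_hom (el C F) v (I, i) z"
      then have "\<exists>!s. cell_hom C s (emor u) (emor v) \<and>
          eiso v = pf_cell F s i \<cdot>\<^bsub>pf_ob F (fst z)\<^esub> eiso u"
        using U unfolding mor by blast
      moreover have uv: "u \<in> el_mors C F" "v \<in> el_mors C F" "esrc u = (I, i)" "etrg u = z"
        "esrc v = (I, i)" "etrg v = z" using u v by (auto simp: mor_hom_iff el_simps)
      ultimately show "\<exists>!s. cell_hom (el C F) s u v"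
        by (simp add: cell_hom_el) (metis dcell.sel(3))
    qed
  qed
  ultimately show ?thesis using two_category.bi_initial_iff[OF two_category_el] ob by simp
qed

lemma cell_hom_mor: "cell_hom (mor C F) w u v \<longleftrightarrow>
    w = DCell u v (DCell (mel0 u) (mel0 v) (dval (fst (dval w))),
      DCell (mel1 u) (mel1 v) (dval (snd (dval w)))) \<and>
    u \<in> mo_mors C F \<and> v \<in> mo_mors C F \<and> msrc u = msrc v \<and> mtrg u = mtrg v \<and>
    cell_hom (el C F) (fst (dval w)) (mel0 u) (mel0 v) \<and>
    cell_hom (el C F) (snd (dval w)) (mel1 u) (mel1 v) \<and>
    mcell v \<bullet> dval (fst (dval w)) = dval (snd (dval w)) \<bullet> mcell u"
proof -
  have "Cell (mor C F) = mo_cells C F" "VDom (mor C F) = dsrc" "VCod (mor C F) = dtrg"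
    by (simp_all add: mor_def)
  then show ?thesis
    unfolding cell_hom_iff[of "mor C F"]
    by (cases w; cases "dval w"; cases "fst (dval w)"; cases "snd (dval w)")
      (auto simp: mo_cells_def cell_hom_el)
qed

lemma bi_initial_mor_iff:
  assumes I: "I \<in> Ob C" and i: "i \<in> Obj (pf_ob F I)"
  shows "bi_initial (mor C F) (I, Idn (pf_ob F I) i) \<longleftrightarrow>
    (\<forall>X \<in> Ob C. \<forall>\<alpha> \<in> Arr (pf_ob F X). \<exists>c p d q s. mor_from I i X \<alpha> c p d q s) \<and>
    (\<forall>X \<alpha> c p d q s c' p' d' q' s'.
      mor_from I i X \<alpha> c p d q s \<and> mor_from I i X \<alpha> c' p' d' q' s' \<longrightarrow>
      (\<exists>!z. cell_hom C (fst z) c c' \<and> p' = pf_cell F (fst z) i \<cdot>\<^bsub>pf_ob F X\<^esub> p \<and>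
        cell_hom C (snd z) d d' \<and> q' = pf_cell F (snd z) i \<cdot>\<^bsub>pf_ob F X\<^esub> q \<and>
        s' \<bullet> fst z = snd z \<bullet> s))" (is "_ \<longleftrightarrow> ?E \<and> ?U")
proof -
  let ?i = "(I, Idn (pf_ob F I) i)" and ?M = "mor C F"
  note [simp] = pf_simps simps
  define mk where "mk = (\<lambda>z (c :: 'm) p (d :: 'm) q (s :: 't). MoMor ?i z
      (ElMor (I, i) (fst z, Dom (pf_ob F (fst z)) (snd z)) c p)
      (ElMor (I, i) (fst z, Cod (pf_ob F (fst z)) (snd z)) d q) s)"
  have mk: "mor_hom ?M (mk z c p d q s) ?i z \<longleftrightarrow> mor_from I i (fst z) (snd z) c p d q s"
    (is "?l \<longleftrightarrow> ?r") for z c p d q s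
  proof
    assume ?l
    then have "mk z c p d q s \<in> mo_mors C F" by (simp add: mor_hom_iff mor_def)
    then have *: "snd z \<in> Arr (pf_ob F (fst z))" "el_from I i (fst z) (Dom (pf_ob F (fst z)) (snd z)) c p"
      "el_from I i (fst z) (Cod (pf_ob F (fst z)) (snd z)) d q" "cell_hom C s c d"
      "q \<cdot>\<^bsub>pf_ob F (fst z)\<^esub> snd z = pf_cell F s i \<cdot>\<^bsub>pf_ob F (fst z)\<^esub>
        (far (pf_mor F c) (Idn (pf_ob F I) i) \<cdot>\<^bsub>pf_ob F (fst z)\<^esub> p)"
      using I i by (auto simp: mo_mors_iff mk_def Let_def el_mors_iff el_from_def mor_hom_iff)
    then show ?r using I i el_fromD[OF *(2)] by (simp add: mor_from_def)
  next
    assume r: ?r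
    then have *: "el_from I i (fst z) (Dom (pf_ob F (fst z)) (snd z)) c p"
      "el_from I i (fst z) (Cod (pf_ob F (fst z)) (snd z)) d q" by (auto simp: mor_from_def)
    have "mk z c p d q s \<in> mo_mors C F"
      using r I i el_fromD[OF *(1)] el_fromD[OF *(2)]
      by (auto simp: mo_mors_iff mk_def Let_def el_mors_iff mor_from_def) (auto simp: el_from_def)
    then show ?l by (simp add: mor_hom_iff mor_def mk_def)
  qed
  have mkI: "u = mk z (emor (mel0 u)) (eiso (mel0 u)) (emor (mel1 u)) (eiso (mel1 u)) (mcell u)"
    if "mor_hom ?M u ?i z" for u z
  proof -
    have "u \<in> mo_mors C F" "msrc u = ?i" "mtrg u = z" using that by (auto simp: mor_hom_iff mor_def)
    then show ?thesis using I i
      by (auto simp: mk_def mo_mors_iff Let_def intro!: mo_mor.expand el_mor.expand)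
  qed
  have cell: "cell_hom ?M w (mk z c p d q s) (mk z c' p' d' q' s') \<longleftrightarrow>
      w = DCell (mk z c p d q s) (mk z c' p' d' q' s')
        (DCell (mel0 (mk z c p d q s)) (mel0 (mk z c' p' d' q' s')) (dval (fst (dval w))),
         DCell (mel1 (mk z c p d q s)) (mel1 (mk z c' p' d' q' s')) (dval (snd (dval w)))) \<and>
      cell_hom C (dval (fst (dval w))) c c' \<and> p' = pf_cell F (dval (fst (dval w))) i \<cdot>\<^bsub>pf_ob F (fst z)\<^esub> p \<and>
      cell_hom C (dval (snd (dval w))) d d' \<and> q' = pf_cell F (dval (snd (dval w))) i \<cdot>\<^bsub>pf_ob F (fst z)\<^esub> q \<and>
      s' \<bullet> dval (fst (dval w)) = dval (snd (dval w)) \<bullet> s"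
    if m: "mor_from I i (fst z) (snd z) c p d q s" "mor_from I i (fst z) (snd z) c' p' d' q' s'"
    for w z c p d q s c' p' d' q' s'
  proof -
    have mo: "mk z c p d q s \<in> mo_mors C F" "mk z c' p' d' q' s' \<in> mo_mors C F"
      using mk[of z c p d q s] mk[of z c' p' d' q' s'] m by (auto simp: mor_hom_iff mor_def)
    then have "mel0 (mk z c p d q s) \<in> el_mors C F" "mel0 (mk z c' p' d' q' s') \<in> el_mors C F"
      "mel1 (mk z c p d q s) \<in> el_mors C F" "mel1 (mk z c' p' d' q' s') \<in> el_mors C F"
      by (auto simp: mo_mors_iff Let_def)
    with mo show ?thesis
      by (cases w; cases "dval w"; cases "fst (dval w)"; cases "snd (dval w)")
        (simp add: cell_hom_mor cell_hom_el mk_def, blast)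
  qed
  have ob: "?i \<in> Ob ?M" using assms by (simp add: mor_def)
  have "(\<forall>z \<in> Ob ?M. \<exists>u. mor_hom ?M u ?i z) \<longleftrightarrow> ?E"
  proof
    assume *: "\<forall>z \<in> Ob ?M. \<exists>u. mor_hom ?M u ?i z"
    show ?E
    proof (intro ballI)
      fix X \<alpha> assume "X \<in> Ob C" "\<alpha> \<in> Arr (pf_ob F X)"
      then have "\<exists>u. mor_hom ?M u ?i (X, \<alpha>)" using * by (simp add: mor_def)
      then obtain u where u: "mor_hom ?M u ?i (X, \<alpha>)" ..
      then obtain c p d q s where "u = mk (X, \<alpha>) c p d q s" using mkI by blast
      with u mk[of "(X, \<alpha>)"] have "mor_from I i X \<alpha> c p d q s" by simp
      then show "\<exists>c p d q s. mor_from I i X \<alpha> c p d q s" by (intro exI)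
    qed
  next
    assume ?E
    show "\<forall>z \<in> Ob ?M. \<exists>u. mor_hom ?M u ?i z"
    proof
      fix z assume "z \<in> Ob ?M"
      then have "fst z \<in> Ob C" "snd z \<in> Arr (pf_ob F (fst z))" by (auto simp: mor_def)
      then have "\<exists>c p d q s. mor_from I i (fst z) (snd z) c p d q s" using \<open>?E\<close> by simp
      then show "\<exists>u. mor_hom ?M u ?i z" using mk by blast
    qed
  qed
  moreover have "(\<forall>z u v. mor_hom ?M u ?i z \<and> mor_hom ?M v ?i z \<longrightarrow> (\<exists>!s. cell_hom ?M s u v)) \<longleftrightarrow> ?U"
  proof
    assume *: "\<forall>z u v. mor_hom ?M u ?i z \<and> mor_hom ?M v ?i z \<longrightarrow> (\<exists>!s. cell_hom ?M s u v)"
    show ?U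
    proof (intro allI impI, elim conjE)
      fix X \<alpha> c p d q s c' p' d' q' s'
      assume m: "mor_from I i X \<alpha> c p d q s" "mor_from I i X \<alpha> c' p' d' q' s'"
      let ?u = "mk (X, \<alpha>) c p d q s" and ?v = "mk (X, \<alpha>) c' p' d' q' s'"
      note cell = cell[of "(X, \<alpha>)", unfolded fst_conv snd_conv, OF m]
      have "mor_hom ?M ?u ?i (X, \<alpha>)" "mor_hom ?M ?v ?i (X, \<alpha>)" using m mk[of "(X, \<alpha>)"] by auto
      then have "\<exists>!w. cell_hom ?M w ?u ?v" using * by blast
      then obtain w where w: "cell_hom ?M w ?u ?v"
        and un: "\<And>t. cell_hom ?M t ?u ?v \<Longrightarrow> t = w" by blast
      show "\<exists>!z. cell_hom C (fst z) c c' \<and> p' = pf_cell F (fst z) i \<cdot>\<^bsub>pf_ob F X\<^esub> p \<and>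
          cell_hom C (snd z) d d' \<and> q' = pf_cell F (snd z) i \<cdot>\<^bsub>pf_ob F X\<^esub> q \<and> s' \<bullet> fst z = snd z \<bullet> s"
      proof (rule ex1I[of _ "(dval (fst (dval w)), dval (snd (dval w)))"], goal_cases)
        case 1 show ?case using w unfolding cell by simp
      next
        case (2 z)
        have "cell_hom ?M (DCell ?u ?v (DCell (mel0 ?u) (mel0 ?v) (fst z), DCell (mel1 ?u) (mel1 ?v) (snd z))) ?u ?v"
          using 2 unfolding cell by simp
        from un[OF this, symmetric] show ?case by simp
      qed
    qed
  next
    assume U: ?U
    show "\<forall>z u v. mor_hom ?M u ?i z \<and> mor_hom ?M v ?i z \<longrightarrow> (\<exists>!s. cell_hom ?M s u v)"
    proof (intro allI impI, elim conjE)
      fix z u v assume u: "mor_hom ?M u ?i z" and v: "mor_hom ?M v ?i z"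
      obtain c p d q s where u': "u = mk z c p d q s" using mkI[OF u] by blast
      obtain c' p' d' q' s' where v': "v = mk z c' p' d' q' s'" using mkI[OF v] by blast
      note m = u[unfolded u' mk] v[unfolded v' mk]
      let ?P = "\<lambda>y. cell_hom C (fst y) c c' \<and> p' = pf_cell F (fst y) i \<cdot>\<^bsub>pf_ob F (fst z)\<^esub> p \<and>
          cell_hom C (snd y) d d' \<and> q' = pf_cell F (snd y) i \<cdot>\<^bsub>pf_ob F (fst z)\<^esub> q \<and> s' \<bullet> fst y = snd y \<bullet> s"
      from U m have "\<exists>!y. ?P y" by blast
      then obtain y where y: "?P y" and un: "\<And>t. ?P t \<Longrightarrow> t = y" by blast
      show "\<exists>!s. cell_hom ?M s u v"
      proof (rule ex1I[of _ "DCell u v (DCell (mel0 u) (mel0 v) (fst y), DCell (mel1 u) (mel1 v) (snd y))"])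
        show "cell_hom ?M (DCell u v (DCell (mel0 u) (mel0 v) (fst y), DCell (mel1 u) (mel1 v) (snd y))) u v"
          using y unfolding u' v' cell[OF m] by simp
        fix w assume w: "cell_hom ?M w u v"
        then have "(dval (fst (dval w)), dval (snd (dval w))) = y"
          unfolding u' v' cell[OF m] by (intro un) simp
        then show "w = DCell u v (DCell (mel0 u) (mel0 v) (fst y), DCell (mel1 u) (mel1 v) (snd y))"
          using w unfolding u' v' cell[OF m] by (metis fst_conv snd_conv)
      qed
    qed
  qed
  ultimately show ?thesis using two_category.bi_initial_iff[OF two_category_mor] ob by simp
qed

text \<open>
  Morphisms to \<open>(X, x)\<close> in \<open>el(F)\<close> yield morphisms to \<open>(X, id)\<close> in \<open>mor(F)\<close> by
  using them for both halves. A 2-morphism in \<open>el(F)\<close> can likewise be used twice, and uniqueness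
  of pairs of 2-morphisms in \<open>mor(F)\<close> gives its uniqueness.
\<close>

lemma bi_initial_mor_imp_el:
  assumes I: "I \<in> Ob C" and i: "i \<in> Obj (pf_ob F I)"
    and mor: "bi_initial (mor C F) (I, Idn (pf_ob F I) i)"
  shows "bi_initial (el C F) (I, i)"
  unfolding bi_initial_el_iff[OF I i]
proof (intro conjI ballI allI impI)
  note mor' = mor[unfolded bi_initial_mor_iff[OF I i]]
  note [simp] = pf_simps simps
  fix X x
  {
    assume "X \<in> Ob C" "x \<in> Obj (pf_ob F X)"
    then have "\<exists>c p d q s. mor_from I i X (Idn (pf_ob F X) x) c p d q s" using mor' by simp
    then show "\<exists>c p. el_from I i X x c p"
      using \<open>X \<in> Ob C\<close> \<open>x \<in> Obj (pf_ob F X)\<close> by (auto simp: mor_from_def)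
  }
  fix c p d q assume "el_from I i X x c p \<and> el_from I i X x d q"
  then have cp: "el_from I i X x c p" and dq: "el_from I i X x d q" by auto
  note c = el_fromD[OF cp] and d = el_fromD[OF dq]
  have "mor_from I i X (Idn (pf_ob F X) x) c p c p (Id2 C c)"
    "mor_from I i X (Idn (pf_ob F X) x) d q d q (Id2 C d)"
    using cp dq c d i by (auto simp: mor_from_def cell_hom_iff)
  then have "\<exists>!z. cell_hom C (fst z) c d \<and> q = pf_cell F (fst z) i \<cdot>\<^bsub>pf_ob F X\<^esub> p \<and>
        cell_hom C (snd z) c d \<and> q = pf_cell F (snd z) i \<cdot>\<^bsub>pf_ob F X\<^esub> p \<and>
        Id2 C d \<bullet> fst z = snd z \<bullet> Id2 C c" using mor' by blast
  then obtain z where z: "cell_hom C (fst z) c d" "q = pf_cell F (fst z) i \<cdot>\<^bsub>pf_ob F X\<^esub> p"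
    and un: "\<And>y. cell_hom C (fst y) c d \<and> q = pf_cell F (fst y) i \<cdot>\<^bsub>pf_ob F X\<^esub> p \<and>
        cell_hom C (snd y) c d \<and> q = pf_cell F (snd y) i \<cdot>\<^bsub>pf_ob F X\<^esub> p \<and>
        Id2 C d \<bullet> fst y = snd y \<bullet> Id2 C c \<Longrightarrow> y = z" by blast
  show "\<exists>!s. cell_hom C s c d \<and> q = pf_cell F s i \<cdot>\<^bsub>pf_ob F X\<^esub> p"
  proof (rule ex1I[of _ "fst z"])
    fix s assume s: "cell_hom C s c d \<and> q = pf_cell F s i \<cdot>\<^bsub>pf_ob F X\<^esub> p"
    \<comment> \<open>The diagonal pair satisfies the same condition as \<open>z\<close>.\<close>
    then have "(s, s) = z" by (intro un) (auto simp: cell_hom_iff)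
    then show "s = fst z" by auto
  qed (use z in blast)
qed

text \<open>
  Given \<open>b : (F c) i \<rightarrow> (F d) i\<close>, a morphism from \<open>(I, id)\<close> to \<open>(X, b)\<close> presents \<open>b\<close> as
  \<open>q\<^sup>-\<^sup>1 \<circ> F s \<circ> p\<close> with \<open>s : c' \<Rightarrow> d'\<close> and isomorphisms \<open>p\<close>, \<open>q\<close>. Bi-initiality in \<open>el(F)\<close>
  lifts \<open>p\<close> and \<open>q\<^sup>-\<^sup>1\<close> to 2-morphisms \<open>\<sigma>\<close> and \<open>\<tau>\<close>, so \<open>b\<close> is the image of \<open>\<tau> \<bullet> s \<bullet> \<sigma>\<close>.
  Two preimages of \<open>b\<close> give two morphisms from \<open>(I, id)\<close> to \<open>(X, b)\<close> with the same
  end morphisms; the 2-morphism between them has identity components, so they agree.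
\<close>

lemma universal_element_if_bi_initial:
  assumes I: "I \<in> Ob C" and i: "i \<in> Obj (pf_ob F I)"
    and el: "bi_initial (el C F) (I, i)" and mor: "bi_initial (mor C F) (I, Idn (pf_ob F I) i)"
  shows "universal_element C F I i"
  unfolding universal_element_def cat_equivalence_def
proof (intro conjI ballI allI impI I i)
  note el' = el[unfolded bi_initial_el_iff[OF I i]] and mor' = mor[unfolded bi_initial_mor_iff[OF I i]]
  note [simp] = pf_simps simps hom_cat_simps Arr_hom_cat evaluation_def
  fix X assume X: "X \<in> Ob C"
  then show "is_functor (hom_cat C X I) (pf_ob F X) (evaluation F i)"
    using i by (rule is_functor_evaluation)
  show "\<exists>c \<in> Obj (hom_cat C X I). \<exists>e. iso_hom (pf_ob F X) e (fob (evaluation F i) c) x"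
    if "x \<in> Obj (pf_ob F X)" for x
    using el' X that iso_hom_inv[of "pf_ob F X"] by (fastforce simp: el_from_def mor_hom_iff)
  fix c d b
  assume "c \<in> Obj (hom_cat C X I)" "d \<in> Obj (hom_cat C X I)"
  then have c: "c \<in> Mor C" "Src C c = X" "Trg C c = I" and d: "d \<in> Mor C" "Src C d = X" "Trg C d = I"
    by auto
  assume "in_hom (pf_ob F X) b (fob (evaluation F i) c) (fob (evaluation F i) d)"
  then have b: "b \<in> Arr (pf_ob F X)" "Dom (pf_ob F X) b = fob (pf_mor F c) i"
    "Cod (pf_ob F X) b = fob (pf_mor F d) i" by (auto simp: in_hom_iff)
  let ?c1 = "Idn (pf_ob F X) (fob (pf_mor F c) i)" and ?d1 = "Idn (pf_ob F X) (fob (pf_mor F d) i)"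
  have c1: "el_from I i X (fob (pf_mor F c) i) c ?c1" and d1: "el_from I i X (fob (pf_mor F d) i) d ?d1"
    using X c d i by (auto simp: el_from_def mor_hom_iff intro!: category.iso_Idn)
  have "\<exists>s. cell_hom C s c d \<and> pf_cell F s i = b"
  proof -
    have "\<exists>c p d q s. mor_from I i X b c p d q s" using mor' X b(1) by simp
    then obtain c' p d' q s where m: "mor_from I i X b c' p d' q s" by auto
    then have p: "el_from I i X (fob (pf_mor F c) i) c' p" and q: "el_from I i X (fob (pf_mor F d) i) d' q"
      and s: "cell_hom C s c' d'" and eq: "q \<cdot>\<^bsub>pf_ob F X\<^esub> b = pf_cell F s i \<cdot>\<^bsub>pf_ob F X\<^esub> p"
      using b by (auto simp: mor_from_def)
    obtain \<sigma> where \<sigma>: "cell_hom C \<sigma> c c'" "p = pf_cell F \<sigma> i \<cdot>\<^bsub>pf_ob F X\<^esub> ?c1"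
      using el' c1 p by blast
    obtain \<tau> where \<tau>: "cell_hom C \<tau> d' d" "?d1 = pf_cell F \<tau> i \<cdot>\<^bsub>pf_ob F X\<^esub> q"
      using el' d1 q by blast
    note t = s \<sigma>(1) \<tau>(1) and c' = el_fromD[OF p] and d' = el_fromD[OF q]
    have "pf_cell F (\<tau> \<bullet> (s \<bullet> \<sigma>)) i = pf_cell F \<tau> i \<cdot>\<^bsub>pf_ob F X\<^esub> (pf_cell F s i \<cdot>\<^bsub>pf_ob F X\<^esub> p)"
      using t c d c' d' i by (simp add: cell_hom_iff \<sigma>(2))
    also have "\<dots> = (pf_cell F \<tau> i \<cdot>\<^bsub>pf_ob F X\<^esub> q) \<cdot>\<^bsub>pf_ob F X\<^esub> b"
      using t c d c' d' i b by (simp add: cell_hom_iff flip: eq)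
    also have "\<dots> = b" using b X by (simp flip: \<tau>(2))
    finally show ?thesis using t by (intro exI[of _ "\<tau> \<bullet> (s \<bullet> \<sigma>)"]) (simp add: cell_hom_iff)
  qed
  moreover have "s = s'" if s: "cell_hom C s c d" "pf_cell F s i = b"
    and s': "cell_hom C s' c d" "pf_cell F s' i = b" for s s'
  proof -
    have "mor_from I i X b c ?c1 d ?d1 s" "mor_from I i X b c ?c1 d ?d1 s'"
      using c1 d1 b s s' X by (auto simp: mor_from_def)
    then obtain z where z: "cell_hom C (fst z) c c" "?c1 = pf_cell F (fst z) i \<cdot>\<^bsub>pf_ob F X\<^esub> ?c1"
        "cell_hom C (snd z) d d" "?d1 = pf_cell F (snd z) i \<cdot>\<^bsub>pf_ob F X\<^esub> ?d1"
        "s' \<bullet> fst z = snd z \<bullet> s" using mor' by blast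
    have "cell_hom C (Id2 C c) c c" "?c1 = pf_cell F (Id2 C c) i \<cdot>\<^bsub>pf_ob F X\<^esub> ?c1"
      "cell_hom C (Id2 C d) d d" "?d1 = pf_cell F (Id2 C d) i \<cdot>\<^bsub>pf_ob F X\<^esub> ?d1"
      using c d i X by (auto simp: cell_hom_iff)
    \<comment> \<open>Endomorphisms of a morphism out of the bi-initial object of \<open>el(F)\<close> are trivial.\<close>
    then have "fst z = Id2 C c" "snd z = Id2 C d" using z el' c1 d1 by blast+
    then show ?thesis using z(5) s s' by (simp add: cell_hom_iff)
  qed
  moreover have "in_hom (hom_cat C X I) s c d \<longleftrightarrow> cell_hom C s c d" for s
    using c by (auto simp: in_hom_iff[of "hom_cat C X I"] cell_hom_iff)
  ultimately show "\<exists>!s. in_hom (hom_cat C X I) s c d \<and> far (evaluation F i) s = b"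
    by (auto simp del: cell_simps)
qed

text \<open>
  Everything follows from one lifting property: an arrow \<open>\<alpha> : x \<rightarrow> y\<close> together with isomorphisms
  \<open>p : x \<cong> (F c) i\<close> and \<open>q : y \<cong> (F d) i\<close> determines a unique \<open>s : c \<Rightarrow> d\<close> whose image is
  \<open>q \<circ> \<alpha> \<circ> p\<^sup>-\<^sup>1\<close>. With \<open>\<alpha>\<close> an identity this is bi-initiality in \<open>el(F)\<close>; with general
  \<open>\<alpha>\<close> it gives existence in \<open>mor(F)\<close>, and its uniqueness part gives the commutation with the
  2-morphisms \<open>s\<close> and \<open>s'\<close> that a pair of 2-morphisms must satisfy.
\<close>

lemma bi_initial_if_universal_element:
  assumes u: "universal_element C F I i"
  shows "bi_initial (el C F) (I, i)" and "bi_initial (mor C F) (I, Idn (pf_ob F I) i)"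
proof -
  note [simp] = pf_simps simps
  have I: "I \<in> Ob C" and i: "i \<in> Obj (pf_ob F I)" using u by (auto simp: universal_element_def)
  have eso: "\<exists>c p. el_from I i X x c p" if "X \<in> Ob C" "x \<in> Obj (pf_ob F X)" for X x
  proof -
    have "\<exists>c \<in> Obj (hom_cat C X I). \<exists>e. iso_hom (pf_ob F X) e (fob (pf_mor F c) i) x"
      using u that by (simp add: universal_element_def cat_equivalence_def evaluation_def)
    then obtain c e where "c \<in> Obj (hom_cat C X I)" "iso_hom (pf_ob F X) e (fob (pf_mor F c) i) x"
      by blast
    then have "el_from I i X x c (inv_arr (pf_ob F X) e)"
      using iso_hom_inv[of "pf_ob F X"] by (auto simp: el_from_def hom_cat_simps mor_hom_iff)
    then show ?thesis by blast
  qed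
  have ff: "\<exists>!s. cell_hom C s c d \<and> pf_cell F s i = b"
    if "mor_hom C c X I" "mor_hom C d X I" "in_hom (pf_ob F X) b (fob (pf_mor F c) i) (fob (pf_mor F d) i)"
    for c d X b
  proof -
    have c: "c \<in> Mor C" "Src C c = X" "Trg C c = I" "X \<in> Ob C" "d \<in> Mor C" "Src C d = X" "Trg C d = I"
      using that mor_simps(1)[of c] by (auto simp: mor_hom_iff)
    then have "\<exists>!s. in_hom (hom_cat C X I) s c d \<and> pf_cell F s i = b"
      using u that(3) unfolding universal_element_def cat_equivalence_def evaluation_def
      by (simp add: hom_cat_simps)
    moreover have "in_hom (hom_cat C X I) s c d \<longleftrightarrow> cell_hom C s c d" for s
      using c by (auto simp: in_hom_iff[of "hom_cat C X I"] cell_hom_iff hom_cat_simps Arr_hom_cat)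
    ultimately show ?thesis by simp
  qed
  have lift: "\<exists>!s. cell_hom C s c d \<and> q \<cdot>\<^bsub>pf_ob F X\<^esub> \<alpha> = pf_cell F s i \<cdot>\<^bsub>pf_ob F X\<^esub> p"
    if \<alpha>: "\<alpha> \<in> Arr (pf_ob F X)" and cp: "el_from I i X (Dom (pf_ob F X) \<alpha>) c p"
      and dq: "el_from I i X (Cod (pf_ob F X) \<alpha>) d q" for X \<alpha> c p d q
  proof -
    let ?K = "pf_ob F X"
    note c = el_fromD[OF cp] and d = el_fromD[OF dq]
    have pi: "iso_hom ?K p (Dom ?K \<alpha>) (fob (pf_mor F c) i)" using cp by (simp add: el_from_def)
    note pI = iso_homD[OF this]
    have "\<exists>!s. cell_hom C s c d \<and> pf_cell F s i = (q \<cdot>\<^bsub>?K\<^esub> \<alpha>) \<cdot>\<^bsub>?K\<^esub> inv_arr ?K p"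
      using cp dq pI c d \<alpha> by (intro ff) (auto simp: el_from_def in_hom_iff)
    moreover have "pf_cell F s i = (q \<cdot>\<^bsub>?K\<^esub> \<alpha>) \<cdot>\<^bsub>?K\<^esub> inv_arr ?K p \<longleftrightarrow> q \<cdot>\<^bsub>?K\<^esub> \<alpha> = pf_cell F s i \<cdot>\<^bsub>?K\<^esub> p"
      if "cell_hom C s c d" for s
    proof
      assume "pf_cell F s i = (q \<cdot>\<^bsub>?K\<^esub> \<alpha>) \<cdot>\<^bsub>?K\<^esub> inv_arr ?K p"
      then show "q \<cdot>\<^bsub>?K\<^esub> \<alpha> = pf_cell F s i \<cdot>\<^bsub>?K\<^esub> p" using pI c d \<alpha> by simp
    next
      assume *: "q \<cdot>\<^bsub>?K\<^esub> \<alpha> = pf_cell F s i \<cdot>\<^bsub>?K\<^esub> p"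
      show "pf_cell F s i = (q \<cdot>\<^bsub>?K\<^esub> \<alpha>) \<cdot>\<^bsub>?K\<^esub> inv_arr ?K p"
        unfolding * using pI c d \<alpha> that i by (simp add: cell_hom_iff)
    qed
    ultimately show ?thesis by blast
  qed
  show "bi_initial (el C F) (I, i)"
    unfolding bi_initial_el_iff[OF I i]
  proof (intro conjI ballI allI impI eso)
    fix X x c p d q assume *: "el_from I i X x c p \<and> el_from I i X x d q"
    then show "\<exists>!s. cell_hom C s c d \<and> q = pf_cell F s i \<cdot>\<^bsub>pf_ob F X\<^esub> p"
      using lift[of "Idn (pf_ob F X) x" X c p d q] el_fromD[of I i X x d q] by simp
  qed
  then have el: "\<exists>!s. cell_hom C s c d \<and> q = pf_cell F s i \<cdot>\<^bsub>pf_ob F X\<^esub> p"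
    if "el_from I i X x c p" "el_from I i X x d q" for X x c p d q
    using that bi_initial_el_iff[OF I i] by blast
  show "bi_initial (mor C F) (I, Idn (pf_ob F I) i)"
    unfolding bi_initial_mor_iff[OF I i]
  proof (intro conjI ballI allI impI)
    fix X \<alpha>
    {
      assume X: "X \<in> Ob C" and \<alpha>: "\<alpha> \<in> Arr (pf_ob F X)"
      then obtain c p d q where cp: "el_from I i X (Dom (pf_ob F X) \<alpha>) c p"
        and dq: "el_from I i X (Cod (pf_ob F X) \<alpha>) d q"
        using eso by (meson cat_simps(1,2) F.ob_category[unfolded op2_simps])
      with lift[OF \<alpha> this] \<alpha> show "\<exists>c p d q s. mor_from I i X \<alpha> c p d q s"
        unfolding mor_from_def by blast
    }
    fix c p d q s c' p' d' q' s'
    assume m: "mor_from I i X \<alpha> c p d q s \<and> mor_from I i X \<alpha> c' p' d' q' s'"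
    let ?K = "pf_ob F X"
    from m have \<alpha>: "\<alpha> \<in> Arr ?K"
      and p: "el_from I i X (Dom ?K \<alpha>) c p" and p': "el_from I i X (Dom ?K \<alpha>) c' p'"
      and q: "el_from I i X (Cod ?K \<alpha>) d q" and q': "el_from I i X (Cod ?K \<alpha>) d' q'"
      and s: "cell_hom C s c d" "q \<cdot>\<^bsub>?K\<^esub> \<alpha> = pf_cell F s i \<cdot>\<^bsub>?K\<^esub> p"
      and s': "cell_hom C s' c' d'" "q' \<cdot>\<^bsub>?K\<^esub> \<alpha> = pf_cell F s' i \<cdot>\<^bsub>?K\<^esub> p'"
      by (auto simp: mor_from_def)
    note D = el_fromD[OF p] el_fromD[OF p'] el_fromD[OF q] el_fromD[OF q']
    have comm: "s' \<bullet> \<sigma> = \<tau> \<bullet> s" if \<sigma>: "cell_hom C \<sigma> c c'" "p' = pf_cell F \<sigma> i \<cdot>\<^bsub>?K\<^esub> p"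
      and \<tau>: "cell_hom C \<tau> d d'" "q' = pf_cell F \<tau> i \<cdot>\<^bsub>?K\<^esub> q" for \<sigma> \<tau>
    proof -
      have "cell_hom C (s' \<bullet> \<sigma>) c d'" "cell_hom C (\<tau> \<bullet> s) c d'"
        using \<sigma>(1) \<tau>(1) s(1) s'(1) by (auto simp: cell_hom_iff)
      moreover have "q' \<cdot>\<^bsub>?K\<^esub> \<alpha> = pf_cell F (s' \<bullet> \<sigma>) i \<cdot>\<^bsub>?K\<^esub> p"
        using \<sigma>(1) s'(1) D i unfolding s'(2) \<sigma>(2) by (simp add: cell_hom_iff)
      moreover have "q' \<cdot>\<^bsub>?K\<^esub> \<alpha> = pf_cell F (\<tau> \<bullet> s) i \<cdot>\<^bsub>?K\<^esub> p"
        using \<tau>(1) s(1) D i \<alpha> unfolding \<tau>(2) by (simp add: cell_hom_iff s(2))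
      ultimately show ?thesis using lift[OF \<alpha> p q'] by blast
    qed
    obtain \<sigma> where \<sigma>: "cell_hom C \<sigma> c c'" "p' = pf_cell F \<sigma> i \<cdot>\<^bsub>?K\<^esub> p"
      and \<sigma>1: "\<And>t. cell_hom C t c c' \<and> p' = pf_cell F t i \<cdot>\<^bsub>?K\<^esub> p \<Longrightarrow> t = \<sigma>" using el[OF p p'] by blast
    obtain \<tau> where \<tau>: "cell_hom C \<tau> d d'" "q' = pf_cell F \<tau> i \<cdot>\<^bsub>?K\<^esub> q"
      and \<tau>1: "\<And>t. cell_hom C t d d' \<and> q' = pf_cell F t i \<cdot>\<^bsub>?K\<^esub> q \<Longrightarrow> t = \<tau>" using el[OF q q'] by blast
    show "\<exists>!z. cell_hom C (fst z) c c' \<and> p' = pf_cell F (fst z) i \<cdot>\<^bsub>?K\<^esub> p \<and>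
        cell_hom C (snd z) d d' \<and> q' = pf_cell F (snd z) i \<cdot>\<^bsub>?K\<^esub> q \<and> s' \<bullet> fst z = snd z \<bullet> s"
      using \<sigma> \<tau> comm[OF \<sigma> \<tau>] by (intro ex1I[of _ "(\<sigma>, \<tau>)"]) (auto intro: \<sigma>1 \<tau>1 prod_eqI)
  qed
qed

end

section \<open>Pseudo-natural transformations\<close>

lemma is_functor_comp:
  assumes "is_functor K L S" "is_functor L M T"
  shows "is_functor K M (comp_fctr T S)"
proof -
  interpret S: is_functor K L S by fact
  interpret T: is_functor L M T by fact
  show ?thesis
    by (intro is_functor.intro is_functor_axioms.intro S.src.category_axioms T.trg.category_axioms)
      (auto simp: comp_fctr_def in_hom_iff S.fob_Obj T.fob_Obj S.far_simps T.far_simps S.far_Idn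
        T.far_Idn S.far_Cmp_arr T.far_Cmp_arr)
qed

lemma is_functor_id: "category K \<Longrightarrow> is_functor K K id_fctr"
  by (intro is_functor.intro is_functor_axioms.intro) (auto simp: id_fctr_def)

lemma nat_isoI:
  assumes "is_functor K L S" "is_functor K L T"
    and "\<And>x. x \<in> Obj K \<Longrightarrow> iso_hom L (t x) (fob S x) (fob T x)"
    and "\<And>f. f \<in> Arr K \<Longrightarrow> t (Cod K f) \<cdot>\<^bsub>L\<^esub> far S f = far T f \<cdot>\<^bsub>L\<^esub> t (Dom K f)"
  shows "nat_iso K L S T t"
  using assms
  by (intro nat_iso.intro nat_trans.intro nat_trans_axioms.intro nat_iso_axioms.intro)
    (auto simp: in_hom_iff iso_hom_def)

text \<open>
  The rules below move a component \<open>pn_mor \<theta> a\<close> to the left, past the image under \<open>\<theta>\<close> of an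
  arrow, a 2-morphism or a compositor.
\<close>

locale transformation = P: cat_valued A P + Q: cat_valued A Q + pseudonat A P Q \<theta>
  for A :: "('o, 'm, 't) twocat" (structure) and P :: "('o, 'm, 't, 'x, 'y) pfun"
    and Q :: "('o, 'm, 't, 'u, 'v) pfun" and \<theta>
begin

lemma ob_typing:
  "X \<in> Ob A \<Longrightarrow> x \<in> Obj (pf_ob P X) \<Longrightarrow> fob (pn_ob \<theta> X) x \<in> Obj (pf_ob Q X)"
  "X \<in> Ob A \<Longrightarrow> f \<in> Arr (pf_ob P X) \<Longrightarrow> far (pn_ob \<theta> X) f \<in> Arr (pf_ob Q X)"
  "X \<in> Ob A \<Longrightarrow> f \<in> Arr (pf_ob P X)
    \<Longrightarrow> Dom (pf_ob Q X) (far (pn_ob \<theta> X) f) = fob (pn_ob \<theta> X) (Dom (pf_ob P X) f)"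
  "X \<in> Ob A \<Longrightarrow> f \<in> Arr (pf_ob P X)
    \<Longrightarrow> Cod (pf_ob Q X) (far (pn_ob \<theta> X) f) = fob (pn_ob \<theta> X) (Cod (pf_ob P X) f)"
  "X \<in> Ob A \<Longrightarrow> x \<in> Obj (pf_ob P X)
    \<Longrightarrow> far (pn_ob \<theta> X) (Idn (pf_ob P X) x) = Idn (pf_ob Q X) (fob (pn_ob \<theta> X) x)"
  "X \<in> Ob A \<Longrightarrow> f \<in> Arr (pf_ob P X) \<Longrightarrow> g \<in> Arr (pf_ob P X)
    \<Longrightarrow> Cod (pf_ob P X) f = Dom (pf_ob P X) g
    \<Longrightarrow> far (pn_ob \<theta> X) (g \<cdot>\<^bsub>pf_ob P X\<^esub> f) = far (pn_ob \<theta> X) g \<cdot>\<^bsub>pf_ob Q X\<^esub> far (pn_ob \<theta> X) f"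
  using is_functor.fob_Obj[OF ob_functor] is_functor.far_simps[OF ob_functor]
    is_functor.far_Idn[OF ob_functor] is_functor.far_Cmp_arr[OF ob_functor]
  by auto

lemma nat_iso_mor: "a \<in> Mor A \<Longrightarrow>
    nat_iso (pf_ob P (Src A a)) (pf_ob Q (Trg A a)) (comp_fctr (pf_mor Q a) (pn_ob \<theta> (Src A a)))
            (comp_fctr (pn_ob \<theta> (Trg A a)) (pf_mor P a)) (pn_mor \<theta> a)"
  using mor_iso by (auto simp: mor_hom_iff)

lemma iso_mor:
  assumes "a \<in> Mor A" "Src A a = X" "Trg A a = Y" "x \<in> Obj (pf_ob P X)"
  shows "iso_hom (pf_ob Q Y) (pn_mor \<theta> a x) (fob (pf_mor Q a) (fob (pn_ob \<theta> X) x))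
    (fob (pn_ob \<theta> Y) (fob (pf_mor P a) x))"
  using nat_iso.component_iso[OF nat_iso_mor[OF assms(1)]] assms by (simp add: comp_fctr_def)

lemma mor_typing:
  assumes "a \<in> Mor A" "Trg A a = Y" "x \<in> Obj (pf_ob P (Src A a))"
  shows "pn_mor \<theta> a x \<in> Arr (pf_ob Q Y)"
    "Dom (pf_ob Q Y) (pn_mor \<theta> a x) = fob (pf_mor Q a) (fob (pn_ob \<theta> (Src A a)) x)"
    "Cod (pf_ob Q Y) (pn_mor \<theta> a x) = fob (pn_ob \<theta> Y) (fob (pf_mor P a) x)"
  using iso_homD(1-3)[OF iso_mor[OF assms(1) refl assms(2,3)]] by auto

lemmas pn_simps = P.pf_simps Q.pf_simps ob_typing mor_typing cat_simps

lemma mor_square: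
  assumes "a \<in> Mor A" "Src A a = X" "Trg A a = Y" "f \<in> Arr (pf_ob P X)" "Dom (pf_ob P X) f = x"
  shows "far (pn_ob \<theta> Y) (far (pf_mor P a) f) \<cdot>\<^bsub>pf_ob Q Y\<^esub> pn_mor \<theta> a x =
    pn_mor \<theta> a (Cod (pf_ob P X) f) \<cdot>\<^bsub>pf_ob Q Y\<^esub> far (pf_mor Q a) (far (pn_ob \<theta> X) f)"
  using nat_trans.natural[OF nat_iso.axioms(1)[OF nat_iso_mor[OF assms(1)]], of f x] assms
  by (simp add: in_hom_iff comp_fctr_def)

lemma cell_square:
  assumes "s \<in> Cell A" "VDom A s = a" "Src A a = X" "Trg A a = Y" "x \<in> Obj (pf_ob P X)"
  shows "far (pn_ob \<theta> Y) (pf_cell P s x) \<cdot>\<^bsub>pf_ob Q Y\<^esub> pn_mor \<theta> a x =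
    pn_mor \<theta> (VCod A s) x \<cdot>\<^bsub>pf_ob Q Y\<^esub> pf_cell Q s (fob (pn_ob \<theta> X) x)"
  using mor_natural[of s a "VCod A s" X Y x] assms P.cell_simps(1)[of s]
  by (auto simp: cell_hom_iff mor_hom_iff)

lemma unit:
  assumes "X \<in> Ob A" "x \<in> Obj (pf_ob P X)"
  shows "pn_mor \<theta> (Id1 A X) x = Idn (pf_ob Q X) (fob (pn_ob \<theta> X) x)"
  using mor_Id1 assms .

lemma comp:
  assumes "a \<in> Mor A" "b \<in> Mor A" "Src A a = X" "Trg A a = Src A b" "Trg A b = Z" "x \<in> Obj (pf_ob P X)"
  shows "far (pn_ob \<theta> Z) (pf_cpr P a b x) \<cdot>\<^bsub>pf_ob Q Z\<^esub>
      (pn_mor \<theta> b (fob (pf_mor P a) x) \<cdot>\<^bsub>pf_ob Q Z\<^esub> far (pf_mor Q b) (pn_mor \<theta> a x)) =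
    pn_mor \<theta> (b \<odot> a) x \<cdot>\<^bsub>pf_ob Q Z\<^esub> pf_cpr Q a b (fob (pn_ob \<theta> X) x)"
  using mor_Comp[of a X "Src A b" b Z x] assms by (auto simp: mor_hom_iff)

end

lemma transformationI:
  assumes P: "cat_valued A P" and Q: "cat_valued A Q"
    and ob: "\<And>X. X \<in> Ob A \<Longrightarrow> is_functor (pf_ob P X) (pf_ob Q X) (pn_ob \<theta> X)"
    and iso: "\<And>a X Y x. \<lbrakk>a \<in> Mor A; Src A a = X; Trg A a = Y; X \<in> Ob A; Y \<in> Ob A;
      x \<in> Obj (pf_ob P X)\<rbrakk> \<Longrightarrow> iso_hom (pf_ob Q Y) (pn_mor \<theta> a x)
        (fob (pf_mor Q a) (fob (pn_ob \<theta> X) x)) (fob (pn_ob \<theta> Y) (fob (pf_mor P a) x))"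
    and square: "\<And>a X Y f x y. \<lbrakk>a \<in> Mor A; Src A a = X; Trg A a = Y; X \<in> Ob A; Y \<in> Ob A;
      f \<in> Arr (pf_ob P X); Dom (pf_ob P X) f = x; Cod (pf_ob P X) f = y;
      x \<in> Obj (pf_ob P X); y \<in> Obj (pf_ob P X)\<rbrakk>
      \<Longrightarrow> pn_mor \<theta> a y \<cdot>\<^bsub>pf_ob Q Y\<^esub> far (pf_mor Q a) (far (pn_ob \<theta> X) f) =
          far (pn_ob \<theta> Y) (far (pf_mor P a) f) \<cdot>\<^bsub>pf_ob Q Y\<^esub> pn_mor \<theta> a x"
    and cell: "\<And>s a b X Y x. \<lbrakk>s \<in> Cell A; VDom A s = a; VCod A s = b; a \<in> Mor A; b \<in> Mor A;
      Src A a = X; Trg A a = Y; Src A b = X; Trg A b = Y; X \<in> Ob A; Y \<in> Ob A; x \<in> Obj (pf_ob P X)\<rbrakk>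
      \<Longrightarrow> pn_mor \<theta> b x \<cdot>\<^bsub>pf_ob Q Y\<^esub> pf_cell Q s (fob (pn_ob \<theta> X) x) =
          far (pn_ob \<theta> Y) (pf_cell P s x) \<cdot>\<^bsub>pf_ob Q Y\<^esub> pn_mor \<theta> a x"
    and unit: "\<And>X x. X \<in> Ob A \<Longrightarrow> x \<in> Obj (pf_ob P X)
      \<Longrightarrow> pn_mor \<theta> (Id1 A X) x = Idn (pf_ob Q X) (fob (pn_ob \<theta> X) x)"
    and comp: "\<And>a b X Y Z x. \<lbrakk>a \<in> Mor A; b \<in> Mor A; Src A a = X; Trg A a = Y; Src A b = Y; Trg A b = Z;
      X \<in> Ob A; Y \<in> Ob A; Z \<in> Ob A; x \<in> Obj (pf_ob P X)\<rbrakk>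
      \<Longrightarrow> pn_mor \<theta> (b \<odot>\<^bsub>A\<^esub> a) x \<cdot>\<^bsub>pf_ob Q Z\<^esub> pf_cpr Q a b (fob (pn_ob \<theta> X) x) =
          far (pn_ob \<theta> Z) (pf_cpr P a b x) \<cdot>\<^bsub>pf_ob Q Z\<^esub>
            (pn_mor \<theta> b (fob (pf_mor P a) x) \<cdot>\<^bsub>pf_ob Q Z\<^esub> far (pf_mor Q b) (pn_mor \<theta> a x))"
  shows "transformation A P Q \<theta>"
proof -
  interpret P: cat_valued A P by fact
  interpret Q: cat_valued A Q by fact
  have nat: "nat_iso (pf_ob P X) (pf_ob Q Y) (comp_fctr (pf_mor Q a) (pn_ob \<theta> X))
            (comp_fctr (pn_ob \<theta> Y) (pf_mor P a)) (pn_mor \<theta> a)"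
    if a: "a \<in> Mor A" "Src A a = X" "Trg A a = Y" for a X Y
  proof (rule nat_isoI)
    have XY: "X \<in> Ob A" "Y \<in> Ob A" using a P.mor_simps(1,2) by auto
    show "is_functor (pf_ob P X) (pf_ob Q Y) (comp_fctr (pf_mor Q a) (pn_ob \<theta> X))"
      by (rule is_functor_comp[OF ob[OF XY(1)] Q.is_functor_mor[OF a]])
    show "is_functor (pf_ob P X) (pf_ob Q Y) (comp_fctr (pn_ob \<theta> Y) (pf_mor P a))"
      by (rule is_functor_comp[OF P.is_functor_mor[OF a] ob[OF XY(2)]])
    show "iso_hom (pf_ob Q Y) (pn_mor \<theta> a x) (fob (comp_fctr (pf_mor Q a) (pn_ob \<theta> X)) x)
      (fob (comp_fctr (pn_ob \<theta> Y) (pf_mor P a)) x)" if "x \<in> Obj (pf_ob P X)" for x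
      using iso[OF a XY that] by (simp add: comp_fctr_def)
    show "pn_mor \<theta> a (Cod (pf_ob P X) f) \<cdot>\<^bsub>pf_ob Q Y\<^esub> far (comp_fctr (pf_mor Q a) (pn_ob \<theta> X)) f =
      far (comp_fctr (pn_ob \<theta> Y) (pf_mor P a)) f \<cdot>\<^bsub>pf_ob Q Y\<^esub> pn_mor \<theta> a (Dom (pf_ob P X) f)"
      if f: "f \<in> Arr (pf_ob P X)" for f
      using square[OF a XY f refl refl] category.Dom_Obj[OF _ f] category.Cod_Obj[OF _ f]
        P.ob_category[OF XY(1)] by (simp add: comp_fctr_def)
  qed
  show ?thesis
    by (intro transformation.intro pseudonat.intro pseudonat_axioms.intro assms(1,2) nat ob unit
        P.normal_pseudofunctor_axioms Q.normal_pseudofunctor_axioms)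
      (auto simp: mor_hom_iff cell_hom_iff P.simps intro!: cell comp)
qed

lemma transformation_id:
  assumes "cat_valued A P"
  shows "transformation A P P (id_pnat A P)"
proof -
  interpret P: cat_valued A P by fact
  show ?thesis
    by (rule transformationI[OF assms assms])
      (auto simp: id_pnat_def is_functor_id[unfolded id_fctr_def] P.pf_simps cat_simps P.simps
        category.iso_Idn id_fctr_def)
qed

lemma transformation_comp:
  assumes "transformation A P Q \<theta>" "transformation A Q R \<kappa>"
  shows "transformation A P R (comp_pnat A R \<kappa> \<theta>)"
proof -
  interpret \<theta>: transformation A P Q \<theta> by fact
  interpret \<kappa>: transformation A Q R \<kappa> by fact
  let ?T = "\<lambda>X. far (pn_ob \<theta> X)" and ?K = "\<lambda>X. far (pn_ob \<kappa> X)"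
  note [simp] = comp_pnat_def comp_fctr_def \<theta>.pn_simps \<kappa>.pn_simps \<theta>.P.simps
  show ?thesis
  proof (rule transformationI[OF \<theta>.P.cat_valued_axioms \<kappa>.Q.cat_valued_axioms])
    show "is_functor (pf_ob P X) (pf_ob R X) (pn_ob (comp_pnat A R \<kappa> \<theta>) X)" if "X \<in> Ob A" for X
      using is_functor_comp[OF \<theta>.ob_functor \<kappa>.ob_functor, OF that that] by simp
    show "iso_hom (pf_ob R Y) (pn_mor (comp_pnat A R \<kappa> \<theta>) a x)
        (fob (pf_mor R a) (fob (pn_ob (comp_pnat A R \<kappa> \<theta>) X) x))
        (fob (pn_ob (comp_pnat A R \<kappa> \<theta>) Y) (fob (pf_mor P a) x))"
      if a: "a \<in> Mor A" "Src A a = X" "Trg A a = Y" "X \<in> Ob A" "Y \<in> Ob A" and x: "x \<in> Obj (pf_ob P X)"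
      for a X Y x
      using category.iso_Cmp[OF \<kappa>.Q.ob_category[OF a(5)] \<kappa>.iso_mor[OF a(1-3) \<theta>.ob_typing(1)[OF a(4) x]]
          is_functor.far_iso[OF \<kappa>.ob_functor[OF a(5)] \<theta>.iso_mor[OF a(1-3) x]]] a by simp
  next
    fix a X Y f x y
    assume [simp]: "a \<in> Mor A" "Src A a = X" "Trg A a = Y" "X \<in> Ob A" "Y \<in> Ob A" "f \<in> Arr (pf_ob P X)"
      "Dom (pf_ob P X) f = x" "Cod (pf_ob P X) f = y" "x \<in> Obj (pf_ob P X)" "y \<in> Obj (pf_ob P X)"
    let ?R = "pf_ob R Y"
    have "?K Y (?T Y (far (pf_mor P a) f) \<cdot>\<^bsub>pf_ob Q Y\<^esub> pn_mor \<theta> a x) =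
        ?K Y (pn_mor \<theta> a y \<cdot>\<^bsub>pf_ob Q Y\<^esub> far (pf_mor Q a) (?T X f))"
      by (subst \<theta>.mor_square[of a X Y f x]) simp_all
    then have 1: "?K Y (?T Y (far (pf_mor P a) f)) \<cdot>\<^bsub>?R\<^esub> ?K Y (pn_mor \<theta> a x) =
        ?K Y (pn_mor \<theta> a y) \<cdot>\<^bsub>?R\<^esub> ?K Y (far (pf_mor Q a) (?T X f))" by simp
    show "pn_mor (comp_pnat A R \<kappa> \<theta>) a y \<cdot>\<^bsub>?R\<^esub> far (pf_mor R a) (far (pn_ob (comp_pnat A R \<kappa> \<theta>) X) f) =
      far (pn_ob (comp_pnat A R \<kappa> \<theta>) Y) (far (pf_mor P a) f) \<cdot>\<^bsub>?R\<^esub> pn_mor (comp_pnat A R \<kappa> \<theta>) a x"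
      by (simp add: Cmp_square[OF _ 1] \<kappa>.mor_square)
  next
    fix s a b X Y x
    assume [simp]: "s \<in> Cell A" "VDom A s = a" "VCod A s = b" "a \<in> Mor A" "b \<in> Mor A" "Src A a = X"
      "Trg A a = Y" "Src A b = X" "Trg A b = Y" "X \<in> Ob A" "Y \<in> Ob A" "x \<in> Obj (pf_ob P X)"
    let ?R = "pf_ob R Y"
    have "?K Y (?T Y (pf_cell P s x) \<cdot>\<^bsub>pf_ob Q Y\<^esub> pn_mor \<theta> a x) =
        ?K Y (pn_mor \<theta> b x \<cdot>\<^bsub>pf_ob Q Y\<^esub> pf_cell Q s (fob (pn_ob \<theta> X) x))"
      by (subst \<theta>.cell_square[of s a X Y x]) simp_all
    then have 1: "?K Y (?T Y (pf_cell P s x)) \<cdot>\<^bsub>?R\<^esub> ?K Y (pn_mor \<theta> a x) =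
        ?K Y (pn_mor \<theta> b x) \<cdot>\<^bsub>?R\<^esub> ?K Y (pf_cell Q s (fob (pn_ob \<theta> X) x))" by simp
    show "pn_mor (comp_pnat A R \<kappa> \<theta>) b x \<cdot>\<^bsub>?R\<^esub> pf_cell R s (fob (pn_ob (comp_pnat A R \<kappa> \<theta>) X) x) =
      far (pn_ob (comp_pnat A R \<kappa> \<theta>) Y) (pf_cell P s x) \<cdot>\<^bsub>?R\<^esub> pn_mor (comp_pnat A R \<kappa> \<theta>) a x"
      by (simp add: Cmp_square[OF _ 1] \<kappa>.cell_square)
  next
    fix X x assume "X \<in> Ob A" "x \<in> Obj (pf_ob P X)"
    then show "pn_mor (comp_pnat A R \<kappa> \<theta>) (Id1 A X) x = Idn (pf_ob R X) (fob (pn_ob (comp_pnat A R \<kappa> \<theta>) X) x)"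
      by (simp add: \<theta>.unit \<kappa>.unit)
  next
    fix a b X Y Z x
    assume [simp]: "a \<in> Mor A" "b \<in> Mor A" "Src A a = X" "Trg A a = Y" "Src A b = Y" "Trg A b = Z"
      "X \<in> Ob A" "Y \<in> Ob A" "Z \<in> Ob A" "x \<in> Obj (pf_ob P X)"
    let ?R = "pf_ob R Z" and ?Q = "pf_ob Q Z" and ?x = "fob (pn_ob \<theta> X) x" and ?Px = "fob (pf_mor P a) x"
    have "?K Z (pn_mor \<theta> (b \<odot>\<^bsub>A\<^esub> a) x) \<cdot>\<^bsub>?R\<^esub> (pn_mor \<kappa> (b \<odot>\<^bsub>A\<^esub> a) ?x \<cdot>\<^bsub>?R\<^esub> pf_cpr R a b (fob (pn_ob \<kappa> X) ?x)) =
      ?K Z (pn_mor \<theta> (b \<odot>\<^bsub>A\<^esub> a) x) \<cdot>\<^bsub>?R\<^esub> (?K Z (pf_cpr Q a b ?x) \<cdot>\<^bsub>?R\<^esub>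
        (pn_mor \<kappa> b (fob (pf_mor Q a) ?x) \<cdot>\<^bsub>?R\<^esub> far (pf_mor R b) (pn_mor \<kappa> a ?x)))"
      by (subst \<kappa>.comp[of a b X Z]) simp_all
    also have "\<dots> = ?K Z (pn_mor \<theta> (b \<odot>\<^bsub>A\<^esub> a) x \<cdot>\<^bsub>?Q\<^esub> pf_cpr Q a b ?x) \<cdot>\<^bsub>?R\<^esub>
        (pn_mor \<kappa> b (fob (pf_mor Q a) ?x) \<cdot>\<^bsub>?R\<^esub> far (pf_mor R b) (pn_mor \<kappa> a ?x))"
      by simp
    also have "\<dots> = ?K Z (?T Z (pf_cpr P a b x) \<cdot>\<^bsub>?Q\<^esub> (pn_mor \<theta> b ?Px \<cdot>\<^bsub>?Q\<^esub> far (pf_mor Q b) (pn_mor \<theta> a x))) \<cdot>\<^bsub>?R\<^esub>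
        (pn_mor \<kappa> b (fob (pf_mor Q a) ?x) \<cdot>\<^bsub>?R\<^esub> far (pf_mor R b) (pn_mor \<kappa> a ?x))"
      by (subst \<theta>.comp[of a b X Z]) simp_all
    also have "\<dots> = ?K Z (?T Z (pf_cpr P a b x)) \<cdot>\<^bsub>?R\<^esub> (?K Z (pn_mor \<theta> b ?Px) \<cdot>\<^bsub>?R\<^esub>
        (?K Z (far (pf_mor Q b) (pn_mor \<theta> a x)) \<cdot>\<^bsub>?R\<^esub>
        (pn_mor \<kappa> b (fob (pf_mor Q a) ?x) \<cdot>\<^bsub>?R\<^esub> far (pf_mor R b) (pn_mor \<kappa> a ?x))))"
      by simp
    also have "\<dots> = ?K Z (?T Z (pf_cpr P a b x)) \<cdot>\<^bsub>?R\<^esub> (?K Z (pn_mor \<theta> b ?Px) \<cdot>\<^bsub>?R\<^esub>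
        (pn_mor \<kappa> b (fob (pn_ob \<theta> Y) ?Px) \<cdot>\<^bsub>?R\<^esub>
        (far (pf_mor R b) (?K Y (pn_mor \<theta> a x)) \<cdot>\<^bsub>?R\<^esub> far (pf_mor R b) (pn_mor \<kappa> a ?x))))"
      by (subst Cmp_square[OF _ \<kappa>.mor_square[of b Y Z "pn_mor \<theta> a x"]]) simp_all
    finally show "pn_mor (comp_pnat A R \<kappa> \<theta>) (b \<odot>\<^bsub>A\<^esub> a) x \<cdot>\<^bsub>?R\<^esub>
          pf_cpr R a b (fob (pn_ob (comp_pnat A R \<kappa> \<theta>) X) x) =
        far (pn_ob (comp_pnat A R \<kappa> \<theta>) Z) (pf_cpr P a b x) \<cdot>\<^bsub>?R\<^esub>
          (pn_mor (comp_pnat A R \<kappa> \<theta>) b ?Px \<cdot>\<^bsub>?R\<^esub>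
            far (pf_mor R b) (pn_mor (comp_pnat A R \<kappa> \<theta>) a x))"
      by simp
  qed
qed

text \<open>
  The componentwise inverses form a modification because their naturality and compatibility
  equations follow from those of \<open>m\<close> by cancelling \<open>m\<close> on both sides.
\<close>

lemma invertible_modificationI:
  assumes \<theta>: "transformation A P Q \<theta>" and \<kappa>: "transformation A P Q \<kappa>"
    and iso: "\<And>X x. X \<in> Ob A \<Longrightarrow> x \<in> Obj (pf_ob P X)
      \<Longrightarrow> iso_hom (pf_ob Q X) (m X x) (fob (pn_ob \<theta> X) x) (fob (pn_ob \<kappa> X) x)"
    and nat: "\<And>X f x y. \<lbrakk>X \<in> Ob A; f \<in> Arr (pf_ob P X); Dom (pf_ob P X) f = x; Cod (pf_ob P X) f = y;
      x \<in> Obj (pf_ob P X); y \<in> Obj (pf_ob P X)\<rbrakk>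
      \<Longrightarrow> m X y \<cdot>\<^bsub>pf_ob Q X\<^esub> far (pn_ob \<theta> X) f = far (pn_ob \<kappa> X) f \<cdot>\<^bsub>pf_ob Q X\<^esub> m X x"
    and mor: "\<And>a X Y x. \<lbrakk>a \<in> Mor A; Src A a = X; Trg A a = Y; X \<in> Ob A; Y \<in> Ob A; x \<in> Obj (pf_ob P X)\<rbrakk>
      \<Longrightarrow> pn_mor \<kappa> a x \<cdot>\<^bsub>pf_ob Q Y\<^esub> far (pf_mor Q a) (m X x) =
          m Y (fob (pf_mor P a) x) \<cdot>\<^bsub>pf_ob Q Y\<^esub> pn_mor \<theta> a x"
  shows "invertible_modification A P Q \<theta> \<kappa> m"
proof -
  interpret \<theta>: transformation A P Q \<theta> by fact
  interpret \<kappa>: transformation A P Q \<kappa> by fact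
  note [simp] = \<theta>.pn_simps \<kappa>.pn_simps \<theta>.P.simps
  let ?n = "\<lambda>X x. inv_arr (pf_ob Q X) (m X x)"
  have m: "m X x \<in> Arr (pf_ob Q X)" "Dom (pf_ob Q X) (m X x) = fob (pn_ob \<theta> X) x"
    "Cod (pf_ob Q X) (m X x) = fob (pn_ob \<kappa> X) x"
    "?n X x \<in> Arr (pf_ob Q X)" "Dom (pf_ob Q X) (?n X x) = fob (pn_ob \<kappa> X) x"
    "Cod (pf_ob Q X) (?n X x) = fob (pn_ob \<theta> X) x"
    "?n X x \<cdot>\<^bsub>pf_ob Q X\<^esub> m X x = Idn (pf_ob Q X) (fob (pn_ob \<theta> X) x)"
    "m X x \<cdot>\<^bsub>pf_ob Q X\<^esub> ?n X x = Idn (pf_ob Q X) (fob (pn_ob \<kappa> X) x)"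
    if "X \<in> Ob A" "x \<in> Obj (pf_ob P X)" for X x
    using iso_homD[OF iso[OF that]] by auto
  have inv_nat: "?n X y \<cdot>\<^bsub>pf_ob Q X\<^esub> far (pn_ob \<kappa> X) f = far (pn_ob \<theta> X) f \<cdot>\<^bsub>pf_ob Q X\<^esub> ?n X x"
    if [simp]: "X \<in> Ob A" "f \<in> Arr (pf_ob P X)" "Dom (pf_ob P X) f = x" "Cod (pf_ob P X) f = y"
      "x \<in> Obj (pf_ob P X)" "y \<in> Obj (pf_ob P X)" for X f x y
  proof -
    have "?n X y \<cdot>\<^bsub>pf_ob Q X\<^esub> far (pn_ob \<kappa> X) f =
        ?n X y \<cdot>\<^bsub>pf_ob Q X\<^esub> ((far (pn_ob \<kappa> X) f \<cdot>\<^bsub>pf_ob Q X\<^esub> m X x) \<cdot>\<^bsub>pf_ob Q X\<^esub> ?n X x)"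
      by (simp add: m)
    also have "\<dots> = ?n X y \<cdot>\<^bsub>pf_ob Q X\<^esub> (m X y \<cdot>\<^bsub>pf_ob Q X\<^esub> (far (pn_ob \<theta> X) f \<cdot>\<^bsub>pf_ob Q X\<^esub> ?n X x))"
      by (subst nat[symmetric, of X f x y]) (simp_all add: m)
    also have "\<dots> = far (pn_ob \<theta> X) f \<cdot>\<^bsub>pf_ob Q X\<^esub> ?n X x"
      by (rule category.inv_Cmp_cancel(1)[OF _ iso]) (simp_all add: m)
    finally show ?thesis .
  qed
  have inv_mor: "pn_mor \<theta> a x \<cdot>\<^bsub>pf_ob Q Y\<^esub> far (pf_mor Q a) (?n X x) =
      ?n Y (fob (pf_mor P a) x) \<cdot>\<^bsub>pf_ob Q Y\<^esub> pn_mor \<kappa> a x"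
    if [simp]: "a \<in> Mor A" "Src A a = X" "Trg A a = Y" "X \<in> Ob A" "Y \<in> Ob A" "x \<in> Obj (pf_ob P X)" for a X Y x
  proof -
    let ?y = "fob (pf_mor P a) x"
    have "far (pf_mor Q a) (m X x \<cdot>\<^bsub>pf_ob Q X\<^esub> ?n X x) = Idn (pf_ob Q Y) (fob (pf_mor Q a) (fob (pn_ob \<kappa> X) x))"
      by (simp add: m)
    then have 1: "far (pf_mor Q a) (m X x) \<cdot>\<^bsub>pf_ob Q Y\<^esub> far (pf_mor Q a) (?n X x) =
        Idn (pf_ob Q Y) (fob (pf_mor Q a) (fob (pn_ob \<kappa> X) x))" by (simp add: m del: m(8))
    have "pn_mor \<theta> a x \<cdot>\<^bsub>pf_ob Q Y\<^esub> far (pf_mor Q a) (?n X x) =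
        ?n Y ?y \<cdot>\<^bsub>pf_ob Q Y\<^esub> (m Y ?y \<cdot>\<^bsub>pf_ob Q Y\<^esub> (pn_mor \<theta> a x \<cdot>\<^bsub>pf_ob Q Y\<^esub> far (pf_mor Q a) (?n X x)))"
      by (rule category.inv_Cmp_cancel(1)[OF _ iso, symmetric]) (simp_all add: m)
    also have "\<dots> = ?n Y ?y \<cdot>\<^bsub>pf_ob Q Y\<^esub> (pn_mor \<kappa> a x \<cdot>\<^bsub>pf_ob Q Y\<^esub>
        (far (pf_mor Q a) (m X x) \<cdot>\<^bsub>pf_ob Q Y\<^esub> far (pf_mor Q a) (?n X x)))"
      by (subst Cmp_square[OF _ mor[symmetric, of a X Y x]]) (simp_all add: m)
    also have "\<dots> = ?n Y ?y \<cdot>\<^bsub>pf_ob Q Y\<^esub> pn_mor \<kappa> a x" by (simp add: 1 m)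
    finally show ?thesis .
  qed
  have "modification A P Q \<theta> \<kappa> m"
    by (intro modification.intro modification_axioms.intro nat_trans.intro nat_trans_axioms.intro
        \<theta>.ob_functor \<kappa>.ob_functor \<theta>.pseudonat_axioms \<kappa>.pseudonat_axioms)
      (auto simp: in_hom_iff underlying_cat_def m intro!: nat mor)
  moreover have "modification A P Q \<kappa> \<theta> ?n"
    by (intro modification.intro modification_axioms.intro nat_trans.intro nat_trans_axioms.intro
        \<theta>.ob_functor \<kappa>.ob_functor \<theta>.pseudonat_axioms \<kappa>.pseudonat_axioms)
      (auto simp: in_hom_iff underlying_cat_def m intro!: inv_nat inv_mor)
  ultimately show ?thesis
    unfolding invertible_modification_def
    by (auto simp: modif_eq_def comp_modif_def id_modif_def m intro!: exI[of _ ?n])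
qed

section \<open>Pointwise equivalences are adjoint equivalences\<close>

lemma Cmp_triangle:
  assumes "category K" and "g \<cdot>\<^bsub>K\<^esub> f = h"
    and "f \<in> Arr K" "g \<in> Arr K" "e \<in> Arr K" "Cod K f = Dom K g" "Cod K e = Dom K f"
  shows "g \<cdot>\<^bsub>K\<^esub> (f \<cdot>\<^bsub>K\<^esub> e) = h \<cdot>\<^bsub>K\<^esub> e"
  using assms by (metis category.Cmp_assoc_arr)

text \<open>
  An inverse \<open>\<sigma>\<close> of \<open>\<rho>\<close> is built by choosing for every \<open>y\<close> an isomorphism
  \<open>counit y : \<rho> (rep y) \<cong> y\<close> and lifting arrows along \<open>\<rho>\<close>. The definitions of the lifted
  arrows contain inverses of \<open>counit\<close> and of the components of \<open>\<rho>\<close>, but each arrow is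
  characterised by an equation without inverses: \<open>counit \<circ> \<rho> (\<sigma> f) = f \<circ> counit\<close>,
  \<open>counit \<circ> \<rho> (\<sigma>\<^sub>a) \<circ> \<rho>\<^sub>a = (Q a) counit\<close> and \<open>counit \<circ> \<rho> unit = id\<close>. The
  calculations rest on these equations.
\<close>

locale pointwise_equivalence = transformation A P Q \<rho>
  for A :: "('o, 'm, 't) twocat" (structure) and P :: "('o, 'm, 't, 'x, 'y) pfun"
    and Q :: "('o, 'm, 't, 'u, 'v) pfun" and \<rho> +
  assumes equivalence: "X \<in> Ob A \<Longrightarrow> cat_equivalence (pf_ob P X) (pf_ob Q X) (pn_ob \<rho> X)"
begin

definition rep :: "'o \<Rightarrow> 'u \<Rightarrow> 'x" where
  "rep X y = (SOME x. x \<in> Obj (pf_ob P X) \<and> (\<exists>e. iso_hom (pf_ob Q X) e (fob (pn_ob \<rho> X) x) y))"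

definition counit :: "'o \<Rightarrow> 'u \<Rightarrow> 'v" where
  "counit X y = (SOME e. iso_hom (pf_ob Q X) e (fob (pn_ob \<rho> X) (rep X y)) y)"

definition lift :: "'o \<Rightarrow> 'x \<Rightarrow> 'x \<Rightarrow> 'v \<Rightarrow> 'y" where
  "lift X x y b = (THE f. in_hom (pf_ob P X) f x y \<and> far (pn_ob \<rho> X) f = b)"

lemma rep_counit:
  assumes "X \<in> Ob A" "y \<in> Obj (pf_ob Q X)"
  shows rep_Obj: "rep X y \<in> Obj (pf_ob P X)"
    and iso_counit: "iso_hom (pf_ob Q X) (counit X y) (fob (pn_ob \<rho> X) (rep X y)) y"
proof -
  have "\<exists>x. x \<in> Obj (pf_ob P X) \<and> (\<exists>e. iso_hom (pf_ob Q X) e (fob (pn_ob \<rho> X) x) y)"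
    using equivalence[OF assms(1)] assms(2) unfolding cat_equivalence_def by blast
  from someI_ex[OF this, folded rep_def]
  show "rep X y \<in> Obj (pf_ob P X)"
    "iso_hom (pf_ob Q X) (counit X y) (fob (pn_ob \<rho> X) (rep X y)) y"
    unfolding counit_def by (auto intro: someI_ex)
qed

lemma counit_typing:
  assumes "X \<in> Ob A" "y \<in> Obj (pf_ob Q X)"
  shows "counit X y \<in> Arr (pf_ob Q X)" "Dom (pf_ob Q X) (counit X y) = fob (pn_ob \<rho> X) (rep X y)"
    "Cod (pf_ob Q X) (counit X y) = y"
    "inv_arr (pf_ob Q X) (counit X y) \<in> Arr (pf_ob Q X)"
    "Dom (pf_ob Q X) (inv_arr (pf_ob Q X) (counit X y)) = y"
    "Cod (pf_ob Q X) (inv_arr (pf_ob Q X) (counit X y)) = fob (pn_ob \<rho> X) (rep X y)"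
    "counit X y \<cdot>\<^bsub>pf_ob Q X\<^esub> inv_arr (pf_ob Q X) (counit X y) = Idn (pf_ob Q X) y"
  using iso_homD[OF iso_counit[OF assms]] by auto

lemma full_faithful:
  assumes "X \<in> Ob A" "x \<in> Obj (pf_ob P X)" "y \<in> Obj (pf_ob P X)"
    "b \<in> Arr (pf_ob Q X)" "Dom (pf_ob Q X) b = fob (pn_ob \<rho> X) x" "Cod (pf_ob Q X) b = fob (pn_ob \<rho> X) y"
  shows "\<exists>!f. in_hom (pf_ob P X) f x y \<and> far (pn_ob \<rho> X) f = b"
  using equivalence[OF assms(1)] assms by (auto simp: cat_equivalence_def in_hom_iff[of "pf_ob Q X"])

lemma lift:
  assumes "X \<in> Ob A" "x \<in> Obj (pf_ob P X)" "y \<in> Obj (pf_ob P X)"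
    "b \<in> Arr (pf_ob Q X)" "Dom (pf_ob Q X) b = fob (pn_ob \<rho> X) x" "Cod (pf_ob Q X) b = fob (pn_ob \<rho> X) y"
  shows "lift X x y b \<in> Arr (pf_ob P X)" "Dom (pf_ob P X) (lift X x y b) = x"
    "Cod (pf_ob P X) (lift X x y b) = y" "far (pn_ob \<rho> X) (lift X x y b) = b"
  using theI'[OF full_faithful[OF assms], folded lift_def] by (auto simp: in_hom_iff)

lemma faithful:
  assumes X: "X \<in> Ob A" and f: "f \<in> Arr (pf_ob P X)" and g: "g \<in> Arr (pf_ob P X)"
    and "Dom (pf_ob P X) f = Dom (pf_ob P X) g" "Cod (pf_ob P X) f = Cod (pf_ob P X) g"
    and "far (pn_ob \<rho> X) f = far (pn_ob \<rho> X) g"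
  shows "f = g"
proof -
  have "\<exists>!h. in_hom (pf_ob P X) h (Dom (pf_ob P X) g) (Cod (pf_ob P X) g) \<and>
      far (pn_ob \<rho> X) h = far (pn_ob \<rho> X) g"
    using X g by (intro full_faithful) (auto simp: pn_simps)
  then show ?thesis using assms by (auto simp: in_hom_iff)
qed

text \<open>
  The form in which faithfulness is used. Composing with the counit brings the characterising
  equations of the lifted arrows into play, and the isomorphism \<open>w\<close>, built from components of
  \<open>\<rho>\<close> or an identity, lets naturality of \<open>\<rho>\<close> apply.
\<close>

lemma faithful_counit:
  assumes X: "X \<in> Ob A" and y: "y \<in> Obj (pf_ob Q X)"
    and f: "f \<in> Arr (pf_ob P X)" and g: "g \<in> Arr (pf_ob P X)"
    and "Dom (pf_ob P X) f = z" "Dom (pf_ob P X) g = z"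
    and "Cod (pf_ob P X) f = rep X y" "Cod (pf_ob P X) g = rep X y"
    and w: "iso_hom (pf_ob Q X) w v (fob (pn_ob \<rho> X) z)"
    and eq: "counit X y \<cdot>\<^bsub>pf_ob Q X\<^esub> (far (pn_ob \<rho> X) f \<cdot>\<^bsub>pf_ob Q X\<^esub> w) =
      counit X y \<cdot>\<^bsub>pf_ob Q X\<^esub> (far (pn_ob \<rho> X) g \<cdot>\<^bsub>pf_ob Q X\<^esub> w)"
  shows "f = g"
proof -
  note [simp] = pn_simps iso_homD[OF w]
  have K: "category (pf_ob Q X)" using X by simp
  have "far (pn_ob \<rho> X) f \<cdot>\<^bsub>pf_ob Q X\<^esub> w = far (pn_ob \<rho> X) g \<cdot>\<^bsub>pf_ob Q X\<^esub> w"
    by (rule category.iso_cancel_left[OF K iso_counit[OF X y] eq]) (use assms in simp_all)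
  then have "far (pn_ob \<rho> X) f = far (pn_ob \<rho> X) g"
    by (rule category.iso_cancel_right[OF K w]) (use assms in simp_all)
  then show ?thesis using assms by (intro faithful[OF X]) simp_all
qed

lemma lift_iso:
  assumes X: "X \<in> Ob A" and x: "x \<in> Obj (pf_ob P X)" and y: "y \<in> Obj (pf_ob P X)"
    and b: "iso_hom (pf_ob Q X) b (fob (pn_ob \<rho> X) x) (fob (pn_ob \<rho> X) y)"
  shows "iso_hom (pf_ob P X) (lift X x y b) x y"
proof (rule iso_homI[where g = "lift X y x (inv_arr (pf_ob Q X) b)"])
  note [simp] = pn_simps X x y iso_homD[OF b] lift
  show "lift X y x (inv_arr (pf_ob Q X) b) \<cdot>\<^bsub>pf_ob P X\<^esub> lift X x y b = Idn (pf_ob P X) x"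
    "lift X x y b \<cdot>\<^bsub>pf_ob P X\<^esub> lift X y x (inv_arr (pf_ob Q X) b) = Idn (pf_ob P X) y"
    by (rule faithful[OF X]; simp)+
qed (simp_all add: X x y lift iso_homD[OF b])

definition inverse :: "('o, 'm, 'u, 'v, 'x, 'y) pnat" where
  "inverse = \<lparr>
     pn_ob = (\<lambda>X. \<lparr>fob = rep X, far = (\<lambda>f. let K = pf_ob Q X; x = Dom K f; y = Cod K f in
       lift X (rep X x) (rep X y) (inv_arr K (counit X y) \<cdot>\<^bsub>K\<^esub> (f \<cdot>\<^bsub>K\<^esub> counit X x)))\<rparr>),
     pn_mor = (\<lambda>a y. let X = Src A a; Z = Trg A a; K = pf_ob Q Z; r = rep X y; z = fob (pf_mor Q a) y in
       lift Z (fob (pf_mor P a) r) (rep Z z)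
         (inv_arr K (counit Z z) \<cdot>\<^bsub>K\<^esub> (far (pf_mor Q a) (counit X y) \<cdot>\<^bsub>K\<^esub> inv_arr K (pn_mor \<rho> a r))))\<rparr>"

definition unit_inv :: "'o \<Rightarrow> 'x \<Rightarrow> 'y" where
  "unit_inv X x = (let y = fob (pn_ob \<rho> X) x in lift X x (rep X y) (inv_arr (pf_ob Q X) (counit X y)))"

lemma fob_inverse: "fob (pn_ob inverse X) y = rep X y"
  by (simp add: inverse_def)

lemma far_inverse:
  assumes X: "X \<in> Ob A" and f: "f \<in> Arr (pf_ob Q X)"
  shows "far (pn_ob inverse X) f \<in> Arr (pf_ob P X)"
    "Dom (pf_ob P X) (far (pn_ob inverse X) f) = rep X (Dom (pf_ob Q X) f)"
    "Cod (pf_ob P X) (far (pn_ob inverse X) f) = rep X (Cod (pf_ob Q X) f)"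
    "counit X (Cod (pf_ob Q X) f) \<cdot>\<^bsub>pf_ob Q X\<^esub> far (pn_ob \<rho> X) (far (pn_ob inverse X) f) =
      f \<cdot>\<^bsub>pf_ob Q X\<^esub> counit X (Dom (pf_ob Q X) f)"
proof -
  note [simp] = pn_simps X f rep_Obj counit_typing lift category.inv_Cmp_cancel(2)[OF _ iso_counit]
  show "far (pn_ob inverse X) f \<in> Arr (pf_ob P X)"
    "Dom (pf_ob P X) (far (pn_ob inverse X) f) = rep X (Dom (pf_ob Q X) f)"
    "Cod (pf_ob P X) (far (pn_ob inverse X) f) = rep X (Cod (pf_ob Q X) f)"
    "counit X (Cod (pf_ob Q X) f) \<cdot>\<^bsub>pf_ob Q X\<^esub> far (pn_ob \<rho> X) (far (pn_ob inverse X) f) =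
      f \<cdot>\<^bsub>pf_ob Q X\<^esub> counit X (Dom (pf_ob Q X) f)"
    by (simp_all add: inverse_def Let_def)
qed

lemma far_inverse_tail:
  assumes "X \<in> Ob A" "f \<in> Arr (pf_ob Q X)" "Cod (pf_ob Q X) f = y" "e \<in> Arr (pf_ob Q X)"
    "Cod (pf_ob Q X) e = fob (pn_ob \<rho> X) (rep X (Dom (pf_ob Q X) f))"
  shows "counit X y \<cdot>\<^bsub>pf_ob Q X\<^esub> (far (pn_ob \<rho> X) (far (pn_ob inverse X) f) \<cdot>\<^bsub>pf_ob Q X\<^esub> e) =
    f \<cdot>\<^bsub>pf_ob Q X\<^esub> (counit X (Dom (pf_ob Q X) f) \<cdot>\<^bsub>pf_ob Q X\<^esub> e)"
  using assms far_inverse[of X f]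
  by (intro Cmp_square) (auto simp: pn_simps rep_Obj counit_typing)

lemma mor_inverse:
  assumes a: "a \<in> Mor A" "Src A a = X" "Trg A a = Z" and y: "y \<in> Obj (pf_ob Q X)"
  shows "iso_hom (pf_ob P Z) (pn_mor inverse a y) (fob (pf_mor P a) (rep X y)) (rep Z (fob (pf_mor Q a) y))"
    and "counit Z (fob (pf_mor Q a) y) \<cdot>\<^bsub>pf_ob Q Z\<^esub>
        (far (pn_ob \<rho> Z) (pn_mor inverse a y) \<cdot>\<^bsub>pf_ob Q Z\<^esub> pn_mor \<rho> a (rep X y)) =
      far (pf_mor Q a) (counit X y)"
proof -
  have XZ: "X \<in> Ob A" "Z \<in> Ob A" using a P.mor_simps(1,2) by auto
  note [simp] = pn_simps XZ a y rep_Obj counit_typing category.inv_Cmp_cancel(2)[OF _ iso_counit]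
  let ?K = "pf_ob Q Z" and ?z = "fob (pf_mor Q a) y" and ?r = "rep X y"
  let ?b = "inv_arr ?K (counit Z ?z) \<cdot>\<^bsub>?K\<^esub> (far (pf_mor Q a) (counit X y) \<cdot>\<^bsub>?K\<^esub> inv_arr ?K (pn_mor \<rho> a ?r))"
  have \<rho>: "iso_hom ?K (pn_mor \<rho> a ?r) (fob (pf_mor Q a) (fob (pn_ob \<rho> X) ?r)) (fob (pn_ob \<rho> Z) (fob (pf_mor P a) ?r))"
    by (rule iso_mor) simp_all
  note [simp] = iso_homD[OF \<rho>]
  have "iso_hom ?K (far (pf_mor Q a) (counit X y)) (fob (pf_mor Q a) (fob (pn_ob \<rho> X) ?r)) ?z"
    by (rule Q.far_iso[OF a]) (simp add: iso_counit)
  from category.iso_Cmp[OF _ category.iso_Cmp[OF _ iso_hom_inv[OF \<rho>] this] iso_hom_inv[OF iso_counit]]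
  have "iso_hom ?K ?b (fob (pn_ob \<rho> Z) (fob (pf_mor P a) ?r)) (fob (pn_ob \<rho> Z) (rep Z ?z))" by simp
  then have b: "iso_hom (pf_ob P Z) (lift Z (fob (pf_mor P a) ?r) (rep Z ?z) ?b) (fob (pf_mor P a) ?r) (rep Z ?z)"
    by (intro lift_iso) simp_all
  have eq: "pn_mor inverse a y = lift Z (fob (pf_mor P a) ?r) (rep Z ?z) ?b"
    by (simp add: inverse_def Let_def)
  show "iso_hom (pf_ob P Z) (pn_mor inverse a y) (fob (pf_mor P a) ?r) (rep Z ?z)"
    unfolding eq by (rule b)
  show "counit Z ?z \<cdot>\<^bsub>?K\<^esub> (far (pn_ob \<rho> Z) (pn_mor inverse a y) \<cdot>\<^bsub>?K\<^esub> pn_mor \<rho> a ?r) = far (pf_mor Q a) (counit X y)"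
    unfolding eq by (simp add: lift)
qed

lemma mor_inverse_typing:
  assumes "a \<in> Mor A" "Trg A a = Z" "y \<in> Obj (pf_ob Q (Src A a))"
  shows "pn_mor inverse a y \<in> Arr (pf_ob P Z)"
    "Dom (pf_ob P Z) (pn_mor inverse a y) = fob (pf_mor P a) (rep (Src A a) y)"
    "Cod (pf_ob P Z) (pn_mor inverse a y) = rep Z (fob (pf_mor Q a) y)"
  using iso_homD[OF mor_inverse(1)[OF assms(1) refl assms(2,3)]] by auto

lemma mor_inverse_tail:
  assumes a: "a \<in> Mor A" "Src A a = X" "Trg A a = Z" and y: "y \<in> Obj (pf_ob Q X)"
    and e: "e \<in> Arr (pf_ob Q Z)" "Cod (pf_ob Q Z) e = fob (pf_mor Q a) (fob (pn_ob \<rho> X) (rep X y))"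
  shows "counit Z (fob (pf_mor Q a) y) \<cdot>\<^bsub>pf_ob Q Z\<^esub> (far (pn_ob \<rho> Z) (pn_mor inverse a y) \<cdot>\<^bsub>pf_ob Q Z\<^esub>
      (pn_mor \<rho> a (rep X y) \<cdot>\<^bsub>pf_ob Q Z\<^esub> e)) = far (pf_mor Q a) (counit X y) \<cdot>\<^bsub>pf_ob Q Z\<^esub> e"
proof -
  have XZ: "X \<in> Ob A" "Z \<in> Ob A" using a P.mor_simps(1,2) by auto
  note [simp] = pn_simps XZ a y e rep_Obj counit_typing mor_inverse_typing
  show ?thesis by (subst mor_inverse(2)[OF a y, symmetric]) simp
qed

lemma unit_inv:
  assumes X: "X \<in> Ob A" and x: "x \<in> Obj (pf_ob P X)"
  shows "iso_hom (pf_ob P X) (unit_inv X x) x (rep X (fob (pn_ob \<rho> X) x))"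
    and "counit X (fob (pn_ob \<rho> X) x) \<cdot>\<^bsub>pf_ob Q X\<^esub> far (pn_ob \<rho> X) (unit_inv X x) =
      Idn (pf_ob Q X) (fob (pn_ob \<rho> X) x)"
proof -
  note [simp] = pn_simps X x rep_Obj counit_typing lift
  show "iso_hom (pf_ob P X) (unit_inv X x) x (rep X (fob (pn_ob \<rho> X) x))"
    unfolding unit_inv_def Let_def by (intro lift_iso iso_hom_inv iso_counit) simp_all
  show "counit X (fob (pn_ob \<rho> X) x) \<cdot>\<^bsub>pf_ob Q X\<^esub> far (pn_ob \<rho> X) (unit_inv X x) =
      Idn (pf_ob Q X) (fob (pn_ob \<rho> X) x)"
    by (simp add: unit_inv_def Let_def)
qed

lemmas unit_inv_typing = iso_homD(1-3)[OF unit_inv(1)]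

lemma unit_inv_tail:
  assumes "X \<in> Ob A" "x \<in> Obj (pf_ob P X)" "e \<in> Arr (pf_ob Q X)" "Cod (pf_ob Q X) e = fob (pn_ob \<rho> X) x"
  shows "counit X (fob (pn_ob \<rho> X) x) \<cdot>\<^bsub>pf_ob Q X\<^esub> (far (pn_ob \<rho> X) (unit_inv X x) \<cdot>\<^bsub>pf_ob Q X\<^esub> e) = e"
  by (subst Cmp_triangle[OF _ unit_inv(2)])
    (use assms in \<open>auto simp: pn_simps rep_Obj counit_typing unit_inv_typing\<close>)

lemmas inverse_typing = fob_inverse far_inverse(1-3) rep_Obj counit_typing(1-3) mor_inverse_typing
  unit_inv_typing

text \<open>
  After applying \<open>\<rho>\<close> and composing with the counit, each axiom for \<open>\<sigma>\<close> reduces to naturality of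
  the counit, or to naturality of the 2-morphisms and compositors of \<open>Q\<close> at the counit.
\<close>

lemma transformation_inverse: "transformation A Q P inverse"
proof (rule transformationI[OF Q.cat_valued_axioms P.cat_valued_axioms])
  note [simp] = pn_simps inverse_typing P.simps far_inverse(4) far_inverse_tail
  let ?R = "\<lambda>X. far (pn_ob \<rho> X)" and ?S = "\<lambda>X. far (pn_ob inverse X)"
  {
    fix X assume [simp]: "X \<in> Ob A"
    have eqI: "f = g" if "f \<in> Arr (pf_ob P X)" "g \<in> Arr (pf_ob P X)" "Dom (pf_ob P X) f = Dom (pf_ob P X) g"
      "Cod (pf_ob P X) f = rep X y" "Cod (pf_ob P X) g = rep X y" "y \<in> Obj (pf_ob Q X)"
      "counit X y \<cdot>\<^bsub>pf_ob Q X\<^esub> ?R X f = counit X y \<cdot>\<^bsub>pf_ob Q X\<^esub> ?R X g" for f g y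
      using that
      by (intro faithful_counit[where X = X and y = y and v = "fob (pn_ob \<rho> X) (Dom (pf_ob P X) g)" and w = "Idn (pf_ob Q X) (fob (pn_ob \<rho> X) (Dom (pf_ob P X) g))"])
        (auto simp: category.iso_Idn)
    show "is_functor (pf_ob Q X) (pf_ob P X) (pn_ob inverse X)"
    proof (intro is_functor.intro is_functor_axioms.intro)
      show "?S X (Idn (pf_ob Q X) x) = Idn (pf_ob P X) (fob (pn_ob inverse X) x)" if "x \<in> Obj (pf_ob Q X)" for x
        using that far_inverse(4)[of X "Idn (pf_ob Q X) x"] by (intro eqI[where y = x]) simp_all
      show "?S X (g \<cdot>\<^bsub>pf_ob Q X\<^esub> f) = ?S X g \<cdot>\<^bsub>pf_ob P X\<^esub> ?S X f"
        if "in_hom (pf_ob Q X) f x y" "in_hom (pf_ob Q X) g y z" for f g x y z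
        using that far_inverse(4)[of X "g \<cdot>\<^bsub>pf_ob Q X\<^esub> f"] far_inverse(4)[of X f]
        by (intro eqI[where y = z]) (auto simp: in_hom_iff)
    qed (auto simp: in_hom_iff)
  }
  show "iso_hom (pf_ob P Z) (pn_mor inverse a y) (fob (pf_mor P a) (fob (pn_ob inverse X) y))
      (fob (pn_ob inverse Z) (fob (pf_mor Q a) y))"
    if "a \<in> Mor A" "Src A a = X" "Trg A a = Z" "y \<in> Obj (pf_ob Q X)" for a X Z y
    using mor_inverse(1)[OF that] by simp
next
  note [simp] = pn_simps inverse_typing P.simps
  let ?R = "\<lambda>X. far (pn_ob \<rho> X)" and ?S = "\<lambda>X. far (pn_ob inverse X)"
  {
    fix a X Z f x y
    assume [simp]: "a \<in> Mor A" "Src A a = X" "Trg A a = Z" "X \<in> Ob A" "Z \<in> Ob A" "f \<in> Arr (pf_ob Q X)"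
      "Dom (pf_ob Q X) f = x" "Cod (pf_ob Q X) f = y" "x \<in> Obj (pf_ob Q X)" "y \<in> Obj (pf_ob Q X)"
    have "far (pf_mor Q a) (counit X y \<cdot>\<^bsub>pf_ob Q X\<^esub> ?R X (?S X f)) = far (pf_mor Q a) (f \<cdot>\<^bsub>pf_ob Q X\<^esub> counit X x)"
      using far_inverse(4)[of X f] by simp
    then have 1: "far (pf_mor Q a) (counit X y) \<cdot>\<^bsub>pf_ob Q Z\<^esub> far (pf_mor Q a) (?R X (?S X f)) =
      far (pf_mor Q a) f \<cdot>\<^bsub>pf_ob Q Z\<^esub> far (pf_mor Q a) (counit X x)" by simp
    show "pn_mor inverse a y \<cdot>\<^bsub>pf_ob P Z\<^esub> far (pf_mor P a) (?S X f) =
        ?S Z (far (pf_mor Q a) f) \<cdot>\<^bsub>pf_ob P Z\<^esub> pn_mor inverse a x"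
      by (rule faithful_counit[where y = "fob (pf_mor Q a) y", OF _ _ _ _ _ _ _ _ iso_mor[of a X Z "rep X x"]])
        (simp_all add: far_inverse_tail mor_inverse(2)[of a X Z] mor_inverse_tail[of a X Z]
          mor_square[of a X Z] 1)
  next
    fix s a b X Z x
    assume [simp]: "s \<in> Cell A" "VDom A s = a" "VCod A s = b" "a \<in> Mor A" "b \<in> Mor A" "Src A a = X"
      "Trg A a = Z" "Src A b = X" "Trg A b = Z" "X \<in> Ob A" "Z \<in> Ob A" "x \<in> Obj (pf_ob Q X)"
    show "pn_mor inverse b x \<cdot>\<^bsub>pf_ob P Z\<^esub> pf_cell P s (fob (pn_ob inverse X) x) =
      ?S Z (pf_cell Q s x) \<cdot>\<^bsub>pf_ob P Z\<^esub> pn_mor inverse a x"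
      by (rule faithful_counit[where y = "fob (pf_mor Q b) x", OF _ _ _ _ _ _ _ _ iso_mor[of a X Z "rep X x"]])
        (simp_all add: far_inverse_tail mor_inverse(2)[of _ X Z] mor_inverse_tail[of _ X Z]
          cell_square[of s a X Z] Q.cell_square[of s a b X Z "counit X x"])
  next
    fix X x assume [simp]: "X \<in> Ob A" "x \<in> Obj (pf_ob Q X)"
    show "pn_mor inverse (Id1 A X) x = Idn (pf_ob P X) (fob (pn_ob inverse X) x)"
      by (rule faithful_counit[where y = x, OF _ _ _ _ _ _ _ _ iso_mor[of "Id1 A X" X X "rep X x"]])
        (use mor_inverse(2)[of "Id1 A X" X X x] mor_inverse_typing[of "Id1 A X" X x] in \<open>simp_all add: unit\<close>)
  next
    fix a b X Y Z x
    assume [simp]: "a \<in> Mor A" "b \<in> Mor A" "Src A a = X" "Trg A a = Y" "Src A b = Y" "Trg A b = Z"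
      "X \<in> Ob A" "Y \<in> Ob A" "Z \<in> Ob A" "x \<in> Obj (pf_ob Q X)"
    let ?K = "pf_ob Q Z" and ?r = "rep X x"
    let ?w = "pn_mor \<rho> b (fob (pf_mor P a) ?r) \<cdot>\<^bsub>?K\<^esub> far (pf_mor Q b) (pn_mor \<rho> a ?r)"
    have w: "iso_hom ?K ?w (fob (pf_mor Q b) (fob (pf_mor Q a) (fob (pn_ob \<rho> X) ?r)))
        (fob (pn_ob \<rho> Z) (fob (pf_mor P b) (fob (pf_mor P a) ?r)))"
      by (rule category.iso_Cmp[OF _ Q.far_iso[OF _ _ _ iso_mor[of a X Y]] iso_mor]) simp_all
    have "far (pf_mor Q b) (counit Y (fob (pf_mor Q a) x) \<cdot>\<^bsub>pf_ob Q Y\<^esub>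
        (?R Y (pn_mor inverse a x) \<cdot>\<^bsub>pf_ob Q Y\<^esub> pn_mor \<rho> a ?r)) = far (pf_mor Q b) (far (pf_mor Q a) (counit X x))"
      by (subst mor_inverse(2)) simp_all
    then have 1: "far (pf_mor Q b) (counit Y (fob (pf_mor Q a) x)) \<cdot>\<^bsub>?K\<^esub>
        (far (pf_mor Q b) (?R Y (pn_mor inverse a x)) \<cdot>\<^bsub>?K\<^esub> far (pf_mor Q b) (pn_mor \<rho> a ?r)) =
      far (pf_mor Q b) (far (pf_mor Q a) (counit X x))" by simp
    show "pn_mor inverse (b \<odot> a) x \<cdot>\<^bsub>pf_ob P Z\<^esub> pf_cpr P a b (fob (pn_ob inverse X) x) =
      ?S Z (pf_cpr Q a b x) \<cdot>\<^bsub>pf_ob P Z\<^esub>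
        (pn_mor inverse b (fob (pf_mor Q a) x) \<cdot>\<^bsub>pf_ob P Z\<^esub> far (pf_mor P b) (pn_mor inverse a x))"
    proof (rule faithful_counit[where y = "fob (pf_mor Q (b \<odot> a)) x", OF _ _ _ _ _ _ _ _ w])
      let ?e = "counit Z (fob (pf_mor Q (b \<odot> a)) x)"
      have "?e \<cdot>\<^bsub>?K\<^esub> (?R Z (pn_mor inverse (b \<odot> a) x) \<cdot>\<^bsub>?K\<^esub> (?R Z (pf_cpr P a b ?r) \<cdot>\<^bsub>?K\<^esub> ?w)) =
          far (pf_mor Q (b \<odot> a)) (counit X x) \<cdot>\<^bsub>?K\<^esub> pf_cpr Q a b (fob (pn_ob \<rho> X) ?r)"
        by (subst comp[of a b X Z]) (simp_all add: mor_inverse_tail[of "b \<odot> a" X Z])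
      also have "\<dots> = pf_cpr Q a b x \<cdot>\<^bsub>?K\<^esub> far (pf_mor Q b) (far (pf_mor Q a) (counit X x))"
        by (simp add: Q.cpr_square[of a b X Z])
      also have "\<dots> = ?e \<cdot>\<^bsub>?K\<^esub> (?R Z (?S Z (pf_cpr Q a b x)) \<cdot>\<^bsub>?K\<^esub> (?R Z (pn_mor inverse b (fob (pf_mor Q a) x)) \<cdot>\<^bsub>?K\<^esub>
          (?R Z (far (pf_mor P b) (pn_mor inverse a x)) \<cdot>\<^bsub>?K\<^esub> ?w)))"
        by (subst Cmp_square[OF _ mor_square[of b Y Z "pn_mor inverse a x"]])
          (simp_all add: far_inverse_tail mor_inverse_tail[of b Y Z] 1)
      finally show "?e \<cdot>\<^bsub>?K\<^esub> (?R Z (pn_mor inverse (b \<odot> a) x \<cdot>\<^bsub>pf_ob P Z\<^esub> pf_cpr P a b (fob (pn_ob inverse X) x)) \<cdot>\<^bsub>?K\<^esub> ?w) =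
        ?e \<cdot>\<^bsub>?K\<^esub> (?R Z (?S Z (pf_cpr Q a b x) \<cdot>\<^bsub>pf_ob P Z\<^esub>
          (pn_mor inverse b (fob (pf_mor Q a) x) \<cdot>\<^bsub>pf_ob P Z\<^esub> far (pf_mor P b) (pn_mor inverse a x))) \<cdot>\<^bsub>?K\<^esub> ?w)"
        by simp
    qed simp_all
  }
qed

text \<open>
  The counit of the adjunction is \<open>counit\<close>. The first triangle identity is the characterising
  equation of the unit; the second holds after applying \<open>\<rho>\<close> and composing with the
  counit, by naturality of the counit and the first one.
\<close>

lemma adjoint_equivalence: "pseudonat_adjoint_equivalence A P Q \<rho>"
  unfolding pseudonat_adjoint_equivalence_def
proof (intro conjI exI)
  interpret \<sigma>: transformation A Q P inverse by (rule transformation_inverse)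
  note [simp] = pn_simps \<sigma>.ob_typing inverse_typing P.simps
  let ?R = "\<lambda>X. far (pn_ob \<rho> X)" and ?S = "\<lambda>X. far (pn_ob inverse X)"
  show "pseudonat A P Q \<rho>" "pseudonat A Q P inverse"
    by (rule pseudonat_axioms, rule \<sigma>.pseudonat_axioms)
  have \<rho>: "transformation A P Q \<rho>" by unfold_locales
  have id: "iso_hom (pf_ob Q X) (Idn (pf_ob Q X) (fob (pn_ob \<rho> X) x)) (fob (pn_ob \<rho> X) x) (fob (pn_ob \<rho> X) x)"
    if "X \<in> Ob A" "x \<in> Obj (pf_ob P X)" for X x
    using that by (intro category.iso_Idn) auto
  note [simp] = id_pnat_def comp_pnat_def id_fctr_def comp_fctr_def
  show "invertible_modification A P P (id_pnat A P) (comp_pnat A P inverse \<rho>) unit_inv"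
  proof (rule invertible_modificationI[OF transformation_id[OF P.cat_valued_axioms]
        transformation_comp[OF \<rho> transformation_inverse]])
    show "iso_hom (pf_ob P X) (unit_inv X x) (fob (pn_ob (id_pnat A P) X) x)
        (fob (pn_ob (comp_pnat A P inverse \<rho>) X) x)" if "X \<in> Ob A" "x \<in> Obj (pf_ob P X)" for X x
      using unit_inv(1)[OF that] by simp
  next
    fix X f x y
    assume [simp]: "X \<in> Ob A" "f \<in> Arr (pf_ob P X)" "Dom (pf_ob P X) f = x" "Cod (pf_ob P X) f = y"
      "x \<in> Obj (pf_ob P X)" "y \<in> Obj (pf_ob P X)"
    show "unit_inv X y \<cdot>\<^bsub>pf_ob P X\<^esub> far (pn_ob (id_pnat A P) X) f =
      far (pn_ob (comp_pnat A P inverse \<rho>) X) f \<cdot>\<^bsub>pf_ob P X\<^esub> unit_inv X x"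
      by (rule faithful_counit[where y = "fob (pn_ob \<rho> X) y", OF _ _ _ _ _ _ _ _ id[of X x]])
        (simp_all add: unit_inv(2) unit_inv_tail far_inverse_tail)
  next
    fix a X Y x
    assume [simp]: "a \<in> Mor A" "Src A a = X" "Trg A a = Y" "X \<in> Ob A" "Y \<in> Ob A" "x \<in> Obj (pf_ob P X)"
    have "far (pf_mor Q a) (counit X (fob (pn_ob \<rho> X) x) \<cdot>\<^bsub>pf_ob Q X\<^esub> ?R X (unit_inv X x)) =
        Idn (pf_ob Q Y) (fob (pf_mor Q a) (fob (pn_ob \<rho> X) x))"
      by (subst unit_inv(2)) simp_all
    then have 1: "far (pf_mor Q a) (counit X (fob (pn_ob \<rho> X) x)) \<cdot>\<^bsub>pf_ob Q Y\<^esub> far (pf_mor Q a) (?R X (unit_inv X x)) =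
        Idn (pf_ob Q Y) (fob (pf_mor Q a) (fob (pn_ob \<rho> X) x))" by simp
    show "pn_mor (comp_pnat A P inverse \<rho>) a x \<cdot>\<^bsub>pf_ob P Y\<^esub> far (pf_mor P a) (unit_inv X x) =
      unit_inv Y (fob (pf_mor P a) x) \<cdot>\<^bsub>pf_ob P Y\<^esub> pn_mor (id_pnat A P) a x"
      by (rule faithful_counit[where y = "fob (pn_ob \<rho> Y) (fob (pf_mor P a) x)", OF _ _ _ _ _ _ _ _ iso_mor[of a X Y x]])
        (simp_all add: unit_inv_tail far_inverse_tail mor_inverse_tail[of a X Y] mor_square[of a X Y] 1)
  qed
  show "invertible_modification A Q Q (comp_pnat A Q \<rho> inverse) (id_pnat A Q) counit"
  proof (rule invertible_modificationI[OF transformation_comp[OF transformation_inverse \<rho>]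
        transformation_id[OF Q.cat_valued_axioms]])
    show "iso_hom (pf_ob Q X) (counit X y) (fob (pn_ob (comp_pnat A Q \<rho> inverse) X) y)
        (fob (pn_ob (id_pnat A Q) X) y)" if "X \<in> Ob A" "y \<in> Obj (pf_ob Q X)" for X y
      using iso_counit[OF that] by simp
    show "counit X y \<cdot>\<^bsub>pf_ob Q X\<^esub> far (pn_ob (comp_pnat A Q \<rho> inverse) X) f =
      far (pn_ob (id_pnat A Q) X) f \<cdot>\<^bsub>pf_ob Q X\<^esub> counit X x"
      if "X \<in> Ob A" "f \<in> Arr (pf_ob Q X)" "Dom (pf_ob Q X) f = x" "Cod (pf_ob Q X) f = y" for X f x y
      using far_inverse(4)[of X f] that by simp
    show "pn_mor (id_pnat A Q) a y \<cdot>\<^bsub>pf_ob Q Z\<^esub> far (pf_mor Q a) (counit X y) =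
      counit Z (fob (pf_mor Q a) y) \<cdot>\<^bsub>pf_ob Q Z\<^esub> pn_mor (comp_pnat A Q \<rho> inverse) a y"
      if "a \<in> Mor A" "Src A a = X" "Trg A a = Z" "X \<in> Ob A" "Z \<in> Ob A" "y \<in> Obj (pf_ob Q X)" for a X Z y
      using mor_inverse(2)[of a X Z y] that by simp
  qed
  show "modif_eq A P (comp_modif Q (whisker_pre counit \<rho>) (whisker_post \<rho> unit_inv)) (id_modif Q \<rho>)"
    by (simp add: modif_eq_def comp_modif_def whisker_pre_def whisker_post_def id_modif_def unit_inv(2))
  show "modif_eq A Q (comp_modif P (whisker_post inverse counit) (whisker_pre unit_inv inverse)) (id_modif P inverse)"
    unfolding modif_eq_def comp_modif_def whisker_pre_def whisker_post_def id_modif_def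
  proof (intro ballI)
    fix X y assume [simp]: "X \<in> Ob A" "y \<in> Obj (pf_ob Q X)"
    show "?S X (counit X y) \<cdot>\<^bsub>pf_ob P X\<^esub> unit_inv X (fob (pn_ob inverse X) y) =
        Idn (pf_ob P X) (fob (pn_ob inverse X) y)"
      by (rule faithful_counit[where y = y, OF _ _ _ _ _ _ _ _ id[of X "rep X y"]])
        (simp_all add: far_inverse_tail unit_inv(2))
  qed
qed

end

text \<open>
  The usual argument in each component: the invertible unit and counit make \<open>\<rho>\<close> and \<open>\<sigma>\<close>
  faithful, the counit makes \<open>\<rho>\<close> essentially surjective, and \<open>b : \<rho> x \<rightarrow> \<rho> y\<close> is the image
  of the conjugate of \<open>\<sigma> b\<close> by the unit, which is checked after applying the faithful
  \<open>\<sigma>\<close>.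
\<close>

lemma pointwise_equivalence_if_adjoint_equivalence:
  assumes P: "cat_valued A P" and Q: "cat_valued A Q" and eq: "pseudonat_adjoint_equivalence A P Q \<rho>"
  shows "pointwise_equivalence A P Q \<rho>"
proof -
  obtain \<sigma> \<eta> \<epsilon> where \<rho>: "pseudonat A P Q \<rho>" and \<sigma>: "pseudonat A Q P \<sigma>"
    and \<eta>: "invertible_modification A P P (id_pnat A P) (comp_pnat A P \<sigma> \<rho>) \<eta>"
    and \<epsilon>: "invertible_modification A Q Q (comp_pnat A Q \<rho> \<sigma>) (id_pnat A Q) \<epsilon>"
    using eq unfolding pseudonat_adjoint_equivalence_def by blast
  interpret \<rho>: transformation A P Q \<rho> by (intro transformation.intro P Q \<rho>)
  interpret \<sigma>: transformation A Q P \<sigma> by (intro transformation.intro P Q \<sigma>)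
  have iso: "iso_hom (pf_ob G X) (m X x) (fob (pn_ob \<theta> X) x) (fob (pn_ob \<kappa> X) x)"
    "f \<in> Arr (pf_ob F X) \<Longrightarrow> Dom (pf_ob F X) f = x \<Longrightarrow> Cod (pf_ob F X) f = y \<Longrightarrow>
      m X y \<cdot>\<^bsub>pf_ob G X\<^esub> far (pn_ob \<theta> X) f = far (pn_ob \<kappa> X) f \<cdot>\<^bsub>pf_ob G X\<^esub> m X x"
    if m: "invertible_modification A F G \<theta> \<kappa> m" and X: "X \<in> Ob A" and x: "x \<in> Obj (pf_ob F X)"
    for F :: "('a, 'b, 'c, 'p, 'q) pfun" and G :: "('a, 'b, 'c, 'r, 's) pfun" and \<theta> \<kappa> m X x f y
  proof -
    obtain n where m': "modification A F G \<theta> \<kappa> m" and n: "modification A F G \<kappa> \<theta> n"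
      and *: "modif_eq A F (comp_modif G n m) (id_modif G \<theta>)" "modif_eq A F (comp_modif G m n) (id_modif G \<kappa>)"
      using m unfolding invertible_modification_def by blast
    note mX = modification.component_nat[OF m' X] and nX = modification.component_nat[OF n X]
    show "iso_hom (pf_ob G X) (m X x) (fob (pn_ob \<theta> X) x) (fob (pn_ob \<kappa> X) x)"
      using nat_trans.component[OF mX x] nat_trans.component[OF nX x] * X x
      by (auto simp: iso_hom_def modif_eq_def comp_modif_def id_modif_def)
    show "m X y \<cdot>\<^bsub>pf_ob G X\<^esub> far (pn_ob \<theta> X) f = far (pn_ob \<kappa> X) f \<cdot>\<^bsub>pf_ob G X\<^esub> m X x"
      if "f \<in> Arr (pf_ob F X)" "Dom (pf_ob F X) f = x" "Cod (pf_ob F X) f = y"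
      using nat_trans.natural[OF mX, of f x y] that by (simp add: in_hom_iff)
  qed
  note \<eta> = iso[OF \<eta>] and \<epsilon> = iso[OF \<epsilon>]
  note [simp] = id_pnat_def comp_pnat_def id_fctr_def comp_fctr_def \<rho>.pn_simps \<sigma>.ob_typing
  show ?thesis
  proof (intro pointwise_equivalence.intro \<rho>.transformation_axioms pointwise_equivalence_axioms.intro)
    fix X assume [simp]: "X \<in> Ob A"
    let ?P = "pf_ob P X" and ?Q = "pf_ob Q X" and ?R = "pn_ob \<rho> X" and ?S = "pn_ob \<sigma> X"
    have inv: "iso_hom ?P (\<eta> X x) x (fob ?S (fob ?R x))" if "x \<in> Obj ?P" for x
      using \<eta>(1)[of X x] that by simp
    have coinv: "iso_hom ?Q (\<epsilon> X y) (fob ?R (fob ?S y)) y" if "y \<in> Obj ?Q" for y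
      using \<epsilon>(1)[of X y] that by simp
    note D = iso_homD[OF inv] iso_homD[OF coinv]
    have \<eta>2: "\<eta> X (Cod ?P f) \<cdot>\<^bsub>?P\<^esub> f = far ?S (far ?R f) \<cdot>\<^bsub>?P\<^esub> \<eta> X (Dom ?P f)" if "f \<in> Arr ?P" for f
      using \<eta>(2)[of X "Dom ?P f" f "Cod ?P f"] that by simp
    have \<epsilon>2: "\<epsilon> X (Cod ?Q f) \<cdot>\<^bsub>?Q\<^esub> far ?R (far ?S f) = f \<cdot>\<^bsub>?Q\<^esub> \<epsilon> X (Dom ?Q f)" if "f \<in> Arr ?Q" for f
      using \<epsilon>(2)[of X "Dom ?Q f" f "Cod ?Q f"] that by simp
    have R_faithful: "f = g" if "f \<in> Arr ?P" "g \<in> Arr ?P" "Dom ?P f = Dom ?P g" "Cod ?P f = Cod ?P g"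
      "far ?R f = far ?R g" for f g
      by (rule category.iso_cancel_left[OF _ inv[of "Cod ?P g"]])
        (use that \<eta>2[of f] \<eta>2[of g] in simp_all)
    have S_faithful: "f = g" if "f \<in> Arr ?Q" "g \<in> Arr ?Q" "Dom ?Q f = Dom ?Q g" "Cod ?Q f = Cod ?Q g"
      "far ?S f = far ?S g" for f g
      by (rule category.iso_cancel_right[OF _ coinv[of "Dom ?Q g"]])
        (use that \<epsilon>2[of f] \<epsilon>2[of g] in simp_all)
    show "cat_equivalence ?P ?Q ?R"
      unfolding cat_equivalence_def
    proof (intro conjI ballI allI impI \<rho>.ob_functor)
      show "\<exists>x \<in> Obj ?P. \<exists>e. iso_hom ?Q e (fob ?R x) y" if "y \<in> Obj ?Q" for y
        using coinv[OF that] that by (intro bexI[of _ "fob ?S y"]) auto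
    next
      fix x y b assume x: "x \<in> Obj ?P" and y: "y \<in> Obj ?P" and b: "in_hom ?Q b (fob ?R x) (fob ?R y)"
      let ?f = "inv_arr ?P (\<eta> X y) \<cdot>\<^bsub>?P\<^esub> (far ?S b \<cdot>\<^bsub>?P\<^esub> \<eta> X x)"
      have b': "b \<in> Arr ?Q" "Dom ?Q b = fob ?R x" "Cod ?Q b = fob ?R y" using b by (auto simp: in_hom_iff)
      note [simp] = x y b' D
      have f: "?f \<in> Arr ?P" "Dom ?P ?f = x" "Cod ?P ?f = y" by simp_all
      have "far ?S (far ?R ?f) \<cdot>\<^bsub>?P\<^esub> \<eta> X x = \<eta> X y \<cdot>\<^bsub>?P\<^esub> ?f"
        using \<eta>2[OF f(1)] f by simp
      also have "\<dots> = far ?S b \<cdot>\<^bsub>?P\<^esub> \<eta> X x"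
        by (rule category.inv_Cmp_cancel(2)[OF _ inv]) simp_all
      finally have eq: "far ?S (far ?R ?f) \<cdot>\<^bsub>?P\<^esub> \<eta> X x = far ?S b \<cdot>\<^bsub>?P\<^esub> \<eta> X x" .
      have "far ?S (far ?R ?f) = far ?S b"
        by (rule category.iso_cancel_right[OF _ inv eq]) (simp_all add: f)
      then have "far ?R ?f = b" by (intro S_faithful) (use f in simp_all)
      then show "\<exists>!f. in_hom ?P f x y \<and> far ?R f = b"
        using f by (intro ex1I[of _ ?f]) (auto simp: in_hom_iff intro: R_faithful)
    qed simp
  qed
qed

section \<open>Representable pseudo-functors\<close>

lemma cat_equivalence_nat_iso:
  assumes T: "cat_equivalence K L T" and "nat_iso K L S T t"
  shows "cat_equivalence K L S"
proof -
  interpret nat_iso K L S T t by fact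
  note [simp] = cat_simps[OF S.src.category_axioms] cat_simps[OF S.trg.category_axioms]
    S.fob_Obj T.fob_Obj S.far_simps T.far_simps
  have t: "iso_hom L (t x) (fob S x) (fob T x)" if "x \<in> Obj K" for x using that by (rule component_iso)
  note [simp] = iso_homD[OF t]
  have nat: "t (Cod K f) \<cdot>\<^bsub>L\<^esub> far S f = far T f \<cdot>\<^bsub>L\<^esub> t (Dom K f)" if "f \<in> Arr K" for f
    using natural[of f] that by (simp add: in_hom_iff)
  show ?thesis
    unfolding cat_equivalence_def
  proof (intro conjI ballI allI impI)
    show "is_functor K L S" by unfold_locales
    fix y assume "y \<in> Obj L"
    then have "\<exists>x \<in> Obj K. \<exists>e. iso_hom L e (fob T x) y" using T by (simp add: cat_equivalence_def)
    then show "\<exists>x \<in> Obj K. \<exists>e. iso_hom L e (fob S x) y"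
      using S.trg.iso_Cmp[OF t] by blast
  next
    fix x y b assume x: "x \<in> Obj K" and y: "y \<in> Obj K" and "in_hom L b (fob S x) (fob S y)"
    then have b: "b \<in> Arr L" "Dom L b = fob S x" "Cod L b = fob S y" by (auto simp: in_hom_iff)
    let ?b = "t y \<cdot>\<^bsub>L\<^esub> (b \<cdot>\<^bsub>L\<^esub> inv_arr L (t x))"
    have "in_hom L ?b (fob T x) (fob T y)" using x y b by (simp add: in_hom_iff)
    then have "\<exists>!f. in_hom K f x y \<and> far T f = ?b" using T x y by (simp add: cat_equivalence_def)
    moreover have "far T f = ?b \<longleftrightarrow> far S f = b" if "in_hom K f x y" for f
    proof
      have f: "f \<in> Arr K" "Dom K f = x" "Cod K f = y" using that by (auto simp: in_hom_iff)
      {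
        assume *: "far T f = ?b"
        have eq: "t y \<cdot>\<^bsub>L\<^esub> far S f = t y \<cdot>\<^bsub>L\<^esub> b" using nat[of f] f x y b by (simp add: *)
        show "far S f = b"
          by (rule S.trg.iso_cancel_left[OF t[OF y] eq]) (use f b y in simp_all)
      }
      assume *: "far S f = b"
      show "far T f = ?b"
        using f x y b nat[of f] by (simp add: Cmp_square[OF S.trg.category_axioms, of "t y" b "far T f" "t x"] *)
    qed
    ultimately show "\<exists>!f. in_hom K f x y \<and> far S f = b" by blast
  qed
qed

context two_category
begin

lemma representable_simps:
  "pf_ob (representable A I) X = hom_cat A X I"
  "fob (pf_mor (representable A I) c) f = f \<odot> c"
  "far (pf_mor (representable A I) c) s = s \<star> Id2 A c"
  "pf_cell (representable A I) t f = Id2 A f \<star> t"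
  "pf_cpr (representable A I) a b f = Id2 A ((f \<odot> a) \<odot> b)"
  by (simp_all add: representable_def)

lemma cat_valued_representable: "cat_valued (op2 A) (representable A I)"
proof (intro cat_valued.intro two_category_op2 two_category_axioms)
  note [simp] = simps hom_cat_simps Arr_hom_cat op2_simps representable_simps
  have mor: "mor_hom (op2 A) a X Y \<longleftrightarrow> a \<in> Mor A \<and> Src A a = Y \<and> Trg A a = X" for a X Y
    by (auto simp: mor_hom_iff)
  have hom: "in_hom (hom_cat A X I) s f g \<longleftrightarrow> s \<in> Cell A \<and> VDom A s = f \<and> VCod A s = g \<and>
      Src A f = X \<and> Trg A f = I" for X s f g
    by (auto simp: in_hom_iff)
  have precomp: "is_functor (hom_cat A X I) (hom_cat A Y I) (pf_mor (representable A I) a)"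
    if "a \<in> Mor A" "Src A a = Y" "Trg A a = X" for a X Y
    using that
    by (intro is_functor.intro is_functor_axioms.intro category_hom_cat) (auto simp: hom whisker_VComp)
  have iso: "iso_hom (hom_cat A X I) (Id2 A f) f f" if "f \<in> Mor A" "Src A f = X" "Trg A f = I" for f X
    using that category.iso_Idn[OF category_hom_cat, of f X I] by simp
  show "normal_pseudofunctor (op2 A) (representable A I)"
  proof (rule normal_pseudofunctor.intro, goal_cases)
    case 1 show ?case by (simp add: category_hom_cat)
  next
    case (2 a X Y) then show ?case by (simp add: mor precomp)
  next
    case (3 s a b X Y)
    then have s: "s \<in> Cell A" "VDom A s = a" "VCod A s = b" "Src A a = Y" "Trg A a = X"
      by (auto simp: mor cell_hom_iff)
    moreover from this have "a \<in> Mor A" "b \<in> Mor A" "Src A b = Y" "Trg A b = X" by auto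
    ultimately show ?case
      by (intro nat_trans.intro nat_trans_axioms.intro)
        (auto simp: precomp hom HComp_split(1)[of s, symmetric] HComp_split(2)[of s, symmetric])
  next
    case (8 a X Y b Z)
    then have *: "a \<in> Mor A" "Src A a = Y" "Trg A a = X" "b \<in> Mor A" "Src A b = Z" "Trg A b = Y"
      by (auto simp: mor)
    let ?G = "pf_mor (representable A I)"
    have "nat_iso (hom_cat A X I) (hom_cat A Z I) (comp_fctr (?G b) (?G a)) (?G (a \<odot> b))
        (pf_cpr (representable A I) a b)"
    proof (rule nat_isoI)
      show "is_functor (hom_cat A X I) (hom_cat A Z I) (comp_fctr (?G b) (?G a))"
        using * by (intro is_functor_comp[OF precomp precomp]) simp_all
      show "is_functor (hom_cat A X I) (hom_cat A Z I) (?G (a \<odot> b))"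
        using * by (intro precomp) simp_all
    qed (use * in \<open>simp_all add: comp_fctr_def iso\<close>)
    then show ?case by simp
  next
    case (9 s a a' t b b' X Y Z x)
    then have s: "s \<in> Cell A" "VDom A s = a" "VCod A s = a'" "Src A a = Y" "Trg A a = X"
      and t: "t \<in> Cell A" "VDom A t = b" "VCod A t = b'" "Src A b = Z" "Trg A b = Y"
      and x: "x \<in> Mor A" "Src A x = X" "Trg A x = I"
      by (auto simp: mor cell_hom_iff)
    have m: "a \<in> Mor A" "b \<in> Mor A" "a' \<in> Mor A" "b' \<in> Mor A" using s t cell_simps(1,2) by auto
    have "Src A a' = Y" "Trg A a' = X" "Src A b' = Z" "Trg A b' = Y" using s t globular_simps by auto
    with m s t x show ?case
      using HComp_split(2)[of t "Id2 A x \<star> s"] by simp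
  qed (auto simp: mor cell_hom_iff whisker_VComp)
qed

end

section \<open>Bi-representations and universal elements\<close>

text \<open>
  The component at \<open>a\<close> compares \<open>(F a) ((F f) i)\<close> with \<open>(F (f \<odot> a)) i\<close>, so it is a compositor,
  and the axioms of a transformation are those of the compositors.
\<close>

definition yoneda :: "('o, 'm, 't, 'x, 'y) pfun \<Rightarrow> 'x \<Rightarrow> ('o, 'm, 'm, 't, 'x, 'y) pnat" where
  "yoneda F i = \<lparr>pn_ob = (\<lambda>X. evaluation F i), pn_mor = (\<lambda>a f. pf_cpr F f a i)\<rparr>"

context presheaf
begin

lemma transformation_yoneda:
  assumes I: "I \<in> Ob C" and i: "i \<in> Obj (pf_ob F I)"
  shows "transformation (op2 C) (representable C I) F (yoneda F i)"
proof (rule transformationI[OF cat_valued_representable F.cat_valued_axioms])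
  note [simp] = I i simps pf_simps hom_cat_simps Arr_hom_cat op2_simps representable_simps yoneda_def
    evaluation_def
  show "is_functor (pf_ob (representable C I) X) (pf_ob F X) (pn_ob (yoneda F i) X)" if "X \<in> Ob (op2 C)" for X
    using is_functor_evaluation[of X i I] that by simp
  show "iso_hom (pf_ob F Y) (pn_mor (yoneda F i) a f)
        (fob (pf_mor F a) (fob (pn_ob (yoneda F i) X) f))
        (fob (pn_ob (yoneda F i) Y) (fob (pf_mor (representable C I) a) f))"
    if "a \<in> Mor (op2 C)" "Src (op2 C) a = X" "Trg (op2 C) a = Y" "f \<in> Obj (pf_ob (representable C I) X)"
    for a X Y f
    using that iso_cpr[of f a i Y] by simp
  show "pn_mor (yoneda F i) a g \<cdot>\<^bsub>pf_ob F Y\<^esub> far (pf_mor F a) (far (pn_ob (yoneda F i) X) s) =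
      far (pn_ob (yoneda F i) Y) (far (pf_mor (representable C I) a) s) \<cdot>\<^bsub>pf_ob F Y\<^esub> pn_mor (yoneda F i) a f"
    if "a \<in> Mor (op2 C)" "Src (op2 C) a = X" "Trg (op2 C) a = Y" "X \<in> Ob (op2 C)" "Y \<in> Ob (op2 C)"
      "s \<in> Arr (pf_ob (representable C I) X)" "Dom (pf_ob (representable C I) X) s = f"
      "Cod (pf_ob (representable C I) X) s = g" "f \<in> Obj (pf_ob (representable C I) X)"
      "g \<in> Obj (pf_ob (representable C I) X)" for a X Y s f g
    using that cpr_cells[of s f g "Id2 C a" a a I Y i] by simp
  show "pn_mor (yoneda F i) b f \<cdot>\<^bsub>pf_ob F Y\<^esub> pf_cell F s (fob (pn_ob (yoneda F i) X) f) =
      far (pn_ob (yoneda F i) Y) (pf_cell (representable C I) s f) \<cdot>\<^bsub>pf_ob F Y\<^esub> pn_mor (yoneda F i) a f"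
    if "s \<in> Cell (op2 C)" "VDom (op2 C) s = a" "VCod (op2 C) s = b" "a \<in> Mor (op2 C)" "b \<in> Mor (op2 C)"
      "Src (op2 C) a = X" "Trg (op2 C) a = Y" "Src (op2 C) b = X" "Trg (op2 C) b = Y" "X \<in> Ob (op2 C)"
      "Y \<in> Ob (op2 C)" "f \<in> Obj (pf_ob (representable C I) X)" for s a b X Y f
    using that cpr_cells[of "Id2 C f" f f s a b I Y i] by simp
  show "pn_mor (yoneda F i) (Id1 (op2 C) X) f = Idn (pf_ob F X) (fob (pn_ob (yoneda F i) X) f)"
    if "X \<in> Ob (op2 C)" "f \<in> Obj (pf_ob (representable C I) X)" for X f
    using that by simp
  show "pn_mor (yoneda F i) (b \<odot>\<^bsub>op2 C\<^esub> a) f \<cdot>\<^bsub>pf_ob F Z\<^esub> pf_cpr F a b (fob (pn_ob (yoneda F i) X) f) =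
      far (pn_ob (yoneda F i) Z) (pf_cpr (representable C I) a b f) \<cdot>\<^bsub>pf_ob F Z\<^esub>
        (pn_mor (yoneda F i) b (fob (pf_mor (representable C I) a) f) \<cdot>\<^bsub>pf_ob F Z\<^esub>
          far (pf_mor F b) (pn_mor (yoneda F i) a f))"
    if "a \<in> Mor (op2 C)" "b \<in> Mor (op2 C)" "Src (op2 C) a = X" "Trg (op2 C) a = Y" "Src (op2 C) b = Y"
      "Trg (op2 C) b = Z" "X \<in> Ob (op2 C)" "Y \<in> Ob (op2 C)" "Z \<in> Ob (op2 C)"
      "f \<in> Obj (pf_ob (representable C I) X)" for a b X Y Z f
    using that cpr_cocycle[of f a b I Z i] by simp
qed

lemma bi_representation_if_universal_element:
  assumes u: "universal_element C F I i"
  shows "bi_representation C F I (yoneda F i)"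
proof -
  have I: "I \<in> Ob C" and i: "i \<in> Obj (pf_ob F I)" using u by (auto simp: universal_element_def)
  have "pointwise_equivalence (op2 C) (representable C I) F (yoneda F i)"
    using u by (intro pointwise_equivalence.intro pointwise_equivalence_axioms.intro
        transformation_yoneda[OF I i])
      (simp add: universal_element_def yoneda_def representable_simps op2_simps)
  then show ?thesis
    using I by (simp add: bi_representation_def pointwise_equivalence.adjoint_equivalence)
qed

text \<open>
  The components of \<open>\<rho>\<close> at the identity of \<open>I\<close> give an isomorphism between
  \<open>c \<mapsto> (F c) (\<rho> id)\<close> and \<open>c \<mapsto> \<rho> (id \<odot> c) = \<rho> c\<close>, natural in \<open>c\<close>.
\<close>

lemma universal_element_if_bi_representation:
  assumes "bi_representation C F I \<rho>"
  shows "universal_element C F I (fob (pn_ob \<rho> I) (Id1 C I))"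
proof -
  let ?i = "fob (pn_ob \<rho> I) (Id1 C I)"
  from assms have I: "I \<in> Ob C"
    and "pseudonat_adjoint_equivalence (op2 C) (representable C I) F \<rho>"
    by (auto simp: bi_representation_def)
  then interpret \<rho>: pointwise_equivalence "op2 C" "representable C I" F \<rho>
    by (intro pointwise_equivalence_if_adjoint_equivalence cat_valued_representable F.cat_valued_axioms)
  note [simp] = I simps pf_simps hom_cat_simps Arr_hom_cat op2_simps representable_simps
  have i: "?i \<in> Obj (pf_ob F I)" using \<rho>.ob_typing(1)[of I "Id1 C I"] by simp
  show ?thesis
    unfolding universal_element_def
  proof (intro conjI ballI I i)
    fix X assume X: "X \<in> Ob C"
    have "nat_iso (hom_cat C X I) (pf_ob F X) (evaluation F ?i) (pn_ob \<rho> X) (\<lambda>c. pn_mor \<rho> c (Id1 C I))"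
    proof (rule nat_isoI)
      show "is_functor (hom_cat C X I) (pf_ob F X) (evaluation F ?i)"
        by (rule is_functor_evaluation[OF X i])
      show "is_functor (hom_cat C X I) (pf_ob F X) (pn_ob \<rho> X)"
        using \<rho>.ob_functor[of X] X by simp
      show "iso_hom (pf_ob F X) (pn_mor \<rho> c (Id1 C I)) (fob (evaluation F ?i) c) (fob (pn_ob \<rho> X) c)"
        if "c \<in> Obj (hom_cat C X I)" for c
        using \<rho>.iso_mor[of c I X "Id1 C I"] that by (simp add: evaluation_def)
      show "pn_mor \<rho> (Cod (hom_cat C X I) s) (Id1 C I) \<cdot>\<^bsub>pf_ob F X\<^esub> far (evaluation F ?i) s =
        far (pn_ob \<rho> X) s \<cdot>\<^bsub>pf_ob F X\<^esub> pn_mor \<rho> (Dom (hom_cat C X I) s) (Id1 C I)"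
        if "s \<in> Arr (hom_cat C X I)" for s
        using \<rho>.cell_square[of s "VDom C s" I X "Id1 C I"] that by (simp add: evaluation_def)
    qed
    moreover have "cat_equivalence (hom_cat C X I) (pf_ob F X) (pn_ob \<rho> X)"
      using \<rho>.equivalence[of X] X by simp
    ultimately show "cat_equivalence (hom_cat C X I) (pf_ob F X) (evaluation F ?i)"
      by (rule cat_equivalence_nat_iso[rotated])
  qed
qed

end

theorem theorem3:
  fixes C :: "('o, 'm, 't) twocat" and F :: "('o, 'm, 't, 'x, 'y) pfun"
  assumes "two_category C"
    and "normal_pseudofunctor (op2 C) F"
  shows "((\<exists>I \<rho>. bi_representation C F I \<rho>) \<longleftrightarrow>
          (\<exists>I \<in> Ob C. \<exists>i \<in> Obj (pf_ob F I).
            bi_initial (el C F) (I, i) \<and> bi_initial (mor C F) (I, Idn (pf_ob F I) i))) \<and>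
         ((\<exists>I \<in> Ob C. \<exists>i \<in> Obj (pf_ob F I).
            bi_initial (el C F) (I, i) \<and> bi_initial (mor C F) (I, Idn (pf_ob F I) i)) \<longleftrightarrow>
          (\<exists>I \<in> Ob C. \<exists>i \<in> Obj (pf_ob F I). bi_initial (mor C F) (I, Idn (pf_ob F I) i)))"
proof -
  interpret presheaf C F
    by (intro presheaf.intro cat_valued.intro two_category_op2 assms)
  have "(\<exists>\<rho>. bi_representation C F I \<rho>) \<longrightarrow> (\<exists>i. universal_element C F I i)" for I
    using universal_element_if_bi_representation by blast
  moreover have "universal_element C F I i \<longleftrightarrow> I \<in> Ob C \<and> i \<in> Obj (pf_ob F I) \<and>
      bi_initial (el C F) (I, i) \<and> bi_initial (mor C F) (I, Idn (pf_ob F I) i)" for I i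
    using universal_element_if_bi_initial bi_initial_if_universal_element
    by (auto simp: universal_element_def)
  ultimately show ?thesis
    using bi_representation_if_universal_element bi_initial_mor_imp_el by meson
qed

end
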